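(* Let $(M,g)$ be a stably causal spacetime, let $\mathscr{T}$ be the manifold topology and let $J^+_S$ be the Seifert relation. Then $(M,\mathscr{T},J^+_S)$ is quasi-uniformizable and hence admits the Nachbin compactification.
   Context: A spacetime $(M,g)$ is a Hausdorff, connected, paracompact $C^{r+1}$ manifold ($r\ge 0$) with a $C^r$ Lorentzian metric $g$ of signature $(-,+,\dots,+)$, time oriented by the choice of a continuous timelike vector field, whose causal cone is called future. A nonzero tangent vector $v$ is spacelike, lightlike, timelike if $g(v,v)$ is $>0$, $=0$, $<0$; causal means lightlike or timelike. A $C^1$ curve is future directed causal (timelike) if its tangent vectors are all future directed causal (timelike). The causal relation is $J^+=\{(x,y)\in M\times M: \text{there is a future directed causal curve from } x \text{ to } y, \text{ or } x=y\}$; write $J^+_{g'}$ for the causal relation of $(M,g')$. Write $g'>g$ if the timelike cones of $g'$ contain the causal cones of $g$ (with $g'$ time oriented so that future cones contain future cones). The Seifert relation is $J^+_S=\bigcap_{g'>g}J^+_{g'}$; it is a closed preorder on $M$. $(M,g)$ is causal if it contains no closed causal curve, and stably causal if there is $g'>g$ such that $(M,g')$ is causal. A topological preordered space $(E,\mathscr{T},\le)$ is quasi-uniformizable if there is a quasi-uniformity $\mathcal{U}$ on $E$ with $\mathscr{T}=\mathscr{T}(\mathcal{U}^* )$ and $\{(x,y):x\le y\}=\bigcap\mathcal{U}$. Here a quasi-uniformity is a filter $\mathcal{U}$ on $E\times E$ whose elements contain the diagonal and such that for every $V\in\mathcal{U}$ there is $W\in\mathcal{U}$ with $W\circ W\subset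 V$; $\mathcal{U}^*$ is the uniformity given by the sets $V\cap W^{-1}$, $V,W\in\mathcal{U}$; $\mathscr{T}(\mathcal{U}^* )$ is its topology. (Nachbin: this is equivalent to $\mathscr{T}$ being the initial topology of the continuous isotone functions $E\to[0,1]$ together with: $x\le y$ iff $f(x)\le f(y)$ for all such $f$, where isotone means $x\le y\Rightarrow f(x)\le f(y)$.) For an ordered space of this type, the Nachbin compactification is the closure of the image of $E$ under the evaluation map $E\to[0,1]^{F}$, $F$ the set of all continuous isotone functions $E\to[0,1]$, with the topology and order induced from the product; the evaluation map is then a topological and order embedding. *)

theory Defs
  imports "HOL-Analysis.Analysis"
begin

section \<open>Manifolds of class C^k\<close>

text \<open>The set \<open>S\<close> is always open below, so derivatives are taken in the full neighbourhood filter.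
  In finite dimension a map is C^(k+1) iff it is differentiable and all its directional derivatives
  are C^k.\<close>

primrec Ck_on :: "nat \<Rightarrow> ('a::euclidean_space \<Rightarrow> 'b::real_normed_vector) \<Rightarrow> 'a set \<Rightarrow> bool" where
  "Ck_on 0 f S \<longleftrightarrow> continuous_on S f"
| "Ck_on (Suc k) f S \<longleftrightarrow>
     f differentiable_on S \<and> (\<forall>v. Ck_on k (\<lambda>x. frechet_derivative f (at x) v) S)"

definition class_C :: "enat \<Rightarrow> ('a::euclidean_space \<Rightarrow> 'b::real_normed_vector) \<Rightarrow> 'a set \<Rightarrow> bool" where
  "class_C r f S \<longleftrightarrow> (\<forall>k. enat k \<le> r \<longrightarrow> Ck_on k f S)"

text \<open>A chart is a domain together with a coordinate map, whose values off the domain are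
  irrelevant.\<close>

type_synonym ('m, 'n) chart = "'m set \<times> ('m \<Rightarrow> real ^ 'n)"

definition is_chart :: "('m::topological_space, 'n::finite) chart \<Rightarrow> bool" where
  "is_chart c \<longleftrightarrow> open (fst c) \<and> open (snd c ` fst c) \<and>
     homeomorphism (fst c) (snd c ` fst c) (snd c) (inv_into (fst c) (snd c))"

definition transition :: "('m, 'n::finite) chart \<Rightarrow> ('m, 'n) chart \<Rightarrow> real ^ 'n \<Rightarrow> real ^ 'n" where
  "transition c d = snd d \<circ> inv_into (fst c) (snd c)"

definition is_atlas :: "enat \<Rightarrow> ('m::topological_space, 'n::finite) chart set \<Rightarrow> bool" where
  "is_atlas k A \<longleftrightarrow> (\<forall>c\<in>A. is_chart c) \<and> (\<Union>c\<in>A. fst c) = UNIV \<and>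
     (\<forall>c\<in>A. \<forall>d\<in>A. class_C k (transition c d) (snd c ` (fst c \<inter> fst d)))"

definition paracompact_space :: "'a topology \<Rightarrow> bool" where
  "paracompact_space X \<longleftrightarrow>
     (\<forall>\<U>. (\<forall>U\<in>\<U>. openin X U) \<and> \<Union>\<U> = topspace X \<longrightarrow>
        (\<exists>\<V>. (\<forall>V\<in>\<V>. openin X V) \<and> \<Union>\<V> = topspace X \<and>
             (\<forall>V\<in>\<V>. \<exists>U\<in>\<U>. V \<subseteq> U) \<and> locally_finite_in X \<V>))"

section \<open>Tangent vectors\<close>

text \<open>A tangent vector at \<open>p\<close> is the family of its components in the charts around \<open>p\<close>, related by the
  Jacobians of the transition maps (and, for uniqueness, zero at all other charts).\<close>

type_synonym ('m, 'n) tangent = "('m, 'n) chart \<Rightarrow> real ^ 'n"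

definition tangent_space :: "('m, 'n::finite) chart set \<Rightarrow> 'm \<Rightarrow> ('m, 'n) tangent set" where
  "tangent_space A p = {v.
     (\<forall>c. \<not> (c \<in> A \<and> p \<in> fst c) \<longrightarrow> v c = 0) \<and>
     (\<forall>c\<in>A. \<forall>d\<in>A. p \<in> fst c \<longrightarrow> p \<in> fst d \<longrightarrow>
        v d = frechet_derivative (transition c d) (at (snd c p)) (v c))}"

text \<open>The tangent vector at \<open>p\<close> whose component in the chart \<open>c\<close> is \<open>a\<close>.\<close>

definition chart_vector ::
  "('m, 'n::finite) chart set \<Rightarrow> ('m, 'n) chart \<Rightarrow> 'm \<Rightarrow> real ^ 'n \<Rightarrow> ('m, 'n) tangent" where
  "chart_vector A c p a = (\<lambda>d. if d \<in> A \<and> p \<in> fst d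
     then frechet_derivative (transition c d) (at (snd c p)) a else 0)"

section \<open>Lorentzian metrics and spacetimes\<close>

type_synonym ('m, 'n) metric = "'m \<Rightarrow> ('m, 'n) tangent \<Rightarrow> ('m, 'n) tangent \<Rightarrow> real"

definition lorentzian_form :: "(real ^ 'n::finite \<Rightarrow> real ^ 'n \<Rightarrow> real) \<Rightarrow> bool" where
  "lorentzian_form h \<longleftrightarrow> bilinear h \<and> (\<forall>a b. h a b = h b a) \<and>
     (\<exists>(e :: 'n \<Rightarrow> real ^ 'n) i0. inj e \<and> independent (range e) \<and>
        (\<forall>i j. h (e i) (e j) = (if i \<noteq> j then 0 else if i = i0 then -1 else 1)))"

definition lorentzian_metric ::
  "enat \<Rightarrow> ('m::topological_space, 'n::finite) chart set \<Rightarrow> ('m, 'n) metric \<Rightarrow> bool" where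
  "lorentzian_metric r A g \<longleftrightarrow> (\<forall>c\<in>A.
     (\<forall>p\<in>fst c. lorentzian_form (\<lambda>a b. g p (chart_vector A c p a) (chart_vector A c p b))) \<and>
     (\<forall>a b. class_C r
        (\<lambda>x. let p = inv_into (fst c) (snd c) x
             in g p (chart_vector A c p a) (chart_vector A c p b)) (snd c ` fst c)))"

definition time_orientation ::
  "('m::topological_space, 'n::finite) chart set \<Rightarrow> ('m, 'n) metric \<Rightarrow> ('m \<Rightarrow> ('m, 'n) tangent) \<Rightarrow> bool"
  where
  "time_orientation A g T \<longleftrightarrow> (\<forall>p. T p \<in> tangent_space A p \<and> g p (T p) (T p) < 0) \<and>
     (\<forall>c\<in>A. continuous_on (fst c) (\<lambda>p. T p c))"

text \<open>Hausdorffness is provided by the type class; all charts take values in the same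
  Euclidean space.\<close>

definition spacetime ::
  "enat \<Rightarrow> ('m::t2_space, 'n::finite) chart set \<Rightarrow> ('m, 'n) metric \<Rightarrow> ('m \<Rightarrow> ('m, 'n) tangent) \<Rightarrow> bool"
  where
  "spacetime r A g T \<longleftrightarrow>
     connected (UNIV :: 'm set) \<and> paracompact_space (euclidean :: 'm topology) \<and>
     is_atlas (eSuc r) A \<and> lorentzian_metric r A g \<and> time_orientation A g T"

section \<open>Causality\<close>

text \<open>A causal vector \<open>v\<close> lies in the same half of the causal cone as the timelike vector
  \<open>T p\<close> iff \<open>g p v (T p) < 0\<close>.\<close>

definition future_causal :: "('m, 'n::finite) chart set \<Rightarrow> ('m, 'n) metric \<Rightarrow> ('m \<Rightarrow> ('m, 'n) tangent)
    \<Rightarrow> 'm \<Rightarrow> ('m, 'n) tangent set" where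
  "future_causal A g T p =
     {v \<in> tangent_space A p. v \<noteq> (\<lambda>_. 0) \<and> g p v v \<le> 0 \<and> g p v (T p) < 0}"

definition future_timelike :: "('m, 'n::finite) chart set \<Rightarrow> ('m, 'n) metric \<Rightarrow> ('m \<Rightarrow> ('m, 'n) tangent)
    \<Rightarrow> 'm \<Rightarrow> ('m, 'n) tangent set" where
  "future_timelike A g T p =
     {v \<in> tangent_space A p. v \<noteq> (\<lambda>_. 0) \<and> g p v v < 0 \<and> g p v (T p) < 0}"

definition C1_curve :: "('m::topological_space, 'n::finite) chart set \<Rightarrow> real \<Rightarrow> real \<Rightarrow> (real \<Rightarrow> 'm) \<Rightarrow> bool"
  where
  "C1_curve A a b \<gamma> \<longleftrightarrow> continuous_on {a..b} \<gamma> \<and>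
     (\<forall>c\<in>A. (\<forall>t\<in>{a..b}. \<gamma> t \<in> fst c \<longrightarrow> (snd c \<circ> \<gamma>) differentiable (at t within {a..b})) \<and>
        continuous_on {t \<in> {a..b}. \<gamma> t \<in> fst c}
          (\<lambda>t. vector_derivative (snd c \<circ> \<gamma>) (at t within {a..b})))"

definition velocity ::
  "('m, 'n::finite) chart set \<Rightarrow> real \<Rightarrow> real \<Rightarrow> (real \<Rightarrow> 'm) \<Rightarrow> real \<Rightarrow> ('m, 'n) tangent" where
  "velocity A a b \<gamma> t = (\<lambda>c. if c \<in> A \<and> \<gamma> t \<in> fst c
     then vector_derivative (snd c \<circ> \<gamma>) (at t within {a..b}) else 0)"

definition future_causal_curve :: "('m::topological_space, 'n::finite) chart set \<Rightarrow> ('m, 'n) metric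
    \<Rightarrow> ('m \<Rightarrow> ('m, 'n) tangent) \<Rightarrow> real \<Rightarrow> real \<Rightarrow> (real \<Rightarrow> 'm) \<Rightarrow> bool" where
  "future_causal_curve A g T a b \<gamma> \<longleftrightarrow> a < b \<and> C1_curve A a b \<gamma> \<and>
     (\<forall>t\<in>{a..b}. velocity A a b \<gamma> t \<in> future_causal A g T (\<gamma> t))"

definition causal_relation :: "('m::topological_space, 'n::finite) chart set \<Rightarrow> ('m, 'n) metric
    \<Rightarrow> ('m \<Rightarrow> ('m, 'n) tangent) \<Rightarrow> ('m \<times> 'm) set" where
  "causal_relation A g T = {(x, y).
     (\<exists>a b \<gamma>. future_causal_curve A g T a b \<gamma> \<and> \<gamma> a = x \<and> \<gamma> b = y) \<or> x = y}"

definition causal :: "('m::topological_space, 'n::finite) chart set \<Rightarrow> ('m, 'n) metric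
    \<Rightarrow> ('m \<Rightarrow> ('m, 'n) tangent) \<Rightarrow> bool" where
  "causal A g T \<longleftrightarrow> (\<nexists>a b \<gamma>. future_causal_curve A g T a b \<gamma> \<and> \<gamma> a = \<gamma> b)"

text \<open>\<open>(g', T')\<close> is a time oriented metric with \<open>g' > g\<close>; past cones are the negatives of future
  cones, so it suffices to compare the latter.\<close>

definition wider :: "enat \<Rightarrow> ('m::t2_space, 'n::finite) chart set
    \<Rightarrow> ('m, 'n) metric \<Rightarrow> ('m \<Rightarrow> ('m, 'n) tangent)
    \<Rightarrow> ('m, 'n) metric \<Rightarrow> ('m \<Rightarrow> ('m, 'n) tangent) \<Rightarrow> bool" where
  "wider r A g' T' g T \<longleftrightarrow> spacetime r A g' T' \<and>
     (\<forall>p. future_causal A g T p \<subseteq> future_timelike A g' T' p)"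

definition seifert_relation :: "enat \<Rightarrow> ('m::t2_space, 'n::finite) chart set
    \<Rightarrow> ('m, 'n) metric \<Rightarrow> ('m \<Rightarrow> ('m, 'n) tangent) \<Rightarrow> ('m \<times> 'm) set" where
  "seifert_relation r A g T =
     \<Inter> {causal_relation A g' T' | g' T'. wider r A g' T' g T}"

definition stably_causal :: "enat \<Rightarrow> ('m::t2_space, 'n::finite) chart set
    \<Rightarrow> ('m, 'n) metric \<Rightarrow> ('m \<Rightarrow> ('m, 'n) tangent) \<Rightarrow> bool" where
  "stably_causal r A g T \<longleftrightarrow> (\<exists>g' T'. wider r A g' T' g T \<and> causal A g' T')"

section \<open>Quasi-uniformities\<close>

text \<open>An entourage \<open>V\<close> is given by its characteristic predicate.\<close>

definition quasi_uniformity :: "('a \<times> 'a) filter \<Rightarrow> bool" where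
  "quasi_uniformity U \<longleftrightarrow>
     (\<forall>V. eventually V U \<longrightarrow> (\<forall>x. V (x, x))) \<and>
     (\<forall>V. eventually V U \<longrightarrow>
        (\<exists>W. eventually W U \<and> (\<forall>x y z. W (x, y) \<longrightarrow> W (y, z) \<longrightarrow> V (x, z))))"

text \<open>By the definition of \<open>inf\<close> on filters, the following is the filter of all supersets of the
  sets \<open>V \<inter> W\<inverse>\<close> with \<open>V\<close>, \<open>W\<close> in \<open>U\<close>.\<close>

definition symmetrized :: "('a \<times> 'a) filter \<Rightarrow> ('a \<times> 'a) filter" where
  "symmetrized U = inf U (filtermap prod.swap U)"

definition quasi_uniformizable :: "('a::topological_space \<times> 'a) set \<Rightarrow> bool" where
  "quasi_uniformizable R \<longleftrightarrow> (\<exists>U. quasi_uniformity U \<and>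
     (\<forall>S :: 'a set. open S \<longleftrightarrow>
        (\<forall>x\<in>S. eventually (\<lambda>(x', y). x' = x \<longrightarrow> y \<in> S) (symmetrized U))) \<and>
     R = \<Inter> {{z. V z} | V. eventually V U})"

section \<open>The Nachbin compactification\<close>

definition isotone_functions :: "('a::topological_space \<times> 'a) set \<Rightarrow> ('a \<Rightarrow> real) set" where
  "isotone_functions R =
     {f. continuous_on UNIV f \<and> range f \<subseteq> {0..1} \<and> (\<forall>x y. (x, y) \<in> R \<longrightarrow> f x \<le> f y)}"

definition nachbin_cube :: "('a::topological_space \<times> 'a) set \<Rightarrow> (('a \<Rightarrow> real) \<Rightarrow> real) topology" where
  "nachbin_cube R = product_topology (\<lambda>_. top_of_set {0..1}) (isotone_functions R)"

definition nachbin_eval :: "('a::topological_space \<times> 'a) set \<Rightarrow> 'a \<Rightarrow> ('a \<Rightarrow> real) \<Rightarrow> real" where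
  "nachbin_eval R x = (\<lambda>f\<in>isotone_functions R. f x)"

definition nachbin_space :: "('a::topological_space \<times> 'a) set \<Rightarrow> (('a \<Rightarrow> real) \<Rightarrow> real) topology" where
  "nachbin_space R = subtopology (nachbin_cube R) (nachbin_cube R closure_of range (nachbin_eval R))"

definition nachbin_order ::
  "('a::topological_space \<times> 'a) set \<Rightarrow> ((('a \<Rightarrow> real) \<Rightarrow> real) \<times> (('a \<Rightarrow> real) \<Rightarrow> real)) set" where
  "nachbin_order R = {(u, v). u \<in> topspace (nachbin_space R) \<and> v \<in> topspace (nachbin_space R) \<and>
     (\<forall>f\<in>isotone_functions R. u f \<le> v f)}"

definition admits_nachbin_compactification :: "('a::topological_space \<times> 'a) set \<Rightarrow> bool" where
  "admits_nachbin_compactification R \<longleftrightarrow>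
     partial_order_on UNIV R \<and>
     compact_space (nachbin_space R) \<and>
     nachbin_space R closure_of range (nachbin_eval R) = topspace (nachbin_space R) \<and>
     embedding_map euclidean (nachbin_space R) (nachbin_eval R) \<and>
     (\<forall>x y. (x, y) \<in> R \<longleftrightarrow> (nachbin_eval R x, nachbin_eval R y) \<in> nachbin_order R)"

end

theory Submission
  imports Defs
begin

text \<open>Write \<open>J h\<close> for the causal relation of a metric \<open>h\<close> and \<open>Q\<close> for the Seifert relation of \<open>g\<close>, the
intersection of all \<open>J g'\<close> with \<open>g' > g\<close>. Between \<open>g\<close> and any \<open>g' > g\<close> lie the metrics
\<open>g_s = (1 - s) g + s g'\<close> with \<open>0 < s < 1\<close>, whose causal cones widen strictly with \<open>s\<close>
(\<open>wider_interpolated\<close>). Concatenating \<open>C\<^sup>1\<close> causal curves produces a corner, and a limit of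
pairs of end points need not be joined by a causal curve; both defects can be repaired at the cost of
passing to a slightly wider metric. By compactness of the unit sphere, a vector near a causal vector of \<open>g_s\<close>, even at a nearby base
point, is causal for \<open>g_t\<close>, \<open>t > s\<close> (\<open>robust_cone\<close>). Hence corners can be rounded
(\<open>causal_curve_join_at_0\<close>), and curves can be composed with a map close to the identity that
moves one end point (\<open>push_diffeomorphism\<close>). For the relations this says, for \<open>s < t\<close>,
\<open>J g_s O J g_s \<subseteq> J g_t\<close> and \<open>closure (J g_s) \<subseteq> J g_t\<close>.

Therefore \<open>Q\<close> is a preorder, and it is antisymmetric as soon as some \<open>g' > g\<close> is causal.

Continuous isotone functions come directly from the scale \<open>g_s\<close>. Let
\<open>K s\<close> be compact neighbourhoods of a point \<open>x\<close> that grow with \<open>s\<close>. The closure of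
\<open>J g_s `` K s\<close> lies in the interior of \<open>J g_t `` K t\<close> for \<open>s < t\<close>, so the function
\<open>y \<mapsto> inf {s. y \<in> J g_s `` K s}\<close> is continuous; it decreases along \<open>Q\<close> because
\<open>Q \<subseteq> J g_s\<close> (\<open>antitone_function\<close>). One minus this function is an isotone function equal to 1 at
\<open>x\<close> and positive only in the \<open>g'\<close>-causal future of a small neighbourhood of \<open>x\<close>
(\<open>future_function\<close>); reversing time gives its mirror image (\<open>past_function\<close>).

If \<open>(x, y) \<notin> Q\<close>, some \<open>g' > g\<close> has no causal curve from near \<open>x\<close> to \<open>y\<close>, and the future
function separates \<open>x\<close> from \<open>y\<close>. If \<open>g\<close> is stably causal, points lying both in the future and in
the past of a small neighbourhood of \<open>x\<close> are close to \<open>x\<close>, since otherwise a limit of causal loops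
crossing a fixed sphere around \<open>x\<close> would give a closed causal curve (\<open>stable_strong_causality\<close>);
so the future and the past function together cut out a small neighbourhood of \<open>x\<close>. Isotone functions thus
determine both order and topology, which is Nachbin's criterion for a quasi-uniformity and for the
embedding into the cube.\<close>

section \<open>Isotone functions from nested families of sets\<close>

text \<open>The infimum of the indices of the sets containing \<open>x\<close>, cut off at 1. Its strict sublevel sets are
unions of interiors and its strict superlevel sets unions of complements of closures, whence
continuity. This is the last step of Urysohn's lemma, applied to a scale that is already given.\<close>

lemma nested_family_function:
  fixes C :: "real \<Rightarrow> 'a::topological_space set"
  assumes nest: "\<And>s t. 0 < s \<Longrightarrow> s < t \<Longrightarrow> t < 1 \<Longrightarrow> closure (C s) \<subseteq> interior (C t)"
  obtains f :: "'a \<Rightarrow> real" where "continuous_on UNIV f" "range f \<subseteq> {0..1}"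
    "\<And>x a. a \<le> 1 \<Longrightarrow> f x < a \<longleftrightarrow> (\<exists>s. 0 < s \<and> s < a \<and> x \<in> C s)"
proof -
  define D where "D x = insert 1 {s. 0 < s \<and> s < 1 \<and> x \<in> C s}" for x
  define f where "f x = Inf (D x)" for x
  have bdd: "bdd_below (D x)" for x by (rule bdd_belowI[of _ 0]) (auto simp: D_def)
  have ne: "D x \<noteq> {}" for x by (simp add: D_def)
  have lo: "0 \<le> f x" for x unfolding f_def by (rule cInf_greatest[OF ne]) (auto simp: D_def)
  have hi: "f x \<le> 1" for x unfolding f_def by (rule cInf_lower[OF _ bdd]) (simp add: D_def)
  have lt: "f x < a \<longleftrightarrow> (\<exists>s. 0 < s \<and> s < a \<and> x \<in> C s)" if "a \<le> 1" for x a
    using that unfolding f_def cInf_less_iff[OF ne bdd] by (auto simp: D_def)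
  have mono: "C s \<subseteq> C t" if "0 < s" "s < t" "t < 1" for s t
    using nest[OF that] closure_subset interior_subset by blast
  have 1: "\<forall>\<^sub>F y in at x. f y < a" if fx: "f x < a" for x a
  proof (cases "a \<le> 1")
    case True
    then obtain s where s: "0 < s" "s < a" "x \<in> C s" using fx lt by blast
    \<comment> \<open>Strictly between \<open>s\<close> and \<open>a\<close>, so that the interior of \<open>C t\<close> is a neighbourhood on which \<open>f < a\<close>.\<close>
    define t where "t = (s + a) / 2"
    have t: "s < t" "t < a" "t < 1" using s True by (auto simp: t_def)
    have "x \<in> interior (C t)" using nest[OF s(1) t(1,3)] s(3) closure_subset by blast
    moreover have "f y < a" if "y \<in> interior (C t)" for y
      using lt[OF True, of y] interior_subset that s t by (meson order.strict_trans subsetD)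
    ultimately show ?thesis unfolding eventually_at_topological
      by (meson open_interior)
  next
    case False
    then have "f y < a" for y using hi[of y] by simp
    then show ?thesis by simp
  qed
  have 2: "\<forall>\<^sub>F y in at x. a < f y" if "a < f x" for x a
  proof (cases "0 \<le> a")
    case True
    define m where "m = (a + f x) / 2"
    define t where "t = (a + m) / 2"
    have m: "a < t" "t < m" "m < f x" "f x \<le> 1" using that hi by (auto simp: m_def t_def field_simps)
    have "x \<notin> C m" using lt[of "f x" x] m True by (meson less_le_trans less_irrefl le_less_trans less_trans)
    then have "x \<notin> closure (C t)" using nest[of t m] m True interior_subset[of "C m"] by auto
    moreover have "a < f y" if "y \<notin> closure (C t)" for y
    proof (rule ccontr)
      assume "\<not> a < f y"
      then have "f y < t" using m by simp
      then obtain s where s: "0 < s" "s < t" "y \<in> C s" using lt[of t y] m by auto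
      then have "y \<in> C t" using mono[of s t] m by auto
      then show False using that closure_subset by blast
    qed
    ultimately show ?thesis unfolding eventually_at_topological
      by (meson ComplD ComplI closed_closure open_Compl)
  next
    case False
    then have "a < f y" for y using lo[of y] by simp
    then show ?thesis by simp
  qed
  have "continuous_on UNIV f"
    unfolding continuous_on_def
    by (auto intro: order_tendstoI 1 2)
  then show thesis using that[of f] lo hi lt by (auto simp: image_subset_iff)
qed

lemma closed_Image_compact:
  fixes R :: "('a::topological_space \<times> 'b::topological_space) set"
  assumes "closed R" "compact K"
  shows "closed (R `` K)"
proof -
  have "closed_map (prod_topology (top_of_set K) euclidean) euclidean (snd :: 'a \<times> 'b \<Rightarrow> 'b)"
    using assms(2) by (intro closed_map_snd) (simp add: compact_space_subtopology)
  moreover have "closedin (prod_topology (top_of_set K) euclidean) (R \<inter> K \<times> UNIV)"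
  proof -
    have "prod_topology (top_of_set K) (euclidean :: 'b topology) = top_of_set (K \<times> UNIV)"
      by (simp add: euclidean_product_topology prod_topology_subtopology)
    moreover have "closedin (top_of_set (K \<times> UNIV)) (R \<inter> K \<times> UNIV)"
      unfolding closedin_closed using assms(1) by blast
    ultimately show ?thesis by simp
  qed
  ultimately have "closed (snd ` (R \<inter> K \<times> UNIV))"
    unfolding closed_map_def by auto
  moreover have "snd ` (R \<inter> K \<times> UNIV) = R `` K" by force
  ultimately show ?thesis by simp
qed

text \<open>Two points of a pair can be moved independently at the cost of passing from \<open>R\<close> to \<open>S\<close>.
One condition covers two facts about causal relations: limits of \<open>R\<close>-related pairs are
\<open>S\<close>-related, and \<open>S\<close> is a neighbourhood of each off-diagonal pair in \<open>R\<close>. The diagonal is excluded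
since a point need not have neighbours in its future on all sides.\<close>

definition perturbable :: "('a::topological_space \<times> 'a) set \<Rightarrow> ('a \<times> 'a) set \<Rightarrow> bool" where
  "perturbable R S \<longleftrightarrow> (\<forall>x y. x \<noteq> y \<longrightarrow> (\<exists>N N'. open N \<and> open N' \<and> x \<in> N \<and> y \<in> N' \<and>
      (R \<inter> N \<times> N' \<noteq> {} \<longrightarrow> N \<times> N' \<subseteq> S)))"

lemma perturbableE:
  assumes "perturbable R S" "x \<noteq> y"
  obtains N N' where "open N" "open N'" "x \<in> N" "y \<in> N'" "R \<inter> N \<times> N' \<noteq> {} \<Longrightarrow> N \<times> N' \<subseteq> S"
  using assms unfolding perturbable_def by meson

lemma perturbable_closure:
  assumes "perturbable R S" "refl S"
  shows "closure R \<subseteq> S"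
proof (rule subrelI)
  fix x y assume c: "(x, y) \<in> closure R"
  show "(x, y) \<in> S"
  proof (cases "x = y")
    case False
    obtain N N' where N: "open N" "open N'" "x \<in> N" "y \<in> N'"
      and RS: "R \<inter> N \<times> N' \<noteq> {} \<Longrightarrow> N \<times> N' \<subseteq> S"
      using perturbableE[OF assms(1) False] by blast
    have "R \<inter> N \<times> N' \<noteq> {}"
      using c N open_Int_closure_eq_empty[of "N \<times> N'" R] by (auto simp: open_Times Int_commute)
    then show ?thesis using RS N by auto
  qed (use assms(2) in \<open>auto simp: refl_on_def\<close>)
qed

lemma perturbable_converse: "perturbable (R\<inverse>) (S\<inverse>)" if RS: "perturbable R S"
  unfolding perturbable_def
proof (intro allI impI)
  fix x y :: 'a assume "x \<noteq> y"
  then obtain N N' where "open N" "open N'" "y \<in> N" "x \<in> N'" and *: "R \<inter> N \<times> N' \<noteq> {} \<Longrightarrow> N \<times> N' \<subseteq> S"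
    using perturbableE[OF RS, of y x] by blast
  moreover have "N' \<times> N \<subseteq> S\<inverse>" if "R\<inverse> \<inter> N' \<times> N \<noteq> {}"
    using * that by blast
  ultimately show "\<exists>N N'. open N \<and> open N' \<and> x \<in> N \<and> y \<in> N' \<and> (R\<inverse> \<inter> N \<times> N' \<noteq> {} \<longrightarrow> N \<times> N' \<subseteq> S\<inverse>)"
    by blast
qed

text \<open>The sets \<open>R s `` K s\<close> form a scale: a limit of points of \<open>R s `` K s\<close> is \<open>R m\<close>-related to a
point of the compact set \<open>K s\<close> for any \<open>m > s\<close>; if that point is the limit itself, the interior of
\<open>K t\<close> is a neighbourhood of it, and otherwise perturbation of the target supplies one.\<close>

lemma antitone_function:
  fixes Q :: "('a::topological_space \<times> 'a) set" and R :: "real \<Rightarrow> ('a \<times> 'a) set"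
  assumes refl: "\<And>s. refl (R s)"
    and Q: "\<And>s. 0 < s \<Longrightarrow> s < 1 \<Longrightarrow> Q \<subseteq> R s"
    and comp: "\<And>s t. 0 < s \<Longrightarrow> s < t \<Longrightarrow> t < 1 \<Longrightarrow> R s O R s \<subseteq> R t"
    and pert: "\<And>s t. 0 < s \<Longrightarrow> s < t \<Longrightarrow> t < 1 \<Longrightarrow> perturbable (R s) (R t)"
    and K: "\<And>s. 0 < s \<Longrightarrow> s < 1 \<Longrightarrow> compact (K s)"
    and K_nest: "\<And>s t. 0 < s \<Longrightarrow> s < t \<Longrightarrow> t < 1 \<Longrightarrow> K s \<subseteq> interior (K t)"
  obtains f :: "'a \<Rightarrow> real" where "continuous_on UNIV f" "range f \<subseteq> {0..1}"
    "\<And>x y. (x, y) \<in> Q \<Longrightarrow> f y \<le> f x"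
    "\<And>x. \<forall>s\<in>{0<..<1}. x \<in> K s \<Longrightarrow> f x = 0"
    "\<And>x. \<forall>s\<in>{0<..<1}. x \<notin> R s `` K s \<Longrightarrow> f x = 1"
proof -
  define C where "C s = R s `` K s" for s
  have mono: "R s \<subseteq> R t" if "0 < s" "s < t" "t < 1" for s t
    using comp[OF that] refl[of s] by (auto simp: refl_on_def)
  have KC: "K s \<subseteq> C s" for s using refl[of s] by (auto simp: C_def refl_on_def)
  have nest: "closure (C s) \<subseteq> interior (C t)" if st: "0 < s" "s < t" "t < 1" for s t
  proof
    fix y assume y: "y \<in> closure (C s)"
    define m where "m = (s + t) / 2"
    have m: "s < m" "m < t" "0 < m" "m < 1" "s < 1" using st by (auto simp: m_def)
    have "closed (closure (R s) `` K s)" using K st m by (intro closed_Image_compact) auto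
    moreover have "C s \<subseteq> closure (R s) `` K s" unfolding C_def using closure_subset by blast
    ultimately have "closure (C s) \<subseteq> closure (R s) `` K s" by (rule closure_minimal[rotated])
    also have "\<dots> \<subseteq> R m `` K s"
      using perturbable_closure[OF pert[of s m] refl] st m by auto
    finally obtain x where x: "x \<in> K s" "(x, y) \<in> R m" using y by auto
    show "y \<in> interior (C t)"
    proof (cases "x = y")
      case True
      then show ?thesis using K_nest[OF st] x interior_mono[OF KC, of t] by auto
    next
      case False
      then obtain N N' where "open N'" "y \<in> N'" "x \<in> N" "R m \<inter> N \<times> N' \<noteq> {} \<Longrightarrow> N \<times> N' \<subseteq> R t"
        using perturbableE[OF pert[of m t]] m st by metis
      moreover have "x \<in> K t" using x K_nest[OF st] interior_subset by auto
      ultimately have "N' \<subseteq> C t" using x(2) unfolding C_def by blast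
      then show ?thesis using \<open>open N'\<close> \<open>y \<in> N'\<close> by (meson interiorI)
    qed
  qed
  obtain f where f: "continuous_on UNIV f" "range f \<subseteq> {0..1}"
    and lt: "\<And>x a. a \<le> 1 \<Longrightarrow> f x < a \<longleftrightarrow> (\<exists>s. 0 < s \<and> s < a \<and> x \<in> C s)"
    by (rule nested_family_function[of C, OF nest]) blast+
  have "f y \<le> f x" if xy: "(x, y) \<in> Q" for x y
  proof (rule ccontr)
    assume "\<not> f y \<le> f x"
    moreover have "f y \<le> 1" using f(2) by (simp add: image_subset_iff)
    ultimately obtain s where s: "0 < s" "s < f y" "x \<in> C s"
      using lt[of "f y" x] by auto
    define t where "t = (s + f y) / 2"
    have t: "s < t" "t < f y" "t < 1" "s < 1" using s \<open>f y \<le> 1\<close> by (auto simp: t_def)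
    obtain z where "z \<in> K s" "(z, x) \<in> R s" using s by (auto simp: C_def)
    then have "(z, y) \<in> R t" using comp[of s t] Q[of s] xy s t by blast
    moreover have "z \<in> K t" using K_nest[of s t] s t interior_subset \<open>z \<in> K s\<close> by blast
    ultimately have "y \<in> C t" by (auto simp: C_def)
    then show False using lt[of "f y" y] t s \<open>f y \<le> 1\<close> by auto
  qed
  moreover have "f x = 0" if K0: "\<forall>s\<in>{0<..<1}. x \<in> K s" for x
  proof (rule ccontr)
    assume "f x \<noteq> 0"
    moreover have "0 \<le> f x" "f x \<le> 1" using f(2) by (simp_all add: image_subset_iff)
    ultimately have half: "f x / 2 < f x" "0 < f x / 2" "f x / 2 < 1" by auto
    then have "x \<in> K (f x / 2)" using K0 by simp
    then have "x \<in> C (f x / 2)" using KC by blast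
    then show False using lt[of "f x" x] half \<open>f x \<le> 1\<close> by blast
  qed
  moreover have "f x = 1" if none: "\<forall>s\<in>{0<..<1}. x \<notin> R s `` K s" for x
  proof -
    have "\<not> f x < 1" using lt[of 1 x] none by (auto simp: C_def)
    moreover have "f x \<le> 1" using f(2) by (simp add: image_subset_iff)
    ultimately show ?thesis by simp
  qed
  ultimately show thesis using that[of f] f by blast
qed

section \<open>Nachbin's criterion\<close>

lemma isotone_functions_cts: "f \<in> isotone_functions R \<Longrightarrow> continuous_on UNIV f"
  and isotone_functions_range: "f \<in> isotone_functions R \<Longrightarrow> f x \<in> {0..1}"
  and isotone_functions_mono: "f \<in> isotone_functions R \<Longrightarrow> (x, y) \<in> R \<Longrightarrow> f x \<le> f y"
  unfolding isotone_functions_def by blast+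

text \<open>The entourages are generated by the sets \<open>f x < f y + e\<close> with \<open>f\<close> isotone and \<open>e > 0\<close>. Their
intersection is the order because isotone functions detect it; the symmetrized topology is the
initial topology of the isotone functions, which the second hypothesis makes as fine as the given one.\<close>

lemma quasi_uniformizable_isotone:
  fixes R :: "('a::topological_space \<times> 'a) set"
  assumes sep: "\<And>x y. (x, y) \<notin> R \<Longrightarrow> \<exists>f \<in> isotone_functions R. f y < f x"
    and init: "\<And>x S. open S \<Longrightarrow> x \<in> S \<Longrightarrow> \<exists>f \<in> isotone_functions R. \<exists>h \<in> isotone_functions R.
       f x = 1 \<and> h x = 0 \<and> {y. 0 < f y \<and> h y < 1} \<subseteq> S"
  shows "quasi_uniformizable R"
proof -
  define V where "V = (\<lambda>(F, e::real). {(x, y). \<forall>f\<in>F. f x < f y + e} :: ('a \<times> 'a) set)"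
  define I where "I = {F. finite F \<and> F \<subseteq> isotone_functions R} \<times> {0::real<..}"
  define U where "U = (INF i\<in>I. principal (V i))"
  have I_ne: "I \<noteq> {}" by (auto simp: I_def intro!: exI[of _ "{}"] exI[of _ 1])
  have dir: "\<exists>k\<in>I. V k \<le> V i \<and> V k \<le> V j" if "i \<in> I" "j \<in> I" for i j
  proof -
    obtain F d G e where ij: "i = (F, d)" "j = (G, e)" by force
    have "(x, y) \<in> V i \<and> (x, y) \<in> V j" if xy: "(x, y) \<in> V (F \<union> G, min d e)" for x y
    proof -
      have less: "f x < f y + min d e" if "f \<in> F \<union> G" for f using xy that unfolding V_def by blast
      then have "f x < f y + d \<and> f x < f y + e" if "f \<in> F \<union> G" for f
        using less[OF that] by linarith
      then show ?thesis by (simp add: ij V_def)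
    qed
    then have "V (F \<union> G, min d e) \<le> V i" "V (F \<union> G, min d e) \<le> V j" by auto
    moreover have "(F \<union> G, min d e) \<in> I" using that unfolding ij I_def by auto
    ultimately show ?thesis by blast
  qed
  have ev: "eventually P U \<longleftrightarrow> (\<exists>i\<in>I. \<forall>z\<in>V i. P z)" for P
    unfolding U_def
    by (subst eventually_INF_base[OF I_ne]) (use dir in \<open>auto simp: eventually_principal\<close>)
  have evV: "eventually (\<lambda>z. z \<in> V i) U" if "i \<in> I" for i using that ev by blast
  have qu: "quasi_uniformity U"
    unfolding quasi_uniformity_def
  proof (intro conjI allI impI)
    fix P and x :: 'a assume "eventually P U"
    then show "P (x, x)" by (auto simp: ev V_def I_def)
  next
    fix P assume "eventually P U"
    then obtain F e where i: "(F, e) \<in> I" "\<forall>z\<in>V (F, e). P z" by (auto simp: ev)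
    have "P (x, z)" if "(x, y) \<in> V (F, e / 2)" "(y, z) \<in> V (F, e / 2)" for x y z
    proof -
      have "(x, z) \<in> V (F, e)" using that by (fastforce simp: V_def)
      then show ?thesis using i by blast
    qed
    moreover have "(F, e / 2) \<in> I" using i by (auto simp: I_def)
    ultimately show "\<exists>W. eventually W U \<and> (\<forall>x y z. W (x, y) \<longrightarrow> W (y, z) \<longrightarrow> P (x, z))"
      using evV[of "(F, e / 2)"] by (intro exI[of _ "\<lambda>z. z \<in> V (F, e / 2)"]) auto
  qed
  have ev_sym: "eventually P (symmetrized U) \<longleftrightarrow>
      (\<exists>i\<in>I. \<forall>x y. (x, y) \<in> V i \<longrightarrow> (y, x) \<in> V i \<longrightarrow> P (x, y))" for P
  proof
    assume "eventually P (symmetrized U)"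
    then obtain P1 P2 where P: "eventually P1 U" "eventually P2 (filtermap prod.swap U)"
      "\<And>z. P1 z \<Longrightarrow> P2 z \<Longrightarrow> P z"
      by (auto simp: symmetrized_def eventually_inf)
    then have "eventually (\<lambda>z. P1 z \<and> P2 (prod.swap z)) U"
      by (auto simp: eventually_filtermap intro: eventually_conj)
    then obtain i where "i \<in> I" "\<forall>z\<in>V i. P1 z \<and> P2 (prod.swap z)" by (auto simp: ev)
    then show "\<exists>i\<in>I. \<forall>x y. (x, y) \<in> V i \<longrightarrow> (y, x) \<in> V i \<longrightarrow> P (x, y)"
      using P(3) by (intro bexI[of _ i]) force+
  next
    assume "\<exists>i\<in>I. \<forall>x y. (x, y) \<in> V i \<longrightarrow> (y, x) \<in> V i \<longrightarrow> P (x, y)"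
    then obtain i where "i \<in> I" "\<forall>x y. (x, y) \<in> V i \<longrightarrow> (y, x) \<in> V i \<longrightarrow> P (x, y)" by blast
    then show "eventually P (symmetrized U)"
      unfolding symmetrized_def eventually_inf eventually_filtermap
      using evV[of i]
      by (intro exI[of _ "\<lambda>z. z \<in> V i"] exI[of _ "\<lambda>z. prod.swap z \<in> V i"]) auto
  qed
  have top: "open S \<longleftrightarrow> (\<forall>x\<in>S. eventually (\<lambda>(x', y). x' = x \<longrightarrow> y \<in> S) (symmetrized U))"
    for S :: "'a set"
  proof
    assume S: "open S"
    show "\<forall>x\<in>S. eventually (\<lambda>(x', y). x' = x \<longrightarrow> y \<in> S) (symmetrized U)"
    proof
      fix x assume "x \<in> S"
      then obtain f h where fh: "f \<in> isotone_functions R" "h \<in> isotone_functions R"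
        "f x = 1" "h x = 0" "{y. 0 < f y \<and> h y < 1} \<subseteq> S" using init[OF S] by blast
      then have "({f, h}, 1) \<in> I" by (auto simp: I_def)
      moreover have "y \<in> S" if "(x, y) \<in> V ({f, h}, 1)" "(y, x) \<in> V ({f, h}, 1)" for y
        using that fh by (auto simp: V_def)
      ultimately show "eventually (\<lambda>(x', y). x' = x \<longrightarrow> y \<in> S) (symmetrized U)"
        unfolding ev_sym by (intro bexI[of _ "({f, h}, 1)"]) auto
    qed
  next
    assume ev: "\<forall>x\<in>S. eventually (\<lambda>(x', y). x' = x \<longrightarrow> y \<in> S) (symmetrized U)"
    show "open S"
      unfolding open_subopen[of S]
    proof
      fix x assume "x \<in> S"
      then obtain F e where i: "(F, e) \<in> I"
        and *: "\<And>y. (x, y) \<in> V (F, e) \<Longrightarrow> (y, x) \<in> V (F, e) \<Longrightarrow> y \<in> S"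
        using ev[rule_format, OF \<open>x \<in> S\<close>] unfolding ev_sym by fastforce
      define W where "W = (\<Inter>f\<in>F. {y. f x < f y + e} \<inter> {y. f y < f x + e})"
      have "open W" unfolding W_def
      proof (intro open_INT open_Int ballI)
        show "finite F" using i by (auto simp: I_def)
        fix f assume "f \<in> F"
        then have "continuous_on UNIV f" using i by (auto simp: I_def isotone_functions_def)
        then show "open {y. f x < f y + e}" "open {y. f y < f x + e}"
          by (intro open_Collect_less continuous_on_add continuous_on_const, simp_all)+
      qed
      moreover have "x \<in> W" using i by (auto simp: W_def I_def)
      moreover have "W \<subseteq> S" using * by (auto simp: W_def V_def)
      ultimately show "\<exists>T. open T \<and> x \<in> T \<and> T \<subseteq> S" by blast
    qed
  qed
  have "R = \<Inter> {{z. P z} | P. eventually P U}"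
  proof (intro equalityI subrelI)
    fix x y assume "(x, y) \<in> R"
    then have "f x < f y + e" if "f \<in> isotone_functions R" "0 < e" for f and e :: real
      using isotone_functions_mono[OF that(1), of x y] that(2) by simp
    then have "(x, y) \<in> V i" if "i \<in> I" for i
      using that unfolding V_def I_def by auto
    then show "(x, y) \<in> \<Inter> {{z. P z} | P. eventually P U}" by (auto simp: ev)
  next
    fix x y assume xy: "(x, y) \<in> \<Inter> {{z. P z} | P. eventually P U}"
    show "(x, y) \<in> R"
    proof (rule ccontr)
      assume "(x, y) \<notin> R"
      then obtain f where f: "f \<in> isotone_functions R" "f y < f x" using sep by blast
      then have "({f}, f x - f y) \<in> I" by (auto simp: I_def)
      then have "{z. z \<in> V ({f}, f x - f y)} \<in> {{z. P z} | P. eventually P U}"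
        using evV by blast
      then have "(x, y) \<in> V ({f}, f x - f y)" using xy by blast
      then show False by (simp add: V_def)
    qed
  qed
  then show ?thesis unfolding quasi_uniformizable_def using qu top by blast
qed

text \<open>Everything but the embedding is formal (Tychonoff's theorem and restriction to a closed subspace).
Evaluation is injective by antisymmetry, and open onto its image because a neighbourhood
\<open>{y. 0 < f y \<and> h y < 1}\<close> is the preimage of an open box in the two coordinates \<open>f\<close> and \<open>h\<close>.\<close>

lemma nachbin_compactification_isotone:
  fixes R :: "('a::t2_space \<times> 'a) set"
  assumes po: "partial_order_on UNIV R"
    and sep: "\<And>x y. (x, y) \<notin> R \<Longrightarrow> \<exists>f \<in> isotone_functions R. f y < f x"
    and init: "\<And>x S. open S \<Longrightarrow> x \<in> S \<Longrightarrow> \<exists>f \<in> isotone_functions R. \<exists>h \<in> isotone_functions R.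
       f x = 1 \<and> h x = 0 \<and> {y. 0 < f y \<and> h y < 1} \<subseteq> S"
  shows "admits_nachbin_compactification R"
proof -
  define F where "F = isotone_functions R"
  define E where "E = nachbin_eval R"
  have E: "E x f = f x" if "f \<in> F" for x f using that by (simp add: E_def F_def nachbin_eval_def)
  have cube: "nachbin_cube R = product_topology (\<lambda>_. top_of_set {0..1}) F"
    by (simp add: nachbin_cube_def F_def)
  have top_cube: "topspace (nachbin_cube R) = (\<Pi>\<^sub>E f\<in>F. {0..1})"
    by (simp add: cube topspace_product_topology)
  have ran: "range E \<subseteq> topspace (nachbin_cube R)"
    unfolding top_cube E_def nachbin_eval_def F_def
    using isotone_functions_range[of _ R] by auto
  have cl: "range E \<subseteq> nachbin_cube R closure_of range E"
    using ran by (rule closure_of_subset)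
  have top_space: "topspace (nachbin_space R) = nachbin_cube R closure_of range E"
    by (simp add: nachbin_space_def E_def closure_of_subset_topspace inf_absorb2)
  have "compact_space (nachbin_cube R)"
    unfolding cube compact_space_product_topology by (simp add: compact_space_subtopology)
  then have comp: "compact_space (nachbin_space R)"
    unfolding nachbin_space_def
    by (meson closedin_closure_of closedin_compact_space compact_space_subtopology)
  have dense: "nachbin_space R closure_of range E = topspace (nachbin_space R)"
    unfolding top_space using cl
    by (simp add: nachbin_space_def E_def closure_of_subtopology inf_absorb2)
  have cont: "continuous_map euclidean (nachbin_cube R) E"
    unfolding cube
  proof (subst continuous_map_componentwise, intro conjI ballI)
    show "E ` topspace euclidean \<subseteq> extensional F" by (auto simp: E_def nachbin_eval_def F_def)
    fix f assume f: "f \<in> F"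
    then have "continuous_on UNIV f" "\<And>x. f x \<in> {0..1}"
      unfolding F_def by (blast intro: isotone_functions_cts isotone_functions_range)+
    then have "continuous_map euclidean (top_of_set {0..1}) f"
      by (auto simp: continuous_map_in_subtopology)
    then show "continuous_map euclidean (top_of_set {0..1}) (\<lambda>x. E x f)"
      using E[OF f] by simp
  qed
  have cont': "continuous_map euclidean (nachbin_space R) E"
    unfolding nachbin_space_def continuous_map_in_subtopology
    using cont cl by (auto simp: E_def)
  have ord: "(x, y) \<in> R \<longleftrightarrow> (\<forall>f\<in>F. f x \<le> f y)" for x y
    using sep[of x y] isotone_functions_mono[of _ R x y] unfolding F_def by fastforce
  have inj: "inj E"
  proof (rule injI)
    fix x y assume "E x = E y"
    then have "(x, y) \<in> R" "(y, x) \<in> R" using E ord by (metis order_refl)+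
    then show "x = y" using po by (auto simp: partial_order_on_def antisym_def)
  qed
  define Y where "Y = subtopology (nachbin_space R) (range E)"
  have Y_cube: "Y = subtopology (nachbin_cube R) (range E)"
    using cl by (simp add: Y_def nachbin_space_def E_def subtopology_subtopology inf_absorb2)
  have "open_map euclidean Y E"
    unfolding open_map_def
  proof (intro allI impI)
    fix S :: "'a set" assume "openin euclidean S"
    then have S: "open S" by simp
    have "\<exists>W. openin Y W \<and> E x \<in> W \<and> W \<subseteq> E ` S" if x: "x \<in> S" for x
    proof -
      obtain f h where fh: "f \<in> F" "h \<in> F" "f x = 1" "h x = 0"
        "{y. 0 < f y \<and> h y < 1} \<subseteq> S" using init[OF S x] unfolding F_def by blast
      have proj: "continuous_map Y euclideanreal (\<lambda>u. u k)" if "k \<in> F" for k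
        unfolding Y_cube cube
        by (rule continuous_map_from_subtopology, rule continuous_map_into_fulltopology,
            rule continuous_map_product_projection[OF that])
      define W where "W = {u \<in> topspace Y. u f \<in> {0<..}} \<inter> {u \<in> topspace Y. u h \<in> {..<1}}"
      have "openin Y W" unfolding W_def
        by (intro openin_Int openin_continuous_map_preimage[OF proj] fh) auto
      moreover have topY: "topspace Y = range E"
        unfolding Y_cube using ran by auto
      ultimately show ?thesis
        using fh x by (intro exI[of _ W]) (auto simp: W_def E)
    qed
    then show "openin Y (E ` S)" by (subst openin_subopen) blast
  qed
  moreover have "continuous_map euclidean Y E"
    unfolding Y_def continuous_map_in_subtopology using cont' by auto
  moreover have "topspace Y = range E" unfolding Y_cube using ran by auto
  ultimately have "homeomorphic_map euclidean Y E"
    using inj by (intro bijective_open_imp_homeomorphic_map) auto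
  then have emb: "embedding_map euclidean (nachbin_space R) E"
    by (simp add: embedding_map_def Y_def)
  have "(E x, E y) \<in> nachbin_order R \<longleftrightarrow> (x, y) \<in> R" for x y
    unfolding nachbin_order_def ord top_space using cl E by (auto simp: F_def)
  then show ?thesis
    unfolding admits_nachbin_compactification_def
    using po comp dense emb by (auto simp: E_def)
qed

section \<open>Linear algebra of Lorentzian forms\<close>

lemma bilinear_simps:
  assumes "bilinear h"
  shows "h (x + y) z = h x z + h y z" "h z (x + y) = h z x + h z y"
    "h (x - y) z = h x z - h y z" "h z (x - y) = h z x - h z y"
    "h (c *\<^sub>R x) z = c * h x z" "h z (c *\<^sub>R x) = c * h z x"
    "h (- x) z = - h x z" "h z (- x) = - h z x" "h 0 z = (0::real)" "h z 0 = 0"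
  using assms
  by (simp_all add: bilinear_ladd bilinear_radd bilinear_lsub bilinear_rsub bilinear_lmul
      bilinear_rmul bilinear_lneg bilinear_rneg bilinear_lzero bilinear_rzero)

lemma bilinear_sum_both:
  fixes h :: "'a::real_vector \<Rightarrow> 'a \<Rightarrow> real"
  assumes "bilinear h" "finite I" "finite J"
  shows "h (\<Sum>i\<in>I. a i *\<^sub>R x i) (\<Sum>j\<in>J. b j *\<^sub>R y j)
    = (\<Sum>i\<in>I. \<Sum>j\<in>J. a i * b j * (h (x i) (y j) :: real))"
proof -
  have l: "h (\<Sum>i\<in>I. a i *\<^sub>R x i) z = (\<Sum>i\<in>I. a i * h (x i) z)" for z
    using assms(2) by (induction rule: finite_induct) (simp_all add: bilinear_simps[OF assms(1)])
  have r: "h z (\<Sum>j\<in>J. b j *\<^sub>R y j) = (\<Sum>j\<in>J. b j * h z (y j))" for z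
    using assms(3) by (induction rule: finite_induct) (simp_all add: bilinear_simps[OF assms(1)])
  show ?thesis unfolding l by (simp add: r sum_distrib_left mult.assoc)
qed

lemma lorentzian_form_bilinear: "lorentzian_form h \<Longrightarrow> bilinear h"
  and lorentzian_form_sym: "lorentzian_form h \<Longrightarrow> h a b = h b a"
  by (auto simp: lorentzian_form_def)

text \<open>In an orthonormal basis this is the Cauchy-Schwarz inequality for the spatial components: orthogonality
equates the product of the time components with the spatial inner product, and \<open>u\<close> has the larger
time component.\<close>

lemma lorentzian_orthogonal_timelike:
  fixes h :: "real ^ 'n::finite \<Rightarrow> real ^ 'n \<Rightarrow> real"
  assumes h: "lorentzian_form h" and u: "h u u < 0" and ortho: "h w u = 0" and "w \<noteq> 0"
  shows "h w w > 0"
proof -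
  note bil = lorentzian_form_bilinear[OF h]
  obtain e :: "'n \<Rightarrow> real ^ 'n" and i0 where e: "inj e" "independent (range e)"
    and he: "\<And>i j. h (e i) (e j) = (if i \<noteq> j then 0 else if i = i0 then -1 else 1)"
    using h unfolding lorentzian_form_def by blast
  have "card (range e) = DIM(real ^ 'n)" using e(1) by (simp add: card_image)
  then have "span (range e) = UNIV"
    using e(2) card_ge_dim_independent[of "range e" UNIV] by auto
  then have ex: "\<exists>a. x = (\<Sum>i\<in>UNIV. a i *\<^sub>R e i)" for x
  proof -
    have "x \<in> span (range e)" using \<open>span (range e) = UNIV\<close> by simp
    then obtain b where "x = (\<Sum>v\<in>range e. b v *\<^sub>R v)" by (auto simp: span_finite)
    also have "\<dots> = (\<Sum>i\<in>UNIV. b (e i) *\<^sub>R e i)" using e(1) by (simp add: sum.reindex)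
    finally show ?thesis by (rule exI[of _ "\<lambda>i. b (e i)"])
  qed
  have hsum: "h (\<Sum>i\<in>UNIV. a i *\<^sub>R e i) (\<Sum>i\<in>UNIV. b i *\<^sub>R e i)
      = (\<Sum>i\<in>-{i0}. a i * b i) - a i0 * b i0" for a b
  proof -
    have "h (\<Sum>i\<in>UNIV. a i *\<^sub>R e i) (\<Sum>i\<in>UNIV. b i *\<^sub>R e i)
      = (\<Sum>i\<in>UNIV. \<Sum>j\<in>UNIV. if j = i then (a i * b i * (if i = i0 then -1 else 1)) else 0)"
      unfolding bilinear_sum_both[OF bil finite finite] he
      by (intro sum.cong refl) auto
    also have "\<dots> = (\<Sum>i\<in>UNIV. a i * b i * (if i = i0 then -1 else 1))" by simp
    also have "\<dots> = (\<Sum>i\<in>-{i0}. a i * b i * (if i = i0 then -1 else 1)) - a i0 * b i0"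
      by (simp add: sum.remove[of UNIV i0] Compl_eq_Diff_UNIV)
    also have "(\<Sum>i\<in>-{i0}. a i * b i * (if i = i0 then -1 else 1)) = (\<Sum>i\<in>-{i0}. a i * b i)"
      by (rule sum.cong) auto
    finally show ?thesis .
  qed
  obtain a b where ab: "u = (\<Sum>i\<in>UNIV. a i *\<^sub>R e i)" "w = (\<Sum>i\<in>UNIV. b i *\<^sub>R e i)"
    using ex by metis
  let ?a = "\<Sum>i\<in>-{i0}. (a i)\<^sup>2" and ?b = "\<Sum>i\<in>-{i0}. (b i)\<^sup>2"
  have u1: "?a < (a i0)\<^sup>2" using u by (simp add: ab hsum power2_eq_square)
  have "(\<Sum>i\<in>-{i0}. a i * b i) = a i0 * b i0"
    using ortho by (simp add: ab hsum mult.commute)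
  then have cs: "(a i0)\<^sup>2 * (b i0)\<^sup>2 \<le> ?a * ?b"
    using Cauchy_Schwarz_ineq_sum[of a b "-{i0}"] by (simp add: power_mult_distrib)
  have nn: "0 \<le> ?a" "0 \<le> ?b" by (simp_all add: sum_nonneg)
  then have a0: "0 < (a i0)\<^sup>2" using u1 by linarith
  have "?b \<noteq> 0"
  proof
    assume b: "?b = 0"
    then have "(b i0)\<^sup>2 \<le> 0" using cs a0 by (simp add: mult_le_0_iff)
    then have "b i = 0" for i using b by (cases "i = i0") (auto simp: sum_nonneg_eq_0_iff)
    then show False using \<open>w \<noteq> 0\<close> by (simp add: ab)
  qed
  then have "?b > 0" using nn by simp
  then have "?a * ?b < (a i0)\<^sup>2 * ?b" using u1 by simp
  then have "(b i0)\<^sup>2 < ?b" using cs a0 by (metis le_less_trans mult_less_cancel_left_pos)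
  then show ?thesis by (simp add: ab hsum power2_eq_square)
qed

text \<open>An orthonormal basis is grown from the normalized vector \<open>u\<close> by Gram-Schmidt: each new vector is
made orthogonal to the previous ones, in particular to \<open>u\<close>, and so has positive square.\<close>

lemma lorentzian_formI:
  fixes h :: "real ^ 'n::finite \<Rightarrow> real ^ 'n \<Rightarrow> real"
  assumes bil: "bilinear h" and sym: "\<And>a b. h a b = h b a" and u: "h u u < 0"
    and pos: "\<And>w. w \<noteq> 0 \<Longrightarrow> h w u = 0 \<Longrightarrow> h w w > 0"
  shows "lorentzian_form h"
proof -
  note bs = bilinear_simps[OF bil]
  define u0 where "u0 = (1 / sqrt (- h u u)) *\<^sub>R u"
  have u0: "h u0 u0 = -1" using u by (simp add: u0_def bs field_simps flip: power2_eq_square)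
  define good where "good S \<longleftrightarrow> finite S \<and> u0 \<in> S \<and> (\<forall>s\<in>S. \<forall>t\<in>S. s \<noteq> t \<longrightarrow> h s t = 0) \<and>
      (\<forall>s\<in>S - {u0}. h s s = 1)" for S
  have ind: "independent S" if S: "good S" for S
  proof (rule independent_if_scalars_zero)
    show "finite S" using S by (simp add: good_def)
    fix f x assume sum0: "(\<Sum>x\<in>S. f x *\<^sub>R x) = 0" and "x \<in> S"
    have "h (\<Sum>y\<in>S. f y *\<^sub>R y) (\<Sum>y\<in>{x}. 1 *\<^sub>R y) = (\<Sum>y\<in>S. if y = x then f x * h x x else 0)"
      unfolding bilinear_sum_both[OF bil \<open>finite S\<close> finite.insertI[OF finite.emptyI]]
      by (rule sum.cong) (use S \<open>x \<in> S\<close> in \<open>auto simp: good_def\<close>)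
    then have "f x * h x x = 0" using sum0 \<open>finite S\<close> \<open>x \<in> S\<close> by (simp add: bs)
    moreover have "h x x \<noteq> 0" using S \<open>x \<in> S\<close> u0 by (cases "x = u0") (auto simp: good_def)
    ultimately show "f x = 0" by simp
  qed
  have "\<exists>S. good S \<and> card S = k" if "1 \<le> k" "k \<le> CARD('n)" for k
    using that
  proof (induction k rule: dec_induct)
    case base
    show ?case by (rule exI[of _ "{u0}"]) (auto simp: good_def)
  next
    case (step k)
    then obtain S where S: "good S" "card S = k" by auto
    have fin: "finite S" and u0S: "u0 \<in> S" using S by (auto simp: good_def)
    have hss: "h s s \<noteq> 0" if "s \<in> S" for s
      using S that u0 by (cases "s = u0") (auto simp: good_def)
    have "span S \<noteq> UNIV"
    proof
      assume "span S = UNIV"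
      then have "dim (UNIV :: (real^'n) set) \<le> card S" using fin by (intro span_card_ge_dim) auto
      then show False using S step by simp
    qed
    then obtain x where x: "x \<notin> span S" by auto
    define y where "y = x - (\<Sum>s\<in>S. (h x s / h s s) *\<^sub>R s)"
    have "y \<noteq> 0"
    proof
      assume "y = 0"
      then have "x = (\<Sum>s\<in>S. (h x s / h s s) *\<^sub>R s)" by (simp add: y_def)
      also have "\<dots> \<in> span S" by (intro span_sum span_scale span_base)
      finally show False using x by simp
    qed
    have hys: "h y s = 0" if s: "s \<in> S" for s
    proof -
      have "h (\<Sum>t\<in>S. (h x t / h t t) *\<^sub>R t) (\<Sum>t\<in>{s}. 1 *\<^sub>R t)
          = (\<Sum>t\<in>S. if t = s then h x s else 0)"
        unfolding bilinear_sum_both[OF bil fin finite.insertI[OF finite.emptyI]]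
        by (rule sum.cong) (use S s hss in \<open>auto simp: good_def\<close>)
      then show ?thesis using s fin by (simp add: y_def bs)
    qed
    have "h y u0 = 0" using hys u0S by simp
    then have "h y u = 0" using u by (simp add: u0_def bs)
    then have hyy: "h y y > 0" using pos \<open>y \<noteq> 0\<close> by simp
    define z where "z = (1 / sqrt (h y y)) *\<^sub>R y"
    have hzz: "h z z = 1" using hyy by (simp add: z_def bs field_simps flip: power2_eq_square)
    have hzs: "h z s = 0" "h s z = 0" if "s \<in> S" for s
      using hys[OF that] sym by (simp_all add: z_def bs)
    have "z \<notin> S" using hzs(1)[of z] hzz by auto
    then have "good (insert z S) \<and> card (insert z S) = Suc k"
      using S fin hzz hzs by (auto simp: good_def)
    then show ?case by blast
  qed
  then obtain S where S: "good S" "card S = CARD('n)"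
    by (metis One_nat_def Suc_leI order_refl zero_less_card_finite)
  then have "finite S" "u0 \<in> S" by (auto simp: good_def)
  then obtain e :: "'n \<Rightarrow> real^'n" where e: "bij_betw e UNIV S"
    using S(2) by (metis bij_betw_iff_card finite)
  then obtain i0 where i0: "e i0 = u0" using \<open>u0 \<in> S\<close> by (auto simp: bij_betw_def)
  have inj: "inj e" and ran: "range e = S" using e by (auto simp: bij_betw_def)
  have "h (e i) (e j) = (if i \<noteq> j then 0 else if i = i0 then -1 else 1)" for i j
  proof -
    have "e i \<in> S" "e j \<in> S" using ran by auto
    moreover have "e i = e j \<longleftrightarrow> i = j" "e i = u0 \<longleftrightarrow> i = i0" using inj i0 by (auto simp: inj_eq)
    ultimately show ?thesis using S(1) u0 i0 unfolding good_def by (cases "i = i0") auto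
  qed
  then show ?thesis unfolding lorentzian_form_def
    using bil sym inj ran ind[OF S(1)] by blast
qed

text \<open>For interpolated forms positivity is known on a hyperplane that belongs to one of the end forms, not on
the orthogonal complement of the timelike vector \<open>u\<close>. Splitting off a multiple of \<open>u\<close> shows that any
hyperplane missing \<open>u\<close> will do.\<close>

lemma lorentzian_formI':
  fixes h :: "real ^ 'n::finite \<Rightarrow> real ^ 'n \<Rightarrow> real"
  assumes bil: "bilinear h" and sym: "\<And>a b. h a b = h b a" and u: "h u u < 0"
    and L: "linear L" "L u \<noteq> (0::real)" and pos: "\<And>w. w \<noteq> 0 \<Longrightarrow> L w = 0 \<Longrightarrow> h w w > 0"
  shows "lorentzian_form h"
proof (rule lorentzian_formI[OF bil sym u])
  note bs = bilinear_simps[OF bil]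
  fix w assume w: "w \<noteq> 0" "h w u = 0"
  define \<alpha> where "\<alpha> = L w / L u"
  define z where "z = w - \<alpha> *\<^sub>R u"
  have "L z = 0" using L by (simp add: z_def \<alpha>_def linear_diff linear_scale)
  have weq: "w = z + \<alpha> *\<^sub>R u" by (simp add: z_def)
  have zu: "h z u = - \<alpha> * h u u" using w(2) by (simp add: weq bs)
  have ww: "h w w = h z z + \<alpha>\<^sup>2 * (- h u u)"
    using zu sym[of u z] by (simp add: weq bs power2_eq_square algebra_simps)
  show "h w w > 0"
  proof (cases "z = 0")
    case True
    then have "\<alpha> \<noteq> 0" using w(1) weq by auto
    then show ?thesis using ww True u by (simp add: bs zero_less_mult_iff mult_pos_neg)
  next
    case False
    then have "h z z > 0" using pos \<open>L z = 0\<close> by blast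
    moreover have "\<alpha>\<^sup>2 * (- h u u) \<ge> 0" using u by (intro mult_nonneg_nonneg) auto
    ultimately show ?thesis using ww by linarith
  qed
qed

definition future_cone :: "(real ^ 'n \<Rightarrow> real ^ 'n \<Rightarrow> real) \<Rightarrow> real ^ 'n \<Rightarrow> (real ^ 'n) set" where
  "future_cone h t = {v. v \<noteq> 0 \<and> h v v \<le> 0 \<and> h v t < 0}"

text \<open>The reversed Cauchy-Schwarz inequality in its qualitative form: otherwise the combination of \<open>u\<close> and
\<open>w\<close> orthogonal to \<open>t\<close> would be timelike.\<close>

lemma future_cone_pairing:
  fixes h :: "real ^ 'n::finite \<Rightarrow> real ^ 'n \<Rightarrow> real"
  assumes h: "lorentzian_form h" and t: "h t t < 0"
    and u: "u \<in> future_cone h t" and w: "w \<in> future_cone h t"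
  shows "h u w \<le> 0"
proof (rule ccontr)
  note bs = bilinear_simps[OF lorentzian_form_bilinear[OF h]]
  assume neg: "\<not> h u w \<le> 0"
  \<comment> \<open>The multiple of \<open>w\<close> that makes \<open>u - l w\<close> orthogonal to \<open>t\<close>.\<close>
  define l where "l = h u t / h w t"
  have l: "l > 0" using u w by (simp add: l_def future_cone_def divide_neg_neg)
  define z where "z = u - l *\<^sub>R w"
  have zt: "h z t = 0" using w by (simp add: z_def l_def bs future_cone_def)
  have "h z z = h u u - 2 * l * h u w + l\<^sup>2 * h w w"
    using lorentzian_form_sym[OF h, of w u] by (simp add: z_def bs power2_eq_square algebra_simps)
  moreover have "h u u \<le> 0" "l\<^sup>2 * h w w \<le> 0"
    using u w by (auto simp: future_cone_def mult_nonneg_nonpos)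
  moreover have "2 * l * h u w > 0" using l neg by simp
  ultimately have "h z z < 0" by linarith
  moreover have "z \<noteq> 0" using \<open>h z z < 0\<close> by (auto simp: bs)
  ultimately show False using lorentzian_orthogonal_timelike[OF h t zt] by simp
qed

lemma future_cone_combination:
  fixes h :: "real ^ 'n::finite \<Rightarrow> real ^ 'n \<Rightarrow> real"
  assumes h: "lorentzian_form h" and t: "h t t < 0"
    and u: "u \<in> future_cone h t" and w: "w \<in> future_cone h t"
    and ab: "a \<ge> 0" "b \<ge> 0" "a + b > 0"
  shows "a *\<^sub>R u + b *\<^sub>R w \<in> future_cone h t"
proof -
  note bs = bilinear_simps[OF lorentzian_form_bilinear[OF h]]
  let ?v = "a *\<^sub>R u + b *\<^sub>R w"
  have "h ?v ?v = a\<^sup>2 * h u u + 2 * (a * b) * h u w + b\<^sup>2 * h w w"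
    using lorentzian_form_sym[OF h, of w u] by (simp add: bs power2_eq_square algebra_simps)
  moreover have "a\<^sup>2 * h u u \<le> 0" "b\<^sup>2 * h w w \<le> 0"
    using u w by (auto simp: future_cone_def mult_nonneg_nonpos)
  moreover have "2 * (a * b) * h u w \<le> 0"
    using ab future_cone_pairing[OF h t u w] by (simp add: mult_nonneg_nonpos)
  moreover have ut: "h ?v t < 0"
  proof -
    have neg: "h u t < 0" "h w t < 0" using u w by (auto simp: future_cone_def)
    show ?thesis
    proof (cases "a = 0")
      case True
      then show ?thesis using ab neg by (simp add: bs mult_pos_neg)
    next
      case False
      then have "a * h u t < 0" "b * h w t \<le> 0" using ab neg by (auto simp: mult_pos_neg mult_nonneg_nonpos)
      then show ?thesis by (simp add: bs)
    qed
  qed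
  moreover have "?v \<noteq> 0" using ut by (metis bs(9) less_irrefl)
  ultimately show ?thesis by (simp add: future_cone_def)
qed

lemma causal_not_orthogonal:
  fixes h :: "real ^ 'n::finite \<Rightarrow> real ^ 'n \<Rightarrow> real"
  assumes "lorentzian_form h" "h t t < 0" "v \<noteq> 0" "h v v \<le> 0"
  shows "h v t \<noteq> 0"
  using lorentzian_orthogonal_timelike[OF assms(1,2) _ assms(3)] assms(4) by fastforce

text \<open>If a future vector \<open>v\<close> of \<open>h\<close> pointed to the past for \<open>k\<close>, the segment from \<open>v\<close> to \<open>t\<close>, which stays
in the cone of \<open>h\<close>, would meet the \<open>k\<close>-orthogonal complement of \<open>t'\<close>; but it consists of
\<open>k\<close>-timelike vectors.\<close>

lemma future_cone_orientation:
  fixes h k :: "real ^ 'n::finite \<Rightarrow> real ^ 'n \<Rightarrow> real"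
  assumes h: "lorentzian_form h" "h t t < 0" and k: "lorentzian_form k" "k t' t' < 0"
    and hk: "\<And>x. x \<noteq> 0 \<Longrightarrow> h x x \<le> 0 \<Longrightarrow> k x x < 0" and "k t t' < 0"
    and v: "v \<in> future_cone h t"
  shows "k v t' < 0"
proof (rule ccontr)
  note bk = bilinear_simps[OF lorentzian_form_bilinear[OF k(1)]]
  note bh = bilinear_simps[OF lorentzian_form_bilinear[OF h(1)]]
  assume neg: "\<not> k v t' < 0"
  \<comment> \<open>The point \<open>v + l t\<close> is where the ray from \<open>v\<close> in direction \<open>t\<close> meets the hyperplane \<open>k x t' = 0\<close>.\<close>
  define l where "l = - (k v t' / k t t')"
  have l: "l \<ge> 0" using neg \<open>k t t' < 0\<close> by (simp add: l_def divide_nonneg_neg)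
  have "t \<in> future_cone h t" using h(2) by (auto simp: future_cone_def bh)
  then have w: "1 *\<^sub>R v + l *\<^sub>R t \<in> future_cone h t"
    using future_cone_combination[OF h v, of t 1 l] l by simp
  have "k (1 *\<^sub>R v + l *\<^sub>R t) t' = 0" using \<open>k t t' < 0\<close> by (simp add: bk l_def)
  then have "k (1 *\<^sub>R v + l *\<^sub>R t) (1 *\<^sub>R v + l *\<^sub>R t) > 0"
    using lorentzian_orthogonal_timelike[OF k] w by (auto simp: future_cone_def)
  moreover have "k (1 *\<^sub>R v + l *\<^sub>R t) (1 *\<^sub>R v + l *\<^sub>R t) < 0" using hk w by (simp add: future_cone_def)
  ultimately show False by simp
qed

definition interpolate :: "real \<Rightarrow> ('a \<Rightarrow> 'a \<Rightarrow> real) \<Rightarrow> ('a \<Rightarrow> 'a \<Rightarrow> real) \<Rightarrow> 'a \<Rightarrow> 'a \<Rightarrow> real" where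
  "interpolate s h k = (\<lambda>a b. (1 - s) * h a b + s * k a b)"

lemma bilinear_interpolate:
  assumes "bilinear h" "bilinear k" shows "bilinear (interpolate s h k)"
  unfolding bilinear_def interpolate_def
  using assms by (auto intro!: linearI simp: bilinear_simps algebra_simps)

lemma causal_wider_forms:
  fixes h k :: "real ^ 'n::finite \<Rightarrow> real ^ 'n \<Rightarrow> real"
  assumes h: "lorentzian_form h" "h t t < 0" and k: "lorentzian_form k"
    and hk: "\<And>x. x \<in> future_cone h t \<Longrightarrow> k x x < 0" and x: "x \<noteq> 0" "h x x \<le> 0"
  shows "k x x < 0"
proof (cases "h x t < 0")
  case True
  then show ?thesis using hk x by (simp add: future_cone_def)
next
  note bh = bilinear_simps[OF lorentzian_form_bilinear[OF h(1)]]
  case False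
  then have "h x t > 0" using causal_not_orthogonal[OF h x] by simp
  then have "- x \<in> future_cone h t" using x by (simp add: future_cone_def bh)
  then show ?thesis using hk[of "- x"] by (simp add: bilinear_simps[OF lorentzian_form_bilinear[OF k]])
qed

text \<open>The pointwise form of \<^const>\<open>wider\<close>, in the components of one chart.\<close>

definition wider_forms where
  "wider_forms h t k t' \<longleftrightarrow> lorentzian_form h \<and> h t t < 0 \<and> lorentzian_form k \<and> k t' t' < 0 \<and>
     (\<forall>x\<in>future_cone h t. k x x < 0 \<and> k x t' < 0)"

context
  fixes h k :: "real ^ 'n::finite \<Rightarrow> real ^ 'n \<Rightarrow> real" and t t'
  assumes wider: "wider_forms h t k t'"
begin

lemma base_form: "lorentzian_form h" "h t t < 0"
  and wide_form: "lorentzian_form k" "k t' t' < 0"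
  and wide_on_cone: "x \<in> future_cone h t \<Longrightarrow> k x x < 0 \<and> k x t' < 0"
  using wider by (auto simp: wider_forms_def)

lemma base_vector_in_cone: "t \<in> future_cone h t"
  using base_form(2)
  by (auto simp: future_cone_def bilinear_simps[OF lorentzian_form_bilinear[OF base_form(1)]])

lemma wide_on_causal: "x \<noteq> 0 \<Longrightarrow> h x x \<le> 0 \<Longrightarrow> k x x < 0"
  using causal_wider_forms[OF base_form wide_form(1)] wide_on_cone by blast

lemma interpolate_timelike: "0 \<le> s \<Longrightarrow> s \<le> 1 \<Longrightarrow> interpolate s h k t t < 0"
proof -
  assume s: "0 \<le> s" "s \<le> 1"
  have "k t t < 0" using wide_on_cone base_vector_in_cone by blast
  then have "(1 - s) * h t t \<le> 0" "s * k t t \<le> 0" using s base_form(2) by (auto simp: mult_nonneg_nonpos)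
  moreover have "(1 - s) * h t t < 0 \<or> s * k t t < 0"
    using s base_form(2) \<open>k t t < 0\<close> by (cases "s = 0") (auto simp: mult_pos_neg)
  ultimately show ?thesis unfolding interpolate_def by linarith
qed

lemma interpolate_lorentzian:
  assumes s: "0 \<le> s" "s \<le> 1"
  shows "lorentzian_form (interpolate s h k)"
proof (rule lorentzian_formI')
  show "bilinear (interpolate s h k)"
    using bilinear_interpolate lorentzian_form_bilinear base_form wide_form by blast
  show "interpolate s h k a b = interpolate s h k b a" for a b
    using lorentzian_form_sym[OF base_form(1), of a b] lorentzian_form_sym[OF wide_form(1), of a b]
    by (simp add: interpolate_def)
  show "interpolate s h k t t < 0" using interpolate_timelike s .
  show "linear (\<lambda>w. k w t')" using lorentzian_form_bilinear[OF wide_form(1)] by (simp add: bilinear_def)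
  show "k t t' \<noteq> 0" using wide_on_cone base_vector_in_cone by force
  fix w assume w: "w \<noteq> 0" "k w t' = 0"
  then have kw: "k w w > 0" using lorentzian_orthogonal_timelike[OF wide_form] by blast
  then have "h w w > 0" using wide_on_causal w by force
  then have "(1 - s) * h w w \<ge> 0" "s * k w w \<ge> 0" "(1 - s) * h w w > 0 \<or> s * k w w > 0"
    using s kw by (cases "s = 0"; force)+
  then show "interpolate s h k w w > 0" unfolding interpolate_def by linarith
qed

text \<open>A causal vector of the form at \<open>s\<close> is timelike for \<open>k\<close>, and the form at \<open>s'\<close> is a convex
combination, with positive weight on \<open>k\<close>, of the form at \<open>s\<close> and \<open>k\<close>.\<close>

lemma interpolate_wider:
  assumes s: "0 \<le> s" "s < s'" "s' \<le> 1" and x: "x \<noteq> 0" "interpolate s h k x x \<le> 0"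
  shows "interpolate s' h k x x < 0"
proof -
  have k0: "k x x < 0"
  proof (rule ccontr)
    assume n: "\<not> k x x < 0"
    then have "h x x > 0" using wide_on_causal x by force
    then have "(1 - s) * h x x > 0" "s * k x x \<ge> 0" using s n by auto
    then show False using x unfolding interpolate_def by linarith
  qed
  \<comment> \<open>The position of \<open>s'\<close> on the segment from \<open>s\<close> to 1.\<close>
  define l where "l = (s' - s) / (1 - s)"
  have l: "0 < l" "l \<le> 1" using s by (auto simp: l_def field_simps)
  have s': "s' = s + l * (1 - s)" using s by (simp add: l_def)
  have "interpolate s' h k x x = (1 - l) * interpolate s h k x x + l * k x x"
    unfolding interpolate_def s' by (simp add: algebra_simps)
  moreover have "(1 - l) * interpolate s h k x x \<le> 0" using l x by (simp add: mult_nonneg_nonpos)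
  moreover have "l * k x x < 0" using l k0 by (simp add: mult_pos_neg)
  ultimately show ?thesis by linarith
qed

lemma interpolate_cone:
  assumes s: "0 \<le> s" "s < s'" "s' \<le> 1" and x: "x \<in> future_cone (interpolate s h k) t"
  shows "interpolate s' h k x x < 0" "interpolate s' h k x t < 0"
proof -
  show "interpolate s' h k x x < 0" using interpolate_wider[OF s] x by (auto simp: future_cone_def)
  show "interpolate s' h k x t < 0"
    by (rule future_cone_orientation[OF interpolate_lorentzian interpolate_timelike
          interpolate_lorentzian interpolate_timelike interpolate_wider[OF s]])
      (use s x interpolate_timelike in auto)
qed

lemma interpolate_cone_top:
  assumes s: "0 \<le> s" "s < 1" and x: "x \<in> future_cone (interpolate s h k) t"
  shows "k x x < 0" "k x t' < 0"
proof -
  have k1: "interpolate 1 h k = k" by (simp add: interpolate_def)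
  show "k x x < 0" using interpolate_wider[of s 1 x] s x k1 by (auto simp: future_cone_def)
  show "k x t' < 0"
    by (rule future_cone_orientation[OF interpolate_lorentzian interpolate_timelike wide_form
          interpolate_wider[of s 1, unfolded k1]])
      (use s x wide_on_cone base_vector_in_cone in auto)
qed

end

section \<open>Charts, components and the order on metrics\<close>

lemma Ck_on_cong:
  assumes "open S" "\<And>x. x \<in> S \<Longrightarrow> f x = g x" "Ck_on k f S"
  shows "Ck_on k g S"
  using assms(2,3)
proof (induction k arbitrary: f g)
  case 0
  then show ?case by (simp cong: continuous_on_cong)
next
  case (Suc k)
  have diff: "f differentiable (at x)" if "x \<in> S" for x
    using Suc.prems(2) that assms(1) by (simp add: differentiable_on_eq_differentiable_at)
  have "(g has_derivative frechet_derivative f (at x)) (at x)" if "x \<in> S" for x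
    using has_derivative_transform_within_open[OF diff[OF that, unfolded frechet_derivative_works] assms(1) that]
      Suc.prems(1) by blast
  then have g: "g differentiable (at x)" "frechet_derivative g (at x) = frechet_derivative f (at x)"
    if "x \<in> S" for x
    using that by (auto simp: differentiable_def frechet_derivative_at[symmetric])
  have "Ck_on k (\<lambda>x. frechet_derivative g (at x) v) S" for v
    by (rule Suc.IH[of "\<lambda>x. frechet_derivative f (at x) v"]) (use Suc.prems(2) g in auto)
  then show ?case using g(1) assms(1) by (simp add: differentiable_on_eq_differentiable_at)
qed

text \<open>Needed to keep the differentiability class of interpolated metrics.\<close>

lemma Ck_on_linear_combination:
  fixes f g :: "'a::euclidean_space \<Rightarrow> real"
  assumes "open S" "Ck_on k f S" "Ck_on k g S"
  shows "Ck_on k (\<lambda>x. a * f x + b * g x) S"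
  using assms(2,3)
proof (induction k arbitrary: f g)
  case 0
  then show ?case by (simp add: continuous_on_add continuous_on_mult_left)
next
  case (Suc k)
  have d: "f differentiable (at x)" "g differentiable (at x)" if "x \<in> S" for x
    using Suc.prems that assms(1) by (simp_all add: differentiable_on_eq_differentiable_at)
  have D: "((\<lambda>x. a * f x + b * g x) has_derivative
      (\<lambda>v. a * frechet_derivative f (at x) v + b * frechet_derivative g (at x) v)) (at x)"
    if "x \<in> S" for x
    by (intro derivative_intros d[OF that, unfolded frechet_derivative_works])
  have "Ck_on k (\<lambda>x. frechet_derivative (\<lambda>x. a * f x + b * g x) (at x) v) S" for v
  proof -
    have "Ck_on k (\<lambda>x. a * frechet_derivative f (at x) v + b * frechet_derivative g (at x) v) S"
      using Suc.IH[of "\<lambda>x. frechet_derivative f (at x) v" "\<lambda>x. frechet_derivative g (at x) v"]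
        Suc.prems by simp
    moreover have "a * frechet_derivative f (at x) v + b * frechet_derivative g (at x) v
        = frechet_derivative (\<lambda>x. a * f x + b * g x) (at x) v" if "x \<in> S" for x
      using fun_cong[OF frechet_derivative_at[OF D[OF that]], of v] .
    ultimately show ?thesis by (rule Ck_on_cong[OF assms(1), rotated])
  qed
  then show ?case using D assms(1)
    by (auto simp: differentiable_on_eq_differentiable_at differentiable_def)
qed

lemma class_C_linear_combination:
  fixes f g :: "'a::euclidean_space \<Rightarrow> real"
  assumes "open S" "class_C r f S" "class_C r g S"
  shows "class_C r (\<lambda>x. a * f x + b * g x) S"
  using assms by (simp add: class_C_def Ck_on_linear_combination)

lemma is_chart_facts:
  assumes "is_chart c"
  shows chart_open: "open (fst c)" and chart_image_open: "open (snd c ` fst c)"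
    and chart_continuous: "continuous_on (fst c) (snd c)"
    and chart_inv_continuous: "continuous_on (snd c ` fst c) (inv_into (fst c) (snd c))"
    and chart_inv: "\<And>p. p \<in> fst c \<Longrightarrow> inv_into (fst c) (snd c) (snd c p) = p"
  using assms by (auto simp: is_chart_def homeomorphism_def)

lemma chart_inv': "x \<in> snd c ` fst c \<Longrightarrow> inv_into (fst c) (snd c) x \<in> fst c \<and> snd c (inv_into (fst c) (snd c) x) = x"
  by (simp add: f_inv_into_f inv_into_into)

lemma chart_preimage_open:
  assumes "is_chart c" "open S"
  shows "open {p \<in> fst c. snd c p \<in> S}"
  using continuous_open_preimage[OF chart_continuous chart_open, OF assms(1,1,2)]
  by (simp add: vimage_def Int_def)

lemma chart_image_of_open:
  assumes "is_chart c" "open U" "U \<subseteq> fst c"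
  shows "open (snd c ` U)"
proof -
  have "snd c ` U = {x \<in> snd c ` fst c. inv_into (fst c) (snd c) x \<in> U}"
    using assms(3) chart_inv[OF assms(1)] by (force simp: chart_inv')
  also have "open \<dots>"
    using continuous_open_preimage[OF chart_inv_continuous chart_image_open, OF assms(1,1,2)]
    by (simp add: vimage_def Int_def)
  finally show ?thesis .
qed

text \<open>The Gram form of the metric in the coordinate basis of the chart \<open>c\<close>; all pointwise arguments about
cones take place in these components.\<close>

definition component_form :: "('m, 'n::finite) chart set \<Rightarrow> ('m, 'n) metric \<Rightarrow> ('m, 'n) chart \<Rightarrow> 'm
    \<Rightarrow> real ^ 'n \<Rightarrow> real ^ 'n \<Rightarrow> real" where
  "component_form A g c p = (\<lambda>a b. g p (chart_vector A c p a) (chart_vector A c p b))"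

text \<open>Enough structure for the Jacobians of the transition maps to obey the chain rule and to depend
continuously on the point.\<close>

locale C1_atlas =
  fixes A :: "('m::t2_space, 'n::finite) chart set"
  assumes charts: "c \<in> A \<Longrightarrow> is_chart c"
    and cover: "\<exists>c\<in>A. p \<in> fst c"
    and transitions: "c \<in> A \<Longrightarrow> d \<in> A \<Longrightarrow> Ck_on 1 (transition c d) (snd c ` (fst c \<inter> fst d))"
begin

lemma overlap_open: "c \<in> A \<Longrightarrow> d \<in> A \<Longrightarrow> open (snd c ` (fst c \<inter> fst d))"
  using chart_image_of_open[OF charts open_Int[OF chart_open[OF charts] chart_open[OF charts]]] by simp

lemma transition_eq: "c \<in> A \<Longrightarrow> p \<in> fst c \<Longrightarrow> transition c d (snd c p) = snd d p"
  using chart_inv[OF charts] by (simp add: transition_def)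

lemma transition_derivative:
  assumes "c \<in> A" "d \<in> A" "p \<in> fst c" "p \<in> fst d"
  shows "(transition c d has_derivative frechet_derivative (transition c d) (at (snd c p))) (at (snd c p))"
  using transitions[OF assms(1,2)] overlap_open[OF assms(1,2)] assms(3,4)
  by (auto simp: differentiable_on_eq_differentiable_at frechet_derivative_works[symmetric])

lemma transition_derivative_continuous:
  assumes "c \<in> A" "d \<in> A"
  shows "continuous_on (snd c ` (fst c \<inter> fst d)) (\<lambda>x. frechet_derivative (transition c d) (at x) v)"
  using transitions[OF assms] by simp

lemma transition_cocycle:
  assumes cde: "c \<in> A" "d \<in> A" "e \<in> A" and p: "p \<in> fst c" "p \<in> fst d" "p \<in> fst e"
  shows "frechet_derivative (transition d e) (at (snd d p))
      (frechet_derivative (transition c d) (at (snd c p)) a)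
    = frechet_derivative (transition c e) (at (snd c p)) a"
proof -
  let ?O = "snd c ` (fst c \<inter> fst d)"
  have "(transition d e has_derivative frechet_derivative (transition d e) (at (snd d p)))
      (at (transition c d (snd c p)))"
    using transition_derivative cde p by (simp add: transition_eq)
  from diff_chain_at[OF transition_derivative[OF cde(1,2) p(1,2)] this]
  have "(transition c e has_derivative
      (frechet_derivative (transition d e) (at (snd d p)) \<circ>
       frechet_derivative (transition c d) (at (snd c p)))) (at (snd c p))"
    by (rule has_derivative_transform_within_open[OF _ overlap_open[OF cde(1,2)]])
      (use p in \<open>auto simp: transition_eq[OF cde(1)] transition_eq[OF cde(2)]\<close>)
  from frechet_derivative_at[OF this] show ?thesis by (simp add: fun_eq_iff)
qed

lemma chart_vector_self: "c \<in> A \<Longrightarrow> p \<in> fst c \<Longrightarrow> chart_vector A c p a c = a"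
proof -
  assume c: "c \<in> A" "p \<in> fst c"
  have "(transition c c has_derivative (\<lambda>v. v)) (at (snd c p))"
    by (rule has_derivative_transform_within_open[OF has_derivative_ident overlap_open[OF c(1,1)]])
      (use c in \<open>auto simp: transition_eq[OF c(1)]\<close>)
  from frechet_derivative_at[OF this] show ?thesis using c by (simp add: chart_vector_def fun_eq_iff)
qed

lemma chart_vector_tangent: "c \<in> A \<Longrightarrow> p \<in> fst c \<Longrightarrow> chart_vector A c p a \<in> tangent_space A p"
  unfolding tangent_space_def chart_vector_def using transition_cocycle by simp

lemma chart_vector_component:
  assumes "v \<in> tangent_space A p" "c \<in> A" "p \<in> fst c"
  shows "chart_vector A c p (v c) = v"
proof
  fix d show "chart_vector A c p (v c) d = v d"
  proof (cases "d \<in> A \<and> p \<in> fst d")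
    case True
    then have "v d = frechet_derivative (transition c d) (at (snd c p)) (v c)"
      using assms unfolding tangent_space_def mem_Collect_eq by blast
    then show ?thesis using True by (simp add: chart_vector_def)
  next
    case False
    then have "v d = 0" using assms(1) unfolding tangent_space_def mem_Collect_eq by blast
    then show ?thesis using False by (simp only: chart_vector_def if_False)
  qed
qed

lemma tangent_eq_0_iff:
  assumes "v \<in> tangent_space A p" "c \<in> A" "p \<in> fst c"
  shows "v = (\<lambda>_. 0) \<longleftrightarrow> v c = 0"
proof
  assume "v c = 0"
  moreover have "chart_vector A c p 0 = (\<lambda>_. 0)"
  proof
    fix d
    show "chart_vector A c p 0 d = 0"
    proof (cases "d \<in> A \<and> p \<in> fst d")
      case True
      then have "linear (frechet_derivative (transition c d) (at (snd c p)))"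
        using transition_derivative[OF assms(2) _ assms(3)] has_derivative_linear by blast
      from linear_0[OF this] show ?thesis by (simp add: chart_vector_def)
    next
      case False
      then show ?thesis by (auto simp: chart_vector_def)
    qed
  qed
  ultimately show "v = (\<lambda>_. 0)" using chart_vector_component[OF assms] by simp
qed simp

lemma future_causal_iff:
  assumes "T p \<in> tangent_space A p" "c \<in> A" "p \<in> fst c"
  shows "v \<in> future_causal A g T p \<longleftrightarrow>
    v \<in> tangent_space A p \<and> v c \<in> future_cone (component_form A g c p) (T p c)"
proof (cases "v \<in> tangent_space A p")
  case True
  then show ?thesis
    using tangent_eq_0_iff[OF True assms(2,3)]
    by (simp add: future_causal_def future_cone_def component_form_def
        chart_vector_component[OF True assms(2,3)] chart_vector_component[OF assms])
next
  case False
  then show ?thesis by (simp add: future_causal_def)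
qed

lemma future_timelike_iff:
  assumes "T p \<in> tangent_space A p" "c \<in> A" "p \<in> fst c" "bilinear (component_form A g c p)"
  shows "v \<in> future_timelike A g T p \<longleftrightarrow>
    v \<in> tangent_space A p \<and> component_form A g c p (v c) (v c) < 0 \<and> component_form A g c p (v c) (T p c) < 0"
proof -
  have "v c \<noteq> 0" if "component_form A g c p (v c) (v c) < 0"
    using that bilinear_simps(9)[OF assms(4)] by (metis less_irrefl)
  note nonzero = this
  show ?thesis
  proof (cases "v \<in> tangent_space A p")
    case True
    then show ?thesis
      using tangent_eq_0_iff[OF True assms(2,3)] nonzero
      by (auto simp: future_timelike_def component_form_def
          chart_vector_component[OF True assms(2,3)] chart_vector_component[OF assms(1-3)])
  next
    case False
    then show ?thesis by (simp add: future_timelike_def)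
  qed
qed

end

lemma spacetime_C1_atlas: "C1_atlas A" if "spacetime r A g T"
proof
  have a: "is_atlas (eSuc r) A" using that by (simp add: spacetime_def)
  show "is_chart c" if "c \<in> A" for c using a that by (simp add: is_atlas_def)
  show "\<exists>c\<in>A. p \<in> fst c" for p using a by (auto simp: is_atlas_def)
  have "enat 1 \<le> eSuc r" by (cases r) (auto simp: eSuc_enat)
  then show "Ck_on 1 (transition c d) (snd c ` (fst c \<inter> fst d))" if "c \<in> A" "d \<in> A" for c d
    using a that unfolding is_atlas_def class_C_def by blast
qed

lemma spacetime_forms:
  assumes st: "spacetime r A g T" and c: "c \<in> A"
  shows spacetime_form: "p \<in> fst c \<Longrightarrow> lorentzian_form (component_form A g c p)"
    and spacetime_form_continuous: "continuous_on (fst c) (\<lambda>p. component_form A g c p a b)"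
    and spacetime_tangent: "T p \<in> tangent_space A p"
    and spacetime_timelike: "p \<in> fst c \<Longrightarrow> component_form A g c p (T p c) (T p c) < 0"
    and spacetime_T_continuous: "continuous_on (fst c) (\<lambda>p. T p c)"
proof -
  interpret C1_atlas A by (rule spacetime_C1_atlas[OF st])
  have lm: "lorentzian_metric r A g" and to: "time_orientation A g T"
    using st by (auto simp: spacetime_def)
  show "p \<in> fst c \<Longrightarrow> lorentzian_form (component_form A g c p)"
    using lm c by (simp add: lorentzian_metric_def component_form_def)
  show T: "T p \<in> tangent_space A p" using to by (simp add: time_orientation_def)
  show "p \<in> fst c \<Longrightarrow> component_form A g c p (T p c) (T p c) < 0"
    using to c chart_vector_component[OF T c] by (simp add: component_form_def time_orientation_def)
  show "continuous_on (fst c) (\<lambda>p. T p c)" using to c by (simp add: time_orientation_def)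
  have "class_C r (\<lambda>x. component_form A g c (inv_into (fst c) (snd c) x) a b) (snd c ` fst c)"
    using lm c by (simp add: lorentzian_metric_def component_form_def Let_def)
  then have "continuous_on (snd c ` fst c) (\<lambda>x. component_form A g c (inv_into (fst c) (snd c) x) a b)"
    unfolding class_C_def by (metis Ck_on.simps(1) i0_lb zero_enat_def)
  from continuous_on_compose2[OF this chart_continuous[OF charts[OF c]]]
  have "continuous_on (fst c) (\<lambda>p. component_form A g c (inv_into (fst c) (snd c) (snd c p)) a b)" by simp
  then show "continuous_on (fst c) (\<lambda>p. component_form A g c p a b)"
    by (rule continuous_on_eq) (simp add: chart_inv[OF charts[OF c]])
qed

lemma wider_cone:
  assumes st: "spacetime r A g T" and w: "wider r A g' T' g T" and c: "c \<in> A" "p \<in> fst c"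
    and x: "x \<in> future_cone (component_form A g c p) (T p c)"
  shows "component_form A g' c p x x < 0 \<and> component_form A g' c p x (T' p c) < 0"
proof -
  interpret C1_atlas A by (rule spacetime_C1_atlas[OF st])
  have st': "spacetime r A g' T'" using w by (simp add: wider_def)
  have "chart_vector A c p x \<in> future_causal A g T p"
    unfolding future_causal_iff[of T p c, OF spacetime_tangent[OF st c(1)] c]
    using x c by (simp add: chart_vector_tangent chart_vector_self)
  then have "chart_vector A c p x \<in> future_timelike A g' T' p"
    using w unfolding wider_def by blast
  then show ?thesis
    unfolding future_timelike_iff[of T' p c, OF spacetime_tangent[OF st' c(1)] c lorentzian_form_bilinear[OF spacetime_form[OF st' c]]]
    using c by (simp add: chart_vector_self)
qed

lemma wider_forms_components:
  assumes "spacetime r A g T" "wider r A g' T' g T" "c \<in> A" "p \<in> fst c"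
  shows "wider_forms (component_form A g c p) (T p c) (component_form A g' c p) (T' p c)"
proof -
  have "spacetime r A g' T'" using assms(2) by (simp add: wider_def)
  then show ?thesis
    using wider_cone[OF assms] spacetime_form[OF assms(1,3,4)] spacetime_timelike[OF assms(1,3,4)]
      spacetime_form[of r A g' T' c p] spacetime_timelike[of r A g' T' c p] assms(3,4)
    by (simp add: wider_forms_def)
qed

lemma widerI:
  assumes st: "spacetime r A g T" and st': "spacetime r A g' T'"
    and cone: "\<And>c p x. c \<in> A \<Longrightarrow> p \<in> fst c \<Longrightarrow> x \<in> future_cone (component_form A g c p) (T p c) \<Longrightarrow>
      component_form A g' c p x x < 0 \<and> component_form A g' c p x (T' p c) < 0"
  shows "wider r A g' T' g T"
  unfolding wider_def
proof (intro conjI allI subsetI st')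
  interpret C1_atlas A by (rule spacetime_C1_atlas[OF st])
  fix p v assume v: "v \<in> future_causal A g T p"
  obtain c where c: "c \<in> A" "p \<in> fst c" using cover by blast
  show "v \<in> future_timelike A g' T' p"
    unfolding future_timelike_iff[of T' p c, OF spacetime_tangent[OF st' c(1)] c lorentzian_form_bilinear[OF spacetime_form[OF st' c]]]
    using v cone[OF c, of "v c"]
    by (simp add: future_causal_iff[of T p c, OF spacetime_tangent[OF st c(1)] c])
qed

definition interpolated_metric :: "real \<Rightarrow> ('m, 'n) metric \<Rightarrow> ('m, 'n) metric \<Rightarrow> ('m, 'n) metric" where
  "interpolated_metric s g g' = (\<lambda>p. interpolate s (g p) (g' p))"

lemma component_form_interpolated:
  "component_form A (interpolated_metric s g g') c p
    = interpolate s (component_form A g c p) (component_form A g' c p)"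
  by (simp add: component_form_def interpolated_metric_def interpolate_def)

lemma interpolated_metric_0: "interpolated_metric 0 g g' = g"
  by (simp add: interpolated_metric_def interpolate_def)

context
  fixes r and A :: "('m::t2_space, 'n::finite) chart set" and g T g' T'
  assumes st: "spacetime r A g T" and w: "wider r A g' T' g T"
begin

lemma wider_spacetime: "spacetime r A g' T'" using w by (simp add: wider_def)

text \<open>The time orientation of \<open>g\<close> serves all interpolated metrics, because vectors timelike for \<open>g\<close> stay
timelike.\<close>

lemma spacetime_interpolated:
  assumes s: "0 \<le> s" "s \<le> 1"
  shows "spacetime r A (interpolated_metric s g g') T"
proof -
  interpret C1_atlas A by (rule spacetime_C1_atlas[OF st])
  have lor: "lorentzian_form (component_form A (interpolated_metric s g g') c p)"
    if c: "c \<in> A" "p \<in> fst c" for c p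
    unfolding component_form_interpolated
    by (rule interpolate_lorentzian[OF wider_forms_components[OF st w c] s])
  have neg: "component_form A (interpolated_metric s g g') c p (T p c) (T p c) < 0"
    if c: "c \<in> A" "p \<in> fst c" for c p
    unfolding component_form_interpolated
    by (rule interpolate_timelike[OF wider_forms_components[OF st w c] s])
  have "class_C r (\<lambda>x. component_form A (interpolated_metric s g g') c (inv_into (fst c) (snd c) x) a b) (snd c ` fst c)"
    if c: "c \<in> A" for c a b
  proof -
    have "class_C r (\<lambda>x. component_form A g c (inv_into (fst c) (snd c) x) a b) (snd c ` fst c)"
      "class_C r (\<lambda>x. component_form A g' c (inv_into (fst c) (snd c) x) a b) (snd c ` fst c)"
      using st wider_spacetime c
      by (simp_all add: spacetime_def lorentzian_metric_def component_form_def Let_def)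
    from class_C_linear_combination[OF chart_image_open[OF charts[OF c]] this]
    show ?thesis unfolding component_form_interpolated interpolate_def .
  qed
  then have "lorentzian_metric r A (interpolated_metric s g g')"
    using lor by (simp add: lorentzian_metric_def component_form_def Let_def)
  moreover have "time_orientation A (interpolated_metric s g g') T"
    unfolding time_orientation_def
  proof (intro conjI allI ballI)
    fix p
    obtain c where c: "c \<in> A" "p \<in> fst c" using cover by blast
    show T: "T p \<in> tangent_space A p" using spacetime_tangent[OF st c(1)] .
    show "interpolated_metric s g g' p (T p) (T p) < 0"
      using neg[OF c] chart_vector_component[OF T c] by (simp add: component_form_def)
  qed (use spacetime_T_continuous[OF st] in blast)
  ultimately show ?thesis using st by (simp add: spacetime_def)
qed

lemma wider_interpolated:
  assumes s: "0 \<le> s" "s < s'" "s' \<le> 1"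
  shows "wider r A (interpolated_metric s' g g') T (interpolated_metric s g g') T"
  using s
  by (intro widerI spacetime_interpolated)
    (auto simp: component_form_interpolated
      intro: interpolate_cone[OF wider_forms_components[OF st w] s])

lemma wider_interpolated_top:
  assumes s: "0 \<le> s" "s < 1"
  shows "wider r A g' T' (interpolated_metric s g g') T"
  using s
  by (intro widerI spacetime_interpolated wider_spacetime)
    (auto simp: component_form_interpolated
      intro: interpolate_cone_top[OF wider_forms_components[OF st w] s])

end

text \<open>A metric is given by finitely many continuous components, so it is continuous in the base point and both
vectors together.\<close>

lemma component_form_jointly_continuous:
  assumes st: "spacetime r A g T" and c: "c \<in> A"
    and f: "continuous_on S f" "\<And>z. z \<in> S \<Longrightarrow> f z \<in> fst c"
    and x: "continuous_on S x" and y: "continuous_on S y"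
  shows "continuous_on S (\<lambda>z. component_form A g c (f z) (x z) (y z))"
proof -
  have eq: "component_form A g c (f z) (x z) (y z)
    = (\<Sum>i\<in>UNIV. \<Sum>j\<in>UNIV. x z $ i * y z $ j * component_form A g c (f z) (axis i 1) (axis j 1))"
    if z: "z \<in> S" for z
  proof -
    have "v = (\<Sum>i\<in>UNIV. v $ i *\<^sub>R axis i 1)" for v :: "real ^ 'b"
      using basis_expansion[of v] by (simp add: scalar_mult_eq_scaleR)
    then show ?thesis
      using bilinear_sum_both[OF lorentzian_form_bilinear[OF spacetime_form[OF st c f(2)[OF z]]] finite finite,
        of "\<lambda>i. x z $ i" "\<lambda>i. axis i 1" UNIV "\<lambda>i. y z $ i" "\<lambda>i. axis i 1" UNIV] by metis
  qed
  have cf: "continuous_on S (\<lambda>z. component_form A g c (f z) a b)" for a b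
    by (rule continuous_on_compose2[OF spacetime_form_continuous[OF st c] f(1)]) (use f in auto)
  have "continuous_on S (\<lambda>z. \<Sum>i\<in>UNIV. \<Sum>j\<in>UNIV. x z $ i * y z $ j * component_form A g c (f z) (axis i 1) (axis j 1))"
    by (intro continuous_intros cf x y)
  then show ?thesis by (rule continuous_on_eq) (simp add: eq)
qed

text \<open>The causal unit vectors of \<open>g\<close> near \<open>p0\<close> form a closed set, contained over \<open>p0\<close> in the open set of
timelike vectors of \<open>g'\<close>. Compactness of the unit sphere makes the resulting room uniform in the
direction, and homogeneity extends it to all vectors with an error proportional to the length. Both the
rounding of corners and the moving of end points are controlled by this constant \<open>e\<close> only.\<close>

lemma robust_cone:
  assumes st: "spacetime r A g T" and w: "wider r A g' T' g T" and c: "c \<in> A" and p0: "p0 \<in> fst c"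
  obtains N e where "open N" "p0 \<in> N" "N \<subseteq> fst c" "e > 0"
    "\<And>p q a b. p \<in> N \<Longrightarrow> q \<in> N \<Longrightarrow> a \<in> future_cone (component_form A g c p) (T p c) \<Longrightarrow>
      norm (b - a) \<le> e * norm a \<Longrightarrow> b \<in> future_cone (component_form A g' c q) (T' q c)"
proof -
  interpret C1_atlas A by (rule spacetime_C1_atlas[OF st])
  have st': "spacetime r A g' T'" using w by (simp add: wider_def)
  let ?h = "component_form A g c" and ?k = "component_form A g' c"
  define P where "P = fst c \<times> (UNIV :: (real^'b) set)"
  have P: "open P" unfolding P_def by (intro open_Times chart_open charts c open_UNIV)
  \<comment> \<open>\<open>W\<close>: future timelike vectors of \<open>g'\<close>; the complement of \<open>G\<close> contains the future causal vectors of \<open>g\<close>.\<close>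
  define W where "W = {z \<in> P. ?k (fst z) (snd z) (snd z) < 0} \<inter> {z \<in> P. ?k (fst z) (snd z) (T' (fst z) c) < 0}"
  define G where "G = {z \<in> P. ?h (fst z) (snd z) (snd z) > 0} \<union> {z \<in> P. ?h (fst z) (snd z) (T (fst z) c) > 0}"
  have TP: "continuous_on P (\<lambda>z. T (fst z) c)" "continuous_on P (\<lambda>z. T' (fst z) c)"
    by (rule continuous_on_compose2[OF spacetime_T_continuous[OF st c]];
        auto simp: P_def intro!: continuous_intros)
       (rule continuous_on_compose2[OF spacetime_T_continuous[OF st' c]];
        auto simp: P_def intro!: continuous_intros)
  have opn: "open {z \<in> P. f z < (0::real)}" "open {z \<in> P. f z > (0::real)}" if "continuous_on P f" for f
    using continuous_open_preimage[OF that P open_lessThan[of 0]] continuous_open_preimage[OF that P open_greaterThan[of 0]]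
    by (simp_all add: vimage_def Int_def)
  have W: "open W" and G: "open G" unfolding W_def G_def
    by (intro open_Int open_Un opn component_form_jointly_continuous[OF st c]
        component_form_jointly_continuous[OF st' c] continuous_on_fst continuous_on_snd continuous_on_id TP;
        auto simp: P_def)+
  define good where "good v N e \<longleftrightarrow> open N \<and> p0 \<in> N \<and> N \<subseteq> fst c \<and> e > 0 \<and>
      (\<forall>p\<in>N. \<forall>q\<in>N. \<forall>a b. norm a = 1 \<longrightarrow> dist a v < e \<longrightarrow> dist b v < e \<longrightarrow>
        a \<in> future_cone (?h p) (T p c) \<longrightarrow> b \<in> future_cone (?k q) (T' q c))" for v N e
  have W_cone: "b \<in> future_cone (?k q) (T' q c)" if "(q, b) \<in> W" for q b
    using that bilinear_simps(9)[OF lorentzian_form_bilinear[OF spacetime_form[OF st' c]], of q b]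
    by (auto simp: W_def P_def future_cone_def)
  have "\<exists>N e. good v N e" if v: "norm v = 1" for v
  proof -
    have nbhd: "\<exists>N e. open N \<and> p0 \<in> N \<and> N \<subseteq> fst c \<and> e > 0 \<and> N \<times> ball v e \<subseteq> X"
      if X: "open X" "(p0, v) \<in> X" for X
    proof -
      obtain N B where NB: "open N" "open B" "p0 \<in> N" "v \<in> B" "N \<times> B \<subseteq> X"
        using X open_prod_elim by (metis mem_Times_iff fst_conv snd_conv)
      obtain e where "e > 0" "ball v e \<subseteq> B" using NB open_contains_ball by blast
      then show ?thesis
        using NB chart_open[OF charts[OF c]] p0 by (intro exI[of _ "N \<inter> fst c"] exI[of _ e]) auto
    qed
    show ?thesis
    proof (cases "(p0, v) \<in> G")
      case True
      then obtain N e where *: "open N" "p0 \<in> N" "N \<subseteq> fst c" "e > 0" "N \<times> ball v e \<subseteq> G"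
        using nbhd[OF G] by blast
      have "a \<notin> future_cone (?h p) (T p c)" if "p \<in> N" "dist a v < e" for p a
      proof -
        have "(p, a) \<in> G" using * that by (auto simp: dist_commute)
        then show ?thesis by (auto simp: G_def future_cone_def)
      qed
      then show ?thesis using * unfolding good_def by blast
    next
      case False
      then have "?h p0 v v \<le> 0" "?h p0 v (T p0 c) \<le> 0" using p0 by (auto simp: G_def P_def)
      moreover have "v \<noteq> 0" using v by auto
      ultimately have "v \<in> future_cone (?h p0) (T p0 c)"
        using causal_not_orthogonal[OF spacetime_form[OF st c p0] spacetime_timelike[OF st c p0], of v]
        by (auto simp: future_cone_def)
      then have "(p0, v) \<in> W" using wider_cone[OF st w c p0] p0 by (auto simp: W_def P_def)
      then obtain N e where *: "open N" "p0 \<in> N" "N \<subseteq> fst c" "e > 0" "N \<times> ball v e \<subseteq> W"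
        using nbhd[OF W] by blast
      have "b \<in> future_cone (?k q) (T' q c)" if "q \<in> N" "dist b v < e" for q b
        using * that by (intro W_cone) (auto simp: dist_commute)
      then show ?thesis using * unfolding good_def by blast
    qed
  qed
  then obtain N e where Ne: "\<And>v. norm v = 1 \<Longrightarrow> good v (N v) (e v)" by metis
  have cover_sphere: "sphere 0 1 \<subseteq> (\<Union>v\<in>sphere 0 1. ball v (e v / 2))"
    using Ne by (force simp: good_def)
  obtain V where V: "V \<subseteq> sphere 0 1" "finite V" "sphere 0 1 \<subseteq> (\<Union>v\<in>V. ball v (e v / 2))"
    by (rule compactE_image[OF compact_sphere _ cover_sphere]) (rule open_ball | assumption | rule that)+
  have V_good: "good v (N v) (e v)" if "v \<in> V" for v using V(1) Ne that by auto
  define N' where "N' = fst c \<inter> (\<Inter>v\<in>V. N v)"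
  define e' where "e' = Min (insert 1 ((\<lambda>v. e v / 4) ` V))"
  have "e' > 0" using V(2) V_good by (auto simp: e'_def good_def)
  have e': "e' \<le> e v / 4" if "v \<in> V" for v unfolding e'_def by (rule Min_le) (use V(2) that in auto)
  have "b \<in> future_cone (?k q) (T' q c)"
    if pq: "p \<in> N'" "q \<in> N'" and a: "a \<in> future_cone (?h p) (T p c)" and b: "norm (b - a) \<le> e' * norm a" for p q a b
  proof -
    note bh = bilinear_simps[OF lorentzian_form_bilinear[OF spacetime_form[OF st c, of p]]]
    note bk = bilinear_simps[OF lorentzian_form_bilinear[OF spacetime_form[OF st' c, of q]]]
    have pqc: "p \<in> fst c" "q \<in> fst c" using pq by (auto simp: N'_def)
    have na: "norm a > 0" using a by (simp add: future_cone_def)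
    define t where "t = 1 / norm a"
    have t: "t > 0" using na by (simp add: t_def)
    have ta: "norm (t *\<^sub>R a) = 1" using na by (simp add: t_def)
    then have "t *\<^sub>R a \<in> (\<Union>v\<in>V. ball v (e v / 2))" using V(3) by (metis mem_sphere_0 subsetD)
    then obtain v where v: "v \<in> V" "dist v (t *\<^sub>R a) < e v / 2" by auto
    have "norm (t *\<^sub>R b - t *\<^sub>R a) = t * norm (b - a)"
      using t by (metis abs_of_pos norm_scaleR scaleR_diff_right)
    also have "\<dots> \<le> t * (e' * norm a)" using b t by simp
    also have "\<dots> = e'" using na by (simp add: t_def)
    finally have "dist (t *\<^sub>R b) (t *\<^sub>R a) \<le> e v / 4" using e'[OF v(1)] by (simp add: dist_norm)
    moreover have "e v > 0" using V_good[OF v(1)] by (simp add: good_def)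
    ultimately have "dist (t *\<^sub>R b) v < e v" "dist (t *\<^sub>R a) v < e v"
      using v(2) dist_triangle[of "t *\<^sub>R b" v "t *\<^sub>R a"] dist_commute[of v "t *\<^sub>R a"]
        zero_le_dist[of v "t *\<^sub>R a"] by linarith+
    moreover have "t *\<^sub>R a \<in> future_cone (?h p) (T p c)"
      using a t by (auto simp: future_cone_def bh[OF pqc(1)] mult_pos_neg mult_nonneg_nonpos)
    moreover have "p \<in> N v" "q \<in> N v" using pq v by (auto simp: N'_def)
    ultimately have "t *\<^sub>R b \<in> future_cone (?k q) (T' q c)"
      using V_good[OF v(1)] ta unfolding good_def by blast
    then show ?thesis
      using t by (auto simp: future_cone_def bk[OF pqc(2)] mult_less_0_iff mult_le_0_iff)
  qed
  moreover have "open N'" "p0 \<in> N'" "N' \<subseteq> fst c"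
    using V(2) V_good chart_open[OF charts[OF c]] p0 unfolding N'_def good_def by auto
  ultimately show thesis using that[of N' e'] \<open>e' > 0\<close> by blast
qed

section \<open>Locality of causal curves\<close>

lemma continuous_on_localI:
  assumes "\<And>t. t \<in> S \<Longrightarrow> \<exists>U. open U \<and> t \<in> U \<and> continuous_on (U \<inter> S) f"
  shows "continuous_on S f"
  unfolding continuous_on_def
proof
  fix t assume "t \<in> S"
  then obtain U where U: "open U" "t \<in> U" "continuous_on (U \<inter> S) f" using assms by blast
  have "at t within (U \<inter> S) = at t within S" by (rule at_within_nhd[OF U(2,1)]) auto
  then show "(f \<longlongrightarrow> f t) (at t within S)"
    using U \<open>t \<in> S\<close> unfolding continuous_on_def by (metis IntI)
qed

lemma has_vector_derivative_local:
  assumes "(f has_vector_derivative d) (at s within I)" "open W" "s \<in> W" "s \<in> I'"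
    "W \<inter> I' \<subseteq> I" "\<And>r. r \<in> W \<inter> I' \<Longrightarrow> f r = f' r"
  shows "(f' has_vector_derivative d) (at s within I')"
proof -
  have "(f has_vector_derivative d) (at s within (W \<inter> I'))"
    by (rule has_vector_derivative_within_subset[OF assms(1,5)])
  then have "(f' has_vector_derivative d) (at s within (W \<inter> I'))"
    by (rule has_vector_derivative_transform[rotated 2]) (use assms in auto)
  moreover have "at s within (W \<inter> I') = at s within I'" by (rule at_within_nhd[OF assms(3,2)]) auto
  ultimately show ?thesis by simp
qed

lemma continuous_on_open_nhd:
  assumes "continuous_on I f" "t \<in> I" "open B" "f t \<in> B"
  obtains U where "open U" "t \<in> U" "f ` (U \<inter> I) \<subseteq> B"
  using assms unfolding continuous_on_topological by (metis IntD1 IntD2 image_subsetI)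

text \<open>The curve \<open>\<gamma>\<close> on the part \<open>J\<close> of its parameter interval \<open>I\<close>, seen in one chart. Derivatives are one-sided
at the ends of \<open>I\<close>, so \<open>I\<close> has to be remembered.\<close>

definition chart_causal where
  "chart_causal A g T c I J \<gamma> \<longleftrightarrow> \<gamma> ` J \<subseteq> fst c \<and> (\<exists>u. continuous_on J u \<and>
    (\<forall>s\<in>J. ((snd c \<circ> \<gamma>) has_vector_derivative u s) (at s within I) \<and>
       u s \<in> future_cone (component_form A g c (\<gamma> s)) (T (\<gamma> s) c)))"

definition locally_causal where
  "locally_causal A g T I \<gamma> t \<longleftrightarrow> (\<exists>c\<in>A. \<exists>U. open U \<and> t \<in> U \<and> chart_causal A g T c I (U \<inter> I) \<gamma>)"

text \<open>The hypothesis relates two curves with possibly different parameter intervals; it covers restriction to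
a subinterval as well as agreement near \<open>t\<close>.\<close>

lemma locally_causal_cong:
  assumes "locally_causal A g T I \<gamma> t" "open W" "t \<in> W" "W \<inter> I' \<subseteq> I"
    "\<And>s. s \<in> W \<inter> I' \<Longrightarrow> \<gamma>' s = \<gamma> s"
  shows "locally_causal A g T I' \<gamma>' t"
proof -
  obtain c U u where c: "c \<in> A" and U: "open U" "t \<in> U" and im: "\<gamma> ` (U \<inter> I) \<subseteq> fst c"
    and cont: "continuous_on (U \<inter> I) u"
    and u: "\<And>s. s \<in> U \<inter> I \<Longrightarrow> ((snd c \<circ> \<gamma>) has_vector_derivative u s) (at s within I) \<and>
       u s \<in> future_cone (component_form A g c (\<gamma> s)) (T (\<gamma> s) c)"
    using assms(1) unfolding locally_causal_def chart_causal_def by metis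
  have sub: "(U \<inter> W) \<inter> I' \<subseteq> U \<inter> I" using assms(4) by blast
  have "chart_causal A g T c I' ((U \<inter> W) \<inter> I') \<gamma>'"
    unfolding chart_causal_def
  proof (intro conjI exI[of _ u] ballI)
    show "\<gamma>' ` (U \<inter> W \<inter> I') \<subseteq> fst c" using im sub assms(5) by (auto simp: image_subset_iff)
    show "continuous_on (U \<inter> W \<inter> I') u" by (rule continuous_on_subset[OF cont sub])
    fix s assume s: "s \<in> U \<inter> W \<inter> I'"
    show "((snd c \<circ> \<gamma>') has_vector_derivative u s) (at s within I')"
      by (rule has_vector_derivative_local[where W = W and I = I and f = "snd c \<circ> \<gamma>"])
        (use assms s u sub in auto)
    show "u s \<in> future_cone (component_form A g c (\<gamma>' s)) (T (\<gamma>' s) c)"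
      using u[of s] s sub assms(5)[of s] by auto
  qed
  then show ?thesis unfolding locally_causal_def using c U assms(2,3) by (meson IntI open_Int)
qed

lemma causal_curve_chart_causal:
  assumes st: "spacetime r A g T" and \<gamma>: "future_causal_curve A g T a b \<gamma>"
    and c: "c \<in> A" and J: "J \<subseteq> {a..b}" "\<gamma> ` J \<subseteq> fst c"
  shows "chart_causal A g T c {a..b} J \<gamma>"
  unfolding chart_causal_def
proof (intro conjI exI[of _ "\<lambda>t. vector_derivative (snd c \<circ> \<gamma>) (at t within {a..b})"] ballI J)
  interpret C1_atlas A by (rule spacetime_C1_atlas[OF st])
  have C1: "C1_curve A a b \<gamma>" and vel: "\<And>t. t \<in> {a..b} \<Longrightarrow> velocity A a b \<gamma> t \<in> future_causal A g T (\<gamma> t)"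
    using \<gamma> by (auto simp: future_causal_curve_def)
  have "continuous_on {t \<in> {a..b}. \<gamma> t \<in> fst c} (\<lambda>t. vector_derivative (snd c \<circ> \<gamma>) (at t within {a..b}))"
    using C1 c unfolding C1_curve_def by blast
  then show "continuous_on J (\<lambda>t. vector_derivative (snd c \<circ> \<gamma>) (at t within {a..b}))"
    by (rule continuous_on_subset) (use J in auto)
  fix s assume s: "s \<in> J"
  then have s': "s \<in> {a..b}" "\<gamma> s \<in> fst c" using J by auto
  then have "(snd c \<circ> \<gamma>) differentiable (at s within {a..b})"
    using C1 c unfolding C1_curve_def by blast
  then show "((snd c \<circ> \<gamma>) has_vector_derivative vector_derivative (snd c \<circ> \<gamma>) (at s within {a..b})) (at s within {a..b})"
    by (simp add: vector_derivative_works)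
  have "velocity A a b \<gamma> s c = vector_derivative (snd c \<circ> \<gamma>) (at s within {a..b})"
    using c s' by (simp add: velocity_def)
  then show "vector_derivative (snd c \<circ> \<gamma>) (at s within {a..b})
      \<in> future_cone (component_form A g c (\<gamma> s)) (T (\<gamma> s) c)"
    using vel[OF s'(1)] future_causal_iff[of T "\<gamma> s" c, OF spacetime_tangent[OF st c] c s'(2)] by simp
qed

lemma causal_curve_continuous: "future_causal_curve A g T a b \<gamma> \<Longrightarrow> continuous_on {a..b} \<gamma>"
  by (simp add: future_causal_curve_def C1_curve_def)

lemma causal_curve_nhd:
  assumes st: "spacetime r A g T" and \<gamma>: "future_causal_curve A g T a b \<gamma>"
    and t: "t \<in> {a..b}" and c: "c \<in> A" and B: "open B" "B \<subseteq> fst c" "\<gamma> t \<in> B"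
  obtains U where "open U" "t \<in> U" "\<gamma> ` (U \<inter> {a..b}) \<subseteq> B" "chart_causal A g T c {a..b} (U \<inter> {a..b}) \<gamma>"
proof -
  obtain U where "open U" "t \<in> U" "\<gamma> ` (U \<inter> {a..b}) \<subseteq> B"
    by (rule continuous_on_open_nhd[OF causal_curve_continuous[OF \<gamma>] t B(1,3)])
  with that[of U] causal_curve_chart_causal[OF st \<gamma> c, of "U \<inter> {a..b}"] B(2) show thesis by blast
qed

lemma causal_curve_locally_causal:
  assumes st: "spacetime r A g T" and \<gamma>: "future_causal_curve A g T a b \<gamma>" and t: "t \<in> {a..b}"
  shows "locally_causal A g T {a..b} \<gamma> t"
proof -
  interpret C1_atlas A by (rule spacetime_C1_atlas[OF st])
  obtain c where c: "c \<in> A" "\<gamma> t \<in> fst c" using cover by blast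
  obtain U where "open U" "t \<in> U" "chart_causal A g T c {a..b} (U \<inter> {a..b}) \<gamma>"
    by (rule causal_curve_nhd[OF st \<gamma> t c(1) chart_open[OF charts[OF c(1)]] order_refl c(2)])
  then show ?thesis unfolding locally_causal_def using c(1) by blast
qed

lemma (in C1_atlas) chart_curve_continuous:
  assumes c: "c \<in> A" and im: "\<gamma> ` J \<subseteq> fst c" and X: "continuous_on J (snd c \<circ> \<gamma>)"
  shows "continuous_on J \<gamma>"
proof -
  have "continuous_on J (inv_into (fst c) (snd c) \<circ> (snd c \<circ> \<gamma>))"
    by (rule continuous_on_compose[OF X continuous_on_subset[OF chart_inv_continuous[OF charts[OF c]]]])
      (use im in auto)
  then show ?thesis
    by (rule continuous_on_eq) (use im chart_inv[OF charts[OF c]] in auto)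
qed

lemma (in C1_atlas) transition_derivative_jointly_continuous:
  assumes cd: "c \<in> A" "d \<in> A" and x: "continuous_on S x" "\<And>s. s \<in> S \<Longrightarrow> x s \<in> snd c ` (fst c \<inter> fst d)"
    and v: "continuous_on S v"
  shows "continuous_on S (\<lambda>s. frechet_derivative (transition c d) (at (x s)) (v s))"
proof -
  have eq: "frechet_derivative (transition c d) (at (x s)) (v s)
    = (\<Sum>i\<in>UNIV. v s $ i *\<^sub>R frechet_derivative (transition c d) (at (x s)) (axis i 1))" if s: "s \<in> S" for s
  proof -
    obtain p where p: "p \<in> fst c" "p \<in> fst d" "x s = snd c p" using x(2)[OF s] by blast
    have lin: "linear (frechet_derivative (transition c d) (at (x s)))"
      unfolding p(3) using transition_derivative[OF cd p(1,2)] has_derivative_linear by blast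
    have "v s = (\<Sum>i\<in>UNIV. v s $ i *\<^sub>R axis i 1)"
      using basis_expansion[of "v s"] by (simp add: scalar_mult_eq_scaleR)
    then have "frechet_derivative (transition c d) (at (x s)) (v s)
      = frechet_derivative (transition c d) (at (x s)) (\<Sum>i\<in>UNIV. v s $ i *\<^sub>R axis i 1)" by simp
    then show ?thesis by (simp only: linear_sum[OF lin] linear_scale[OF lin])
  qed
  have "continuous_on S (\<lambda>s. \<Sum>i\<in>UNIV. v s $ i *\<^sub>R frechet_derivative (transition c d) (at (x s)) (axis i 1))"
    by (intro continuous_intros v continuous_on_compose2[OF transition_derivative_continuous[OF cd] x(1)])
      (use x(2) in auto)
  then show ?thesis by (rule continuous_on_eq) (simp only: eq)
qed

text \<open>A curve only has to be tested in one chart near each parameter: the velocity in another chart is the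
image under the Jacobian of the transition map, which depends continuously on the point, and this
transformation rule is also what makes the velocity a tangent vector.\<close>

lemma locally_causal_curve:
  assumes st: "spacetime r A g T" and ab: "a < b"
    and loc: "\<And>t. t \<in> {a..b} \<Longrightarrow> locally_causal A g T {a..b} \<gamma> t"
  shows "future_causal_curve A g T a b \<gamma>"
proof -
  interpret C1_atlas A by (rule spacetime_C1_atlas[OF st])
  let ?I = "{a..b}"
  define L where "L c U u \<longleftrightarrow> c \<in> A \<and> open U \<and> \<gamma> ` (U \<inter> ?I) \<subseteq> fst c \<and> continuous_on (U \<inter> ?I) u \<and>
    (\<forall>s\<in>U \<inter> ?I. ((snd c \<circ> \<gamma>) has_vector_derivative u s) (at s within ?I) \<and>
       u s \<in> future_cone (component_form A g c (\<gamma> s)) (T (\<gamma> s) c))" for c U u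
  have ex: "\<exists>c U u. L c U u \<and> t \<in> U" if t: "t \<in> ?I" for t
    using loc[OF t] unfolding locally_causal_def chart_causal_def L_def by blast
  have LX: "continuous_on (U \<inter> ?I) (snd c \<circ> \<gamma>)" if L: "L c U u" for c U u
    unfolding continuous_on_eq_continuous_within
  proof
    fix s assume "s \<in> U \<inter> ?I"
    then have "continuous (at s within ?I) (snd c \<circ> \<gamma>)"
      using L has_vector_derivative_continuous unfolding L_def by blast
    then show "continuous (at s within (U \<inter> ?I)) (snd c \<circ> \<gamma>)"
      by (rule continuous_within_subset) blast
  qed
  have cont: "continuous_on ?I \<gamma>"
  proof (rule continuous_on_localI)
    fix t assume "t \<in> ?I"
    then obtain c U u where L: "L c U u" "t \<in> U" using ex by blast
    then have "continuous_on (U \<inter> ?I) \<gamma>"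
      using chart_curve_continuous[of c \<gamma> "U \<inter> ?I"] LX unfolding L_def by blast
    then show "\<exists>U. open U \<and> t \<in> U \<and> continuous_on (U \<inter> ?I) \<gamma>" using L unfolding L_def by blast
  qed
  have change: "((snd d \<circ> \<gamma>) has_vector_derivative
      frechet_derivative (transition c d) (at (snd c (\<gamma> s))) (u s)) (at s within ?I)"
    if L: "L c U u" and d: "d \<in> A" and s: "s \<in> U \<inter> ?I" "\<gamma> s \<in> fst d" for c U u d s
  proof -
    have c: "c \<in> A" and sc: "\<gamma> s \<in> fst c" using L s unfolding L_def by blast+
    obtain V where V: "open V" "s \<in> V" "\<gamma> ` (V \<inter> ?I) \<subseteq> fst d"
      by (rule continuous_on_open_nhd[OF cont _ chart_open[OF charts[OF d]] s(2)]) (use s in auto)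
    have "((snd c \<circ> \<gamma>) has_derivative (\<lambda>h. h *\<^sub>R u s)) (at s within ?I)"
      using L s unfolding L_def has_vector_derivative_def by blast
    moreover have "(transition c d has_derivative frechet_derivative (transition c d) (at (snd c (\<gamma> s))))
       (at ((snd c \<circ> \<gamma>) s))" using transition_derivative[OF c d sc s(2)] by simp
    ultimately have "((\<lambda>t. transition c d ((snd c \<circ> \<gamma>) t)) has_derivative
        (\<lambda>h. frechet_derivative (transition c d) (at (snd c (\<gamma> s))) (h *\<^sub>R u s))) (at s within ?I)"
      by (rule has_derivative_compose)
    moreover have "linear (frechet_derivative (transition c d) (at (snd c (\<gamma> s))))"
      using transition_derivative[OF c d sc s(2)] has_derivative_linear by blast
    ultimately have "((\<lambda>t. transition c d ((snd c \<circ> \<gamma>) t)) has_vector_derivative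
        frechet_derivative (transition c d) (at (snd c (\<gamma> s))) (u s)) (at s within ?I)"
      by (simp add: has_vector_derivative_def linear_scale)
    then show ?thesis
    proof (rule has_vector_derivative_local[where W = "U \<inter> V"])
      fix r assume "r \<in> U \<inter> V \<inter> ?I"
      then have "\<gamma> r \<in> fst c" using L unfolding L_def by blast
      then show "transition c d ((snd c \<circ> \<gamma>) r) = (snd d \<circ> \<gamma>) r" using transition_eq[OF c] by simp
    qed (use L V s in \<open>auto simp: L_def\<close>)
  qed
  have vd: "vector_derivative (snd d \<circ> \<gamma>) (at s within ?I)
      = frechet_derivative (transition c d) (at (snd c (\<gamma> s))) (u s)"
    if "L c U u" "d \<in> A" "s \<in> U \<inter> ?I" "\<gamma> s \<in> fst d" for c U u d s
    using vector_derivative_within_closed_interval[OF ab _ change[OF that]] that(3) by blast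
  have "C1_curve A a b \<gamma>"
    unfolding C1_curve_def
  proof (intro conjI ballI impI cont)
    fix d t assume d: "d \<in> A" and t: "t \<in> ?I" "\<gamma> t \<in> fst d"
    obtain c U u where L: "L c U u" "t \<in> U" using ex[OF t(1)] by blast
    show "snd d \<circ> \<gamma> differentiable at t within ?I"
      using change[OF L(1) d _ t(2)] L(2) t(1) differentiableI_vector by blast
  next
    fix d assume d: "d \<in> A"
    let ?S = "{t \<in> ?I. \<gamma> t \<in> fst d}"
    show "continuous_on ?S (\<lambda>t. vector_derivative (snd d \<circ> \<gamma>) (at t within ?I))"
    proof (rule continuous_on_localI)
      fix t assume t: "t \<in> ?S"
      then obtain c U u where L: "L c U u" "t \<in> U" using ex by blast
      have sub: "U \<inter> ?S \<subseteq> U \<inter> ?I" by blast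
      have c: "c \<in> A" using L by (simp add: L_def)
      have "continuous_on (U \<inter> ?S) (\<lambda>s. frechet_derivative (transition c d) (at ((snd c \<circ> \<gamma>) s)) (u s))"
      proof (rule transition_derivative_jointly_continuous[OF c d])
        show "continuous_on (U \<inter> ?S) (snd c \<circ> \<gamma>)" "continuous_on (U \<inter> ?S) u"
          using continuous_on_subset[OF LX[OF L(1)] sub] L(1) continuous_on_subset[OF _ sub]
          unfolding L_def by blast+
        fix s assume "s \<in> U \<inter> ?S"
        then have "\<gamma> s \<in> fst c \<inter> fst d" using L(1) unfolding L_def by blast
        then show "(snd c \<circ> \<gamma>) s \<in> snd c ` (fst c \<inter> fst d)" by simp
      qed
      then have "continuous_on (U \<inter> ?S) (\<lambda>t. vector_derivative (snd d \<circ> \<gamma>) (at t within ?I))"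
        by (rule continuous_on_eq) (use vd[OF L(1) d] in auto)
      then show "\<exists>U. open U \<and> t \<in> U \<and>
          continuous_on (U \<inter> ?S) (\<lambda>t. vector_derivative (snd d \<circ> \<gamma>) (at t within ?I))"
        using L unfolding L_def by blast
    qed
  qed
  moreover have "velocity A a b \<gamma> t \<in> future_causal A g T (\<gamma> t)" if t: "t \<in> ?I" for t
  proof -
    obtain c U u where L: "L c U u" "t \<in> U" using ex[OF t] by blast
    have c: "c \<in> A" "\<gamma> t \<in> fst c" using L t unfolding L_def by blast+
    have "velocity A a b \<gamma> t = chart_vector A c (\<gamma> t) (u t)"
      unfolding velocity_def chart_vector_def
      by (rule ext, rule if_cong[OF refl _ refl]) (use vd[OF L(1)] L(2) t in blast)
    moreover have "chart_vector A c (\<gamma> t) (u t) \<in> future_causal A g T (\<gamma> t)"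
      unfolding future_causal_iff[of T "\<gamma> t" c, OF spacetime_tangent[OF st c(1)] c]
      using L t c by (simp add: chart_vector_tangent chart_vector_self L_def)
    ultimately show ?thesis by simp
  qed
  ultimately show ?thesis using ab by (simp add: future_causal_curve_def)
qed

lemma causal_curve_sub:
  assumes st: "spacetime r A g T" and \<gamma>: "future_causal_curve A g T a b \<gamma>"
    and "a \<le> a'" "a' < b'" "b' \<le> b"
  shows "future_causal_curve A g T a' b' \<gamma>"
proof (rule locally_causal_curve[OF st assms(4)])
  fix t assume "t \<in> {a'..b'}"
  then have "t \<in> {a..b}" using assms(3-5) by simp
  show "locally_causal A g T {a'..b'} \<gamma> t"
    by (rule locally_causal_cong[OF causal_curve_locally_causal[OF st \<gamma> \<open>t \<in> {a..b}\<close>] open_UNIV])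
      (use assms(3-5) in simp_all)
qed

lemma causal_curve_shift:
  assumes st: "spacetime r A g T" and \<gamma>: "future_causal_curve A g T a b \<gamma>"
  shows "future_causal_curve A g T (a - k) (b - k) (\<lambda>t. \<gamma> (t + k))"
proof (rule locally_causal_curve[OF st])
  show "a - k < b - k" using \<gamma> by (simp add: future_causal_curve_def)
  fix t assume "t \<in> {a - k..b - k}"
  then have t: "t + k \<in> {a..b}" by auto
  obtain c U u where c: "c \<in> A" and U: "open U" "t + k \<in> U" and im: "\<gamma> ` (U \<inter> {a..b}) \<subseteq> fst c"
    and cont: "continuous_on (U \<inter> {a..b}) u"
    and u: "\<And>s. s \<in> U \<inter> {a..b} \<Longrightarrow> ((snd c \<circ> \<gamma>) has_vector_derivative u s) (at s within {a..b}) \<and>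
       u s \<in> future_cone (component_form A g c (\<gamma> s)) (T (\<gamma> s) c)"
    using causal_curve_locally_causal[OF st \<gamma> t] unfolding locally_causal_def chart_causal_def by metis
  define V where "V = (\<lambda>s. s + k) -` U"
  have V: "open V" "t \<in> V" unfolding V_def using U by (auto intro!: open_vimage continuous_intros)
  have im': "s + k \<in> U \<inter> {a..b}" if "s \<in> V \<inter> {a - k..b - k}" for s
    using that by (auto simp: V_def)
  have "chart_causal A g T c {a - k..b - k} (V \<inter> {a - k..b - k}) (\<lambda>t. \<gamma> (t + k))"
    unfolding chart_causal_def
  proof (intro conjI exI[of _ "\<lambda>s. u (s + k)"] ballI)
    show "(\<lambda>t. \<gamma> (t + k)) ` (V \<inter> {a - k..b - k}) \<subseteq> fst c" using im' im by blast
    show "continuous_on (V \<inter> {a - k..b - k}) (\<lambda>s. u (s + k))"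
      by (rule continuous_on_compose2[OF cont]) (use im' in \<open>auto intro!: continuous_intros\<close>)
    fix s assume s: "s \<in> V \<inter> {a - k..b - k}"
    have "((\<lambda>s. s + k) has_vector_derivative 1) (at s within {a - k..b - k})"
      by (auto intro!: derivative_eq_intros)
    moreover have "((snd c \<circ> \<gamma>) has_vector_derivative u (s + k)) (at (s + k) within (\<lambda>s. s + k) ` {a - k..b - k})"
      using u[OF im'[OF s]] by simp
    ultimately show "((snd c \<circ> (\<lambda>t. \<gamma> (t + k))) has_vector_derivative u (s + k)) (at s within {a - k..b - k})"
      using vector_diff_chain_within[of "\<lambda>s. s + k" 1 s "{a - k..b - k}" "snd c \<circ> \<gamma>" "u (s + k)"]
      by (simp add: o_def)
    show "u (s + k) \<in> future_cone (component_form A g c (\<gamma> (s + k))) (T (\<gamma> (s + k)) c)"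
      using u[OF im'[OF s]] by blast
  qed
  then show "locally_causal A g T {a - k..b - k} (\<lambda>t. \<gamma> (t + k)) t"
    unfolding locally_causal_def using c V by blast
qed

lemma causal_curve_wider:
  assumes "wider r A g' T' g T" "future_causal_curve A g T a b \<gamma>"
  shows "future_causal_curve A g' T' a b \<gamma>"
proof -
  have "future_causal A g T p \<subseteq> future_causal A g' T' p" for p
    using assms(1) unfolding wider_def future_causal_def future_timelike_def by fastforce
  then show ?thesis using assms(2) unfolding future_causal_curve_def by blast
qed

section \<open>Rounding corners and moving end points\<close>

text \<open>The only nonlinear \<open>C\<^sup>1\<close> building block: both the ramp for rounding corners and the bump function
are made from it.\<close>

lemma square_positive_part_derivative:
  "((\<lambda>t::real. (max 0 t)\<^sup>2) has_real_derivative 2 * max 0 t) (at t)"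
proof (cases "t = 0")
  case True
  have "((\<lambda>h::real. (max 0 h)\<^sup>2 / h) \<longlongrightarrow> 0) (at 0)"
  proof (rule Lim_null_comparison)
    have "norm ((max 0 h)\<^sup>2 / h) \<le> \<bar>h\<bar>" for h :: real
      by (cases "h > 0") (auto simp: max_def power2_eq_square)
    then show "\<forall>\<^sub>F h in at 0. norm ((max 0 h)\<^sup>2 / h) \<le> \<bar>h::real\<bar>" by simp
    show "((\<lambda>h::real. \<bar>h\<bar>) \<longlongrightarrow> 0) (at 0)" by (intro tendsto_rabs_zero tendsto_ident_at)
  qed
  then show ?thesis using True by (simp add: DERIV_def)
next
  case False
  show ?thesis
  proof (cases "t > 0")
    case True
    have "((\<lambda>t::real. t\<^sup>2) has_real_derivative 2 * t) (at t)"
      by (auto intro!: derivative_eq_intros)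
    then have "((\<lambda>t::real. (max 0 t)\<^sup>2) has_real_derivative 2 * t) (at t)"
      by (rule has_field_derivative_transform_within_open[where S = "{0<..}"]) (use True in auto)
    then show ?thesis using True by simp
  next
    case neg: False
    have "((\<lambda>t::real. 0) has_real_derivative 0) (at t)" by simp
    then have "((\<lambda>t::real. (max 0 t)\<^sup>2) has_real_derivative 0) (at t)"
      by (rule has_field_derivative_transform_within_open[where S = "{..<0}"]) (use neg False in auto)
    then show ?thesis using neg by simp
  qed
qed

text \<open>A \<open>C\<^sup>1\<close> version of \<open>max 0 t\<close> that differs from it only for \<open>\<bar>t\<bar> < e\<close>; its derivative \<open>ramp'\<close>
rises linearly from 0 to 1 there.\<close>

definition ramp :: "real \<Rightarrow> real \<Rightarrow> real" where
  "ramp e t = ((max 0 (t + e))\<^sup>2 - (max 0 (t - e))\<^sup>2) / (4 * e)"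

definition ramp' :: "real \<Rightarrow> real \<Rightarrow> real" where
  "ramp' e t = (2 * max 0 (t + e) - 2 * max 0 (t - e)) / (4 * e)"

lemma ramp_derivative:
  assumes "e > 0"
  shows "(ramp e has_vector_derivative ramp' e t) (at t within S)"
proof -
  have "((\<lambda>t. (max 0 (t + e))\<^sup>2) has_real_derivative 2 * max 0 (t + e)) (at t)" for e
    using DERIV_shift[of "\<lambda>t. (max 0 t)\<^sup>2" _ t e] square_positive_part_derivative by blast
  from DERIV_cdivide[OF DERIV_diff[OF this[of e] this[of "-e"]], of "4 * e"]
  have "(ramp e has_real_derivative ramp' e t) (at t)"
    by (simp add: ramp_def[abs_def] ramp'_def)
  then show ?thesis
    by (simp add: has_real_derivative_iff_has_vector_derivative has_vector_derivative_at_within)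
qed

lemma ramp'_continuous: "continuous_on S (ramp' e)"
  unfolding ramp'_def[abs_def] divide_inverse by (intro continuous_intros)

lemma ramp'_bounds: "e > 0 \<Longrightarrow> 0 \<le> ramp' e t" "e > 0 \<Longrightarrow> ramp' e t \<le> 1"
  by (auto simp: ramp'_def max_def field_simps)

lemma ramp_left: "e > 0 \<Longrightarrow> t \<le> - e \<Longrightarrow> ramp e t = 0"
  by (simp add: ramp_def)

lemma ramp_right: "e > 0 \<Longrightarrow> t \<ge> e \<Longrightarrow> ramp e t = t"
  by (simp add: ramp_def power2_eq_square field_simps)

lemma ramp_middle:
  assumes "e > 0" "- e < t" "t < e"
  shows "0 \<le> ramp e t" "ramp e t \<le> e" "- e \<le> t - ramp e t" "t - ramp e t \<le> 0"
proof -
  have r: "ramp e t = (t + e)\<^sup>2 / (4 * e)" using assms by (simp add: ramp_def)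
  have tr: "t - ramp e t = - ((e - t)\<^sup>2 / (4 * e))"
    unfolding r using assms(1) by (simp add: field_simps power2_eq_square)
  show "0 \<le> ramp e t" "t - ramp e t \<le> 0" unfolding tr unfolding r using assms(1) by simp_all
  have "(t + e)\<^sup>2 \<le> (2 * e)\<^sup>2" "(e - t)\<^sup>2 \<le> (2 * e)\<^sup>2" using assms by (intro power_mono; simp)+
  then show "ramp e t \<le> e" "- e \<le> t - ramp e t"
    unfolding tr unfolding r using assms(1) by (simp_all add: field_simps power2_eq_square)
qed

text \<open>With \<open>k = ramp \<epsilon>\<close>, the rounded curve is \<open>\<gamma>1(t - k t) + \<gamma>2(k t) - y\<close> in a chart
around the junction \<open>y\<close>. It is \<open>C\<^sup>1\<close> because both parameter changes are, it agrees with \<open>\<gamma>1\<close>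
or \<open>\<gamma>2\<close> as soon as \<open>\<bar>t\<bar> \<ge> \<epsilon>\<close>, and its velocity is a convex combination of velocities
of the two pieces near \<open>y\<close>. The cone at \<open>y\<close> being convex, the velocity is close to a causal vector at
\<open>y\<close>, hence causal for the wider metric.\<close>

lemma causal_curve_join_at_0:
  assumes st: "spacetime r A g T" and w: "wider r A g' T' g T"
    and g1: "future_causal_curve A g T a 0 \<gamma>1" and g2: "future_causal_curve A g T 0 d \<gamma>2"
    and junction: "\<gamma>1 0 = \<gamma>2 0"
  obtains \<gamma> where "future_causal_curve A g' T' a d \<gamma>" "\<gamma> a = \<gamma>1 a" "\<gamma> d = \<gamma>2 d"
proof -
  interpret C1_atlas A by (rule spacetime_C1_atlas[OF st])
  have st': "spacetime r A g' T'" using w by (simp add: wider_def)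
  have a: "a < 0" and d: "0 < d" using g1 g2 by (auto simp: future_causal_curve_def)
  define y where "y = \<gamma>1 0"
  obtain c where c: "c \<in> A" "y \<in> fst c" using cover by blast
  note chart = charts[OF c(1)]
  let ?x = "snd c" and ?inv = "inv_into (fst c) (snd c)"
  obtain N e where N: "open N" "y \<in> N" "N \<subseteq> fst c" and e: "e > 0"
    and robust: "\<And>p q v v'. p \<in> N \<Longrightarrow> q \<in> N \<Longrightarrow> v \<in> future_cone (component_form A g c p) (T p c) \<Longrightarrow>
      norm (v' - v) \<le> e * norm v \<Longrightarrow> v' \<in> future_cone (component_form A g' c q) (T' q c)"
    using robust_cone[OF st w c] by metis
  obtain \<rho> where \<rho>: "\<rho> > 0" "ball (?x y) \<rho> \<subseteq> ?x ` N"
    using chart_image_of_open[OF chart N(1,3)] N(2) open_contains_ball by (metis imageI)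
  have inv_N: "?inv z \<in> N \<and> ?x (?inv z) = z" if "z \<in> ?x ` N" for z
    using that chart_inv[OF chart] N(3) by auto
  obtain U1 where U1: "open U1" "0 \<in> U1" "\<gamma>1 ` (U1 \<inter> {a..0}) \<subseteq> N" "chart_causal A g T c {a..0} (U1 \<inter> {a..0}) \<gamma>1"
    by (rule causal_curve_nhd[OF st g1 _ c(1) N(1,3)]) (use a N in \<open>auto simp: y_def\<close>)
  obtain U2 where U2: "open U2" "0 \<in> U2" "\<gamma>2 ` (U2 \<inter> {0..d}) \<subseteq> N" "chart_causal A g T c {0..d} (U2 \<inter> {0..d}) \<gamma>2"
    by (rule causal_curve_nhd[OF st g2 _ c(1) N(1,3)]) (use d N junction in \<open>auto simp: y_def\<close>)
  define J1 where "J1 = U1 \<inter> {a..0}"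
  define J2 where "J2 = U2 \<inter> {0..d}"
  obtain u1 where u1: "continuous_on J1 u1"
    "\<And>s. s \<in> J1 \<Longrightarrow> ((?x \<circ> \<gamma>1) has_vector_derivative u1 s) (at s within {a..0})"
    "\<And>s. s \<in> J1 \<Longrightarrow> u1 s \<in> future_cone (component_form A g c (\<gamma>1 s)) (T (\<gamma>1 s) c)"
    using U1(4) unfolding chart_causal_def J1_def[symmetric] by blast
  obtain u2 where u2: "continuous_on J2 u2"
    "\<And>s. s \<in> J2 \<Longrightarrow> ((?x \<circ> \<gamma>2) has_vector_derivative u2 s) (at s within {0..d})"
    "\<And>s. s \<in> J2 \<Longrightarrow> u2 s \<in> future_cone (component_form A g c (\<gamma>2 s)) (T (\<gamma>2 s) c)"
    using U2(4) unfolding chart_causal_def J2_def[symmetric] by blast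
  have J0: "0 \<in> J1" "0 \<in> J2" using U1(2) U2(2) a d by (auto simp: J1_def J2_def)
  define C where "C = future_cone (component_form A g c y) (T y c)"
  have uC: "u1 0 \<in> C" "u2 0 \<in> C" using u1(3)[OF J0(1)] u2(3)[OF J0(2)] by (simp_all add: C_def y_def junction)
  define v where "v s = (1 - s) *\<^sub>R u1 0 + s *\<^sub>R u2 0" for s
  have vC: "v s \<in> C" if "s \<in> {0..1}" for s
    unfolding v_def C_def
    by (rule future_cone_combination[OF spacetime_form[OF st c] spacetime_timelike[OF st c]])
      (use uC that in \<open>auto simp: C_def\<close>)
  have "continuous_on {0..1::real} (\<lambda>s. norm (v s))" unfolding v_def by (intro continuous_intros)
  then obtain s0 where s0: "s0 \<in> {0..1}" "\<And>s. s \<in> {0..1} \<Longrightarrow> norm (v s0) \<le> norm (v s)"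
    using continuous_attains_inf[of "{0..1::real}" "\<lambda>s. norm (v s)"] by auto
  \<comment> \<open>The error allowed by \<open>robust_cone\<close> for the shortest convex combination of the two velocities at \<open>y\<close>.\<close>
  define \<eta> where "\<eta> = e * norm (v s0)"
  have \<eta>: "\<eta> > 0" using vC[OF s0(1)] e by (simp add: \<eta>_def C_def future_cone_def)
  have ex1: "\<exists>\<delta>>0. \<forall>s\<in>J1. dist s 0 < \<delta> \<longrightarrow> dist (?x (\<gamma>1 s)) (?x y) < \<rho> / 2 \<and> norm (u1 s - u1 0) < \<eta>"
  proof -
    have "continuous_on J1 (?x \<circ> \<gamma>1)"
      using u1(2) has_vector_derivative_continuous continuous_within_subset[of _ "{a..0}" _ J1]
      unfolding continuous_on_eq_continuous_within J1_def by blast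
    then obtain d1 where "d1 > 0" "\<forall>s\<in>J1. dist s 0 < d1 \<longrightarrow> dist (?x (\<gamma>1 s)) (?x y) < \<rho> / 2"
      using J0(1) \<rho>(1) unfolding continuous_on_iff y_def by (metis comp_apply half_gt_zero)
    moreover obtain d2 where "d2 > 0" "\<forall>s\<in>J1. dist s 0 < d2 \<longrightarrow> dist (u1 s) (u1 0) < \<eta>"
      using J0(1) \<eta> u1(1) unfolding continuous_on_iff by metis
    ultimately show ?thesis by (intro exI[of _ "min d1 d2"]) (auto simp: dist_norm)
  qed
  have ex2: "\<exists>\<delta>>0. \<forall>s\<in>J2. dist s 0 < \<delta> \<longrightarrow> dist (?x (\<gamma>2 s)) (?x y) < \<rho> / 2 \<and> norm (u2 s - u2 0) < \<eta>"
  proof -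
    have "continuous_on J2 (?x \<circ> \<gamma>2)"
      using u2(2) has_vector_derivative_continuous continuous_within_subset[of _ "{0..d}" _ J2]
      unfolding continuous_on_eq_continuous_within J2_def by blast
    then obtain d1 where "d1 > 0" "\<forall>s\<in>J2. dist s 0 < d1 \<longrightarrow> dist (?x (\<gamma>2 s)) (?x y) < \<rho> / 2"
      using J0(2) \<rho>(1) unfolding continuous_on_iff y_def junction by (metis comp_apply half_gt_zero)
    moreover obtain d2 where "d2 > 0" "\<forall>s\<in>J2. dist s 0 < d2 \<longrightarrow> dist (u2 s) (u2 0) < \<eta>"
      using J0(2) \<eta> u2(1) unfolding continuous_on_iff by metis
    ultimately show ?thesis by (intro exI[of _ "min d1 d2"]) (auto simp: dist_norm)
  qed
  obtain \<delta>1 \<delta>2 where \<delta>12: "\<delta>1 > 0" "\<delta>2 > 0"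
    and near1: "\<And>s. s \<in> J1 \<Longrightarrow> \<bar>s\<bar> < \<delta>1 \<Longrightarrow> dist (?x (\<gamma>1 s)) (?x y) < \<rho> / 2 \<and> norm (u1 s - u1 0) < \<eta>"
    and near2: "\<And>s. s \<in> J2 \<Longrightarrow> \<bar>s\<bar> < \<delta>2 \<Longrightarrow> dist (?x (\<gamma>2 s)) (?x y) < \<rho> / 2 \<and> norm (u2 s - u2 0) < \<eta>"
    using ex1 ex2 unfolding dist_real_def by (metis diff_zero)
  obtain \<delta>3 where \<delta>3: "\<delta>3 > 0" "ball 0 \<delta>3 \<subseteq> U1 \<inter> U2"
    using U1(1,2) U2(1,2) open_contains_ball by (metis IntI open_Int)
  define \<delta> where "\<delta> = Min {\<delta>1, \<delta>2, \<delta>3, - a, d}"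
  have \<delta>: "\<delta> > 0" "\<delta> \<le> \<delta>1" "\<delta> \<le> \<delta>2" "\<delta> \<le> \<delta>3" "\<delta> \<le> - a" "\<delta> \<le> d"
    using \<delta>12 \<delta>3 a d by (auto simp: \<delta>_def)
  define \<epsilon> where "\<epsilon> = \<delta> / 2"
  have \<epsilon>: "\<epsilon> > 0" "\<epsilon> < \<delta>" using \<delta> by (auto simp: \<epsilon>_def)
  have inJ: "s \<in> J1" if "- \<delta> < s" "s \<le> 0" for s
    using that \<delta> \<delta>3(2) by (auto simp: J1_def subset_iff dist_real_def)
  have inJ': "s \<in> J2" if "s < \<delta>" "0 \<le> s" for s
    using that \<delta> \<delta>3(2) by (auto simp: J2_def subset_iff dist_real_def)
  have ramp2: "0 \<le> ramp \<epsilon> t" "ramp \<epsilon> t \<le> max t \<epsilon>" "min t (- \<epsilon>) \<le> t - ramp \<epsilon> t" "t - ramp \<epsilon> t \<le> 0" for t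
  proof -
    consider "t \<le> - \<epsilon>" | "- \<epsilon> < t" "t < \<epsilon>" | "t \<ge> \<epsilon>" by linarith
    then have "0 \<le> ramp \<epsilon> t \<and> ramp \<epsilon> t \<le> max t \<epsilon> \<and> min t (- \<epsilon>) \<le> t - ramp \<epsilon> t \<and> t - ramp \<epsilon> t \<le> 0"
      using ramp_left[of \<epsilon> t] ramp_right[of \<epsilon> t] ramp_middle[of \<epsilon> t] \<epsilon> by cases auto
    then show "0 \<le> ramp \<epsilon> t" "ramp \<epsilon> t \<le> max t \<epsilon>" "min t (- \<epsilon>) \<le> t - ramp \<epsilon> t" "t - ramp \<epsilon> t \<le> 0"
      by auto
  qed
  define Z where "Z t = ?x (\<gamma>1 (t - ramp \<epsilon> t)) + ?x (\<gamma>2 (ramp \<epsilon> t)) - ?x y" for t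
  define \<gamma> where "\<gamma> t = (if t \<le> - \<epsilon> then \<gamma>1 t else if t \<ge> \<epsilon> then \<gamma>2 t else ?inv (Z t))" for t
  have s12: "t - ramp \<epsilon> t \<in> J1" "\<bar>t - ramp \<epsilon> t\<bar> < \<delta>1" "ramp \<epsilon> t \<in> J2" "\<bar>ramp \<epsilon> t\<bar> < \<delta>2"
    if "- \<delta> < t" "t < \<delta>" for t
  proof -
    have 1: "- \<delta> < t - ramp \<epsilon> t" "t - ramp \<epsilon> t \<le> 0" "0 \<le> ramp \<epsilon> t" "ramp \<epsilon> t < \<delta>"
      using ramp2[of t] that \<epsilon> by linarith+
    show "t - ramp \<epsilon> t \<in> J1" "ramp \<epsilon> t \<in> J2" using 1 by (auto intro: inJ inJ')
    show "\<bar>t - ramp \<epsilon> t\<bar> < \<delta>1" "\<bar>ramp \<epsilon> t\<bar> < \<delta>2" using 1 \<delta> by linarith+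
  qed
  have Z: "\<gamma> t \<in> N \<and> ?x (\<gamma> t) = Z t" if t: "- \<delta> < t" "t < \<delta>" for t
  proof -
    have "dist (?x (\<gamma>1 (t - ramp \<epsilon> t))) (?x y) < \<rho> / 2" "dist (?x (\<gamma>2 (ramp \<epsilon> t))) (?x y) < \<rho> / 2"
      using near1 near2 s12[OF t] by blast+
    moreover have "dist (?x y) (Z t) = norm ((?x (\<gamma>1 (t - ramp \<epsilon> t)) - ?x y) + (?x (\<gamma>2 (ramp \<epsilon> t)) - ?x y))"
      unfolding dist_norm Z_def norm_minus_commute[of "?x y"] by (rule arg_cong[of _ _ norm]) simp
    ultimately have "dist (?x y) (Z t) < \<rho>"
      using norm_triangle_ineq[of "?x (\<gamma>1 (t - ramp \<epsilon> t)) - ?x y" "?x (\<gamma>2 (ramp \<epsilon> t)) - ?x y"]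
      unfolding dist_norm by linarith
    then have "Z t \<in> ?x ` N" using \<rho>(2) by auto
    note ZN = inv_N[OF this]
    consider "t \<le> - \<epsilon>" | "- \<epsilon> < t" "t < \<epsilon>" | "t \<ge> \<epsilon>" by linarith
    then show ?thesis
    proof cases
      case 1
      then have "t \<in> J1" "ramp \<epsilon> t = 0" using s12[OF t] ramp_left[OF \<epsilon>(1)] by auto
      then show ?thesis using 1 U1(3) junction by (auto simp: \<gamma>_def Z_def y_def J1_def)
    next
      case 2
      then show ?thesis using ZN by (simp add: \<gamma>_def)
    next
      case 3
      then have "t \<in> J2" "ramp \<epsilon> t = t" using s12[OF t] ramp_right[OF \<epsilon>(1)] by auto
      then show ?thesis using 3 U2(3) \<epsilon> by (auto simp: \<gamma>_def Z_def y_def J2_def)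
    qed
  qed
  let ?I = "{a..d}"
  have cor: "chart_causal A g' T' c ?I ({-\<delta><..<\<delta>} \<inter> ?I) \<gamma>"
    unfolding chart_causal_def
  proof (intro conjI exI ballI)
    show "\<gamma> ` ({-\<delta><..<\<delta>} \<inter> ?I) \<subseteq> fst c" using Z N(3) by (auto simp: image_subset_iff)
    let ?u = "\<lambda>t. (1 - ramp' \<epsilon> t) *\<^sub>R u1 (t - ramp \<epsilon> t) + ramp' \<epsilon> t *\<^sub>R u2 (ramp \<epsilon> t)"
    have rc: "continuous_on S (ramp \<epsilon>)" for S
      unfolding continuous_on_eq_continuous_within
      using ramp_derivative[OF \<epsilon>(1)] has_vector_derivative_continuous by blast
    show "continuous_on ({-\<delta><..<\<delta>} \<inter> ?I) ?u"
    proof (intro continuous_intros ramp'_continuous)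
      show "continuous_on ({-\<delta><..<\<delta>} \<inter> ?I) (\<lambda>t. u1 (t - ramp \<epsilon> t))"
        by (rule continuous_on_compose2[OF u1(1)]) (use s12 in \<open>auto intro!: continuous_intros rc\<close>)
      show "continuous_on ({-\<delta><..<\<delta>} \<inter> ?I) (\<lambda>t. u2 (ramp \<epsilon> t))"
        by (rule continuous_on_compose2[OF u2(1) rc]) (use s12 in auto)
    qed
    fix t assume t: "t \<in> {-\<delta><..<\<delta>} \<inter> ?I"
    then have t': "- \<delta> < t" "t < \<delta>" by auto
    have "((\<lambda>t. t - ramp \<epsilon> t) has_vector_derivative (1 - ramp' \<epsilon> t)) (at t within ?I)"
      by (intro has_vector_derivative_diff ramp_derivative \<epsilon> has_vector_derivative_id[unfolded id_def])
    moreover have "((?x \<circ> \<gamma>1) has_vector_derivative u1 (t - ramp \<epsilon> t)) (at (t - ramp \<epsilon> t) within (\<lambda>t. t - ramp \<epsilon> t) ` ?I)"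
    proof (rule has_vector_derivative_within_subset[OF u1(2)[OF s12(1)[OF t']]])
      show "(\<lambda>t. t - ramp \<epsilon> t) ` ?I \<subseteq> {a..0}"
      proof (rule image_subsetI)
        fix s assume "s \<in> ?I"
        then show "s - ramp \<epsilon> s \<in> {a..0}" using ramp2[of s] \<epsilon> \<delta>(5) by auto
      qed
    qed
    ultimately have D1: "((\<lambda>t. ?x (\<gamma>1 (t - ramp \<epsilon> t))) has_vector_derivative (1 - ramp' \<epsilon> t) *\<^sub>R u1 (t - ramp \<epsilon> t)) (at t within ?I)"
      using vector_diff_chain_within by (fastforce simp: o_def)
    have "((?x \<circ> \<gamma>2) has_vector_derivative u2 (ramp \<epsilon> t)) (at (ramp \<epsilon> t) within ramp \<epsilon> ` ?I)"
    proof (rule has_vector_derivative_within_subset[OF u2(2)[OF s12(3)[OF t']]])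
      show "ramp \<epsilon> ` ?I \<subseteq> {0..d}"
      proof (rule image_subsetI)
        fix s assume "s \<in> ?I"
        then show "ramp \<epsilon> s \<in> {0..d}" using ramp2[of s] \<epsilon> \<delta>(6) by auto
      qed
    qed
    then have D2: "((\<lambda>t. ?x (\<gamma>2 (ramp \<epsilon> t))) has_vector_derivative ramp' \<epsilon> t *\<^sub>R u2 (ramp \<epsilon> t)) (at t within ?I)"
      using vector_diff_chain_within[OF ramp_derivative[OF \<epsilon>(1)]] by (fastforce simp: o_def)
    have "(Z has_vector_derivative ?u t) (at t within ?I)"
      unfolding Z_def[abs_def]
      using has_vector_derivative_diff[OF has_vector_derivative_add[OF D1 D2] has_vector_derivative_const[of "?x y"]]
      by simp
    then show "((?x \<circ> \<gamma>) has_vector_derivative ?u t) (at t within ?I)"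
      by (rule has_vector_derivative_local[where W = "{-\<delta><..<\<delta>}"]) (use t Z in auto)
    define s where "s = ramp' \<epsilon> t"
    have s: "s \<in> {0..1}" using ramp'_bounds[OF \<epsilon>(1)] by (simp add: s_def)
    have "?u t - v s = (1 - s) *\<^sub>R (u1 (t - ramp \<epsilon> t) - u1 0) + s *\<^sub>R (u2 (ramp \<epsilon> t) - u2 0)"
      by (simp add: v_def s_def algebra_simps)
    also have "norm \<dots> \<le> (1 - s) * norm (u1 (t - ramp \<epsilon> t) - u1 0) + s * norm (u2 (ramp \<epsilon> t) - u2 0)"
      using norm_triangle_ineq[of "(1 - s) *\<^sub>R (u1 (t - ramp \<epsilon> t) - u1 0)" "s *\<^sub>R (u2 (ramp \<epsilon> t) - u2 0)"] s
      by simp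
    also have "\<dots> \<le> (1 - s) * \<eta> + s * \<eta>"
      using near1[OF s12(1,2)[OF t']] near2[OF s12(3,4)[OF t']] s
      by (intro add_mono mult_left_mono) auto
    also have "\<dots> = e * norm (v s0)" by (simp add: \<eta>_def algebra_simps)
    also have "\<dots> \<le> e * norm (v s)" using s0(2)[OF s] e by simp
    finally have "norm (?u t - v s) \<le> e * norm (v s)" .
    then show "?u t \<in> future_cone (component_form A g' c (\<gamma> t)) (T' (\<gamma> t) c)"
      using robust[OF N(2) _ vC[OF s, unfolded C_def]] Z[OF t'] by blast
  qed
  have "locally_causal A g' T' ?I \<gamma> t" if t: "t \<in> ?I" for t
  proof -
    consider "t < - \<epsilon>" | "- \<delta> < t" "t < \<delta>" | "t > \<epsilon>" using \<epsilon> by linarith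
    then show ?thesis
    proof cases
      case 1
      then have "locally_causal A g' T' {a..0} \<gamma>1 t"
        using causal_curve_locally_causal[OF st' causal_curve_wider[OF w g1], of t] t \<epsilon> by auto
      then show ?thesis
        by (rule locally_causal_cong[where W = "{..<-\<epsilon>}"]) (use 1 \<epsilon> in \<open>auto simp: \<gamma>_def\<close>)
    next
      case 2
      then show ?thesis
        unfolding locally_causal_def using c(1) cor
        by (intro bexI[of _ c] exI[of _ "{-\<delta><..<\<delta>}"]) auto
    next
      case 3
      then have "locally_causal A g' T' {0..d} \<gamma>2 t"
        using causal_curve_locally_causal[OF st' causal_curve_wider[OF w g2], of t] t \<epsilon> by auto
      then show ?thesis
        by (rule locally_causal_cong[where W = "{\<epsilon><..}"]) (use 3 \<epsilon> in \<open>auto simp: \<gamma>_def\<close>)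
    qed
  qed
  then have "future_causal_curve A g' T' a d \<gamma>"
    using locally_causal_curve[OF st'] a d by simp
  moreover have "\<gamma> a = \<gamma>1 a" "\<gamma> d = \<gamma>2 d" using \<epsilon> \<delta>(5,6) by (auto simp: \<gamma>_def)
  ultimately show thesis using that by blast
qed

lemma chart_preimage_compact:
  assumes c: "is_chart c" and C: "compact C" "C \<subseteq> snd c ` fst c"
  shows "compact {p \<in> fst c. snd c p \<in> C}"
proof -
  have "{p \<in> fst c. snd c p \<in> C} = inv_into (fst c) (snd c) ` C"
    using chart_inv[OF c] C(2) by (force simp: chart_inv')
  moreover have "compact (inv_into (fst c) (snd c) ` C)"
    by (intro compact_continuous_image continuous_on_subset[OF chart_inv_continuous[OF c]] C)
  ultimately show ?thesis by simp
qed

lemma chart_cball_radius: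
  assumes c: "is_chart c" and "open S" "p \<in> S" "p \<in> fst c"
  obtains \<rho> where "\<rho> > 0" "cball (snd c p) \<rho> \<subseteq> snd c ` fst c"
    "{q \<in> fst c. snd c q \<in> cball (snd c p) \<rho>} \<subseteq> S"
proof -
  have "open (snd c ` (S \<inter> fst c))"
    by (rule chart_image_of_open[OF c]) (use assms chart_open[OF c] in auto)
  moreover have "snd c p \<in> snd c ` (S \<inter> fst c)" using assms by blast
  ultimately obtain \<rho> where \<rho>: "\<rho> > 0" "cball (snd c p) \<rho> \<subseteq> snd c ` (S \<inter> fst c)"
    using open_contains_cball by metis
  have "q \<in> S" if q: "q \<in> fst c" "snd c q \<in> cball (snd c p) \<rho>" for q
  proof -
    obtain q' where "q' \<in> S" "q' \<in> fst c" "snd c q = snd c q'" using \<rho>(2) q(2) by blast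
    then show ?thesis using chart_inv[OF c] q(1) by metis
  qed
  then show thesis using that[of \<rho>] \<rho> by blast
qed

text \<open>A \<open>C\<^sup>1\<close> bump of height 1 at \<open>x0\<close>, supported in the ball of radius \<open>\<rho>\<close>; \<open>bump'\<close> is
its derivative.\<close>

definition bump :: "real \<Rightarrow> 'a::euclidean_space \<Rightarrow> 'a \<Rightarrow> real" where
  "bump \<rho> x0 x = (max 0 (1 - (norm (x - x0))\<^sup>2 / \<rho>\<^sup>2))\<^sup>2"

definition bump' :: "real \<Rightarrow> 'a::euclidean_space \<Rightarrow> 'a \<Rightarrow> 'a \<Rightarrow> real" where
  "bump' \<rho> x0 x v = 2 * max 0 (1 - (norm (x - x0))\<^sup>2 / \<rho>\<^sup>2) * (- (2 * ((x - x0) \<bullet> v)) / \<rho>\<^sup>2)"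

lemma bump_derivative: "(bump \<rho> x0 has_derivative bump' \<rho> x0 x) (at x)"
proof -
  have "((\<lambda>x. 1 - ((x - x0) \<bullet> (x - x0)) / \<rho>\<^sup>2) has_derivative (\<lambda>v. - (2 * ((x - x0) \<bullet> v)) / \<rho>\<^sup>2)) (at x)"
    unfolding divide_inverse
    by (auto intro!: derivative_eq_intros simp: inner_commute algebra_simps)
  from DERIV_compose_FDERIV[OF square_positive_part_derivative this]
  show ?thesis
    by (simp add: bump_def[abs_def] bump'_def[abs_def] power2_norm_eq_inner mult.commute)
qed

lemma bump'_bound:
  assumes "\<rho> > 0"
  shows "\<bar>bump' \<rho> x0 x v\<bar> \<le> 4 / \<rho> * norm v"
proof (cases "norm (x - x0) \<le> \<rho>")
  case True
  have "\<bar>(x - x0) \<bullet> v\<bar> \<le> \<rho> * norm v"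
    using Cauchy_Schwarz_ineq2[of "x - x0" v] mult_right_mono[OF True norm_ge_zero[of v]] by linarith
  then have "\<bar>- (2 * ((x - x0) \<bullet> v)) / \<rho>\<^sup>2\<bar> \<le> 2 / \<rho> * norm v"
    using assms by (simp add: abs_mult power2_eq_square field_simps)
  moreover have "\<bar>2 * max 0 (1 - (norm (x - x0))\<^sup>2 / \<rho>\<^sup>2)\<bar> \<le> 2" using assms by simp
  ultimately have "\<bar>bump' \<rho> x0 x v\<bar> \<le> 2 * (2 / \<rho> * norm v)"
    unfolding bump'_def abs_mult[of "2 * max 0 _"] by (intro mult_mono) auto
  then show ?thesis by simp
next
  case False
  then have "\<rho>\<^sup>2 < (norm (x - x0))\<^sup>2" using assms by (intro power_strict_mono) auto
  then have "1 - (norm (x - x0))\<^sup>2 / \<rho>\<^sup>2 < 0" using assms by (simp add: field_simps)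
  then show ?thesis using assms by (simp add: bump'_def)
qed

lemma bump'_continuous:
  assumes "continuous_on S x" "continuous_on S v"
  shows "continuous_on S (\<lambda>s. bump' \<rho> x0 (x s) (v s))"
  unfolding bump'_def divide_inverse by (intro continuous_intros assms)

lemma bump_le_1: "bump \<rho> x0 x \<le> 1"
proof -
  have "max 0 (1 - (norm (x - x0))\<^sup>2 / \<rho>\<^sup>2) \<le> 1" by simp
  then show ?thesis unfolding bump_def by (intro power_le_one) auto
qed

lemma bump_nonneg: "0 \<le> bump \<rho> x0 x" by (simp add: bump_def)

lemma bump_outside: "\<rho> > 0 \<Longrightarrow> norm (x - x0) \<ge> \<rho> \<Longrightarrow> bump \<rho> x0 x = 0"
proof -
  assume "\<rho> > 0" "norm (x - x0) \<ge> \<rho>"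
  moreover from this have "\<rho>\<^sup>2 \<le> (norm (x - x0))\<^sup>2" by (intro power_mono) auto
  ultimately have "1 - (norm (x - x0))\<^sup>2 / \<rho>\<^sup>2 \<le> 0" by (simp add: field_simps)
  then show ?thesis by (simp add: bump_def)
qed

lemma bump_near: "\<rho> > 0 \<Longrightarrow> norm (x - x0) \<le> \<rho> / 4 \<Longrightarrow> bump \<rho> x0 x \<ge> 1 / 2"
proof -
  assume r: "\<rho> > 0" "norm (x - x0) \<le> \<rho> / 4"
  then have "(norm (x - x0))\<^sup>2 \<le> (\<rho> / 4)\<^sup>2" by (intro power_mono) auto
  then have "(norm (x - x0))\<^sup>2 / \<rho>\<^sup>2 \<le> 1 / 16" using r(1) by (simp add: power_divide field_simps)
  then have "3 / 4 \<le> max 0 (1 - (norm (x - x0))\<^sup>2 / \<rho>\<^sup>2)" by linarith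
  then have "(3 / 4)\<^sup>2 \<le> bump \<rho> x0 x" unfolding bump_def by (rule power_mono) simp
  then show ?thesis by (simp add: power2_eq_square)
qed

text \<open>In a chart, \<open>\<phi> z = z + bump z * w0\<close> with a vector \<open>w0\<close> that makes \<open>q\<close> go to \<open>q'\<close>. Its derivative
differs from the identity by at most a constant times the distance of \<open>q\<close> and \<open>q'\<close>, so it maps causal
vectors of \<open>g\<close> to causal vectors of \<open>g'\<close> when the two points are close. Acting on the whole curve by one map,
rather than bending the curve near its end, needs no control of the parametrization.\<close>

lemma push_diffeomorphism:
  assumes st: "spacetime r A g T" and w: "wider r A g' T' g T" and S: "open S" "p0 \<in> S"
  obtains N where "open N" "p0 \<in> N" "N \<subseteq> S"
    "\<And>q q'. q \<in> N \<Longrightarrow> q' \<in> N \<Longrightarrow> \<exists>\<Phi>. \<Phi> q = q' \<and> (\<forall>p. p \<notin> S \<longrightarrow> \<Phi> p = p) \<and>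
      (\<forall>a b \<gamma>. future_causal_curve A g T a b \<gamma> \<longrightarrow> future_causal_curve A g' T' a b (\<Phi> \<circ> \<gamma>))"
proof -
  interpret C1_atlas A by (rule spacetime_C1_atlas[OF st])
  have st': "spacetime r A g' T'" using w by (simp add: wider_def)
  obtain c where c: "c \<in> A" "p0 \<in> fst c" using cover by blast
  note chart = charts[OF c(1)]
  let ?x = "snd c" and ?inv = "inv_into (fst c) (snd c)"
  obtain N0 e where N0: "open N0" "p0 \<in> N0" "N0 \<subseteq> fst c" and e: "e > 0"
    and robust: "\<And>p q v v'. p \<in> N0 \<Longrightarrow> q \<in> N0 \<Longrightarrow> v \<in> future_cone (component_form A g c p) (T p c) \<Longrightarrow>
      norm (v' - v) \<le> e * norm v \<Longrightarrow> v' \<in> future_cone (component_form A g' c q) (T' q c)"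
    using robust_cone[OF st w c] by metis
  define x0 where "x0 = ?x p0"
  obtain \<rho>' where \<rho>': "\<rho>' > 0" "cball x0 \<rho>' \<subseteq> ?x ` fst c" "{q \<in> fst c. ?x q \<in> cball x0 \<rho>'} \<subseteq> S \<inter> N0"
    using chart_cball_radius[OF chart open_Int[OF S(1) N0(1)] _ c(2)] S(2) N0(2) unfolding x0_def by blast
  \<comment> \<open>The bump lives in the ball of radius \<open>\<rho>\<close>, the chart formula is used on radius \<open>2 \<rho>\<close>, and \<open>\<phi>\<close>
    moves points by at most \<open>\<rho>\<close>, which stays in the ball of radius \<open>3 \<rho>\<close>.\<close>
  define \<rho> where "\<rho> = \<rho>' / 3"
  have \<rho>: "\<rho> > 0" "\<rho>' = 3 * \<rho>" using \<rho>'(1) by (simp_all add: \<rho>_def)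
  \<comment> \<open>With \<open>norm w0 \<le> 4 \<delta>\<close> and the bound \<open>4 / \<rho>\<close> on the derivative of the bump, the
    derivative of \<open>\<phi>\<close> differs from the identity by at most \<open>16 \<delta> / \<rho> \<le> e\<close>.\<close>
  define \<delta> where "\<delta> = min (\<rho> / 4) (e * \<rho> / 16)"
  have \<delta>: "\<delta> > 0" "\<delta> \<le> \<rho> / 4" "16 * \<delta> \<le> e * \<rho>" using \<rho> e by (auto simp: \<delta>_def min_def)
  define N where "N = {p \<in> fst c. ?x p \<in> ball x0 \<delta>}"
  have "open N" unfolding N_def by (rule chart_preimage_open[OF chart open_ball])
  moreover have "p0 \<in> N" using c \<delta> by (simp add: N_def x0_def)
  moreover have "N \<subseteq> {q \<in> fst c. ?x q \<in> cball x0 \<rho>'}" using \<delta> \<rho> by (auto simp: N_def)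
  then have "N \<subseteq> S" using \<rho>'(3) by blast
  moreover have "\<exists>\<Phi>. \<Phi> q = q' \<and> (\<forall>p. p \<notin> S \<longrightarrow> \<Phi> p = p) \<and>
      (\<forall>a b \<gamma>. future_causal_curve A g T a b \<gamma> \<longrightarrow> future_causal_curve A g' T' a b (\<Phi> \<circ> \<gamma>))"
    if q: "q \<in> N" and q': "q' \<in> N" for q q'
  proof -
    have qd: "q \<in> fst c" "q' \<in> fst c" "norm (?x q - x0) < \<delta>" "norm (?x q' - x0) < \<delta>"
      using q q' by (auto simp: N_def dist_norm norm_minus_commute)
    define f where "f = bump \<rho> x0 (?x q)"
    have f: "f \<ge> 1 / 2" unfolding f_def by (rule bump_near) (use qd \<delta> \<rho> in auto)
    \<comment> \<open>Division by the value \<open>f\<close> of the bump at \<open>q\<close> makes \<open>\<phi>\<close> hit \<open>q'\<close> exactly.\<close>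
    define w0 where "w0 = (1 / f) *\<^sub>R (?x q' - ?x q)"
    have "norm (?x q' - ?x q) \<le> 2 * \<delta>"
      using norm_triangle_ineq4[of "?x q' - x0" "?x q - x0"] qd by simp
    moreover have "norm w0 = (1 / f) * norm (?x q' - ?x q)" unfolding w0_def norm_scaleR using f by simp
    moreover have "1 / f \<le> 2" using f by (simp add: field_simps)
    ultimately have "norm w0 \<le> 2 * (2 * \<delta>)" using f by (metis mult_mono norm_ge_zero zero_le_numeral)
    then have w0: "norm w0 \<le> 4 * \<delta>" by simp
    define \<phi> where "\<phi> z = z + bump \<rho> x0 z *\<^sub>R w0" for z
    have \<phi>_dist: "norm (\<phi> z - z) \<le> \<rho>" for z
    proof -
      have "norm (\<phi> z - z) = bump \<rho> x0 z * norm w0" by (simp add: \<phi>_def bump_nonneg)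
      also have "\<dots> \<le> 1 * norm w0" using bump_le_1 by (intro mult_right_mono) auto
      finally show ?thesis using w0 \<delta> by simp
    qed
    define B where "B = {p \<in> fst c. ?x p \<in> ball x0 (2 * \<rho>)}"
    define K where "K = {p \<in> fst c. ?x p \<in> cball x0 \<rho>}"
    have B: "open B" unfolding B_def by (rule chart_preimage_open[OF chart open_ball])
    have "compact K" unfolding K_def using \<rho> \<rho>'(2) by (intro chart_preimage_compact[OF chart]) auto
    then have K: "closed K" by (rule compact_imp_closed)
    define \<Phi> where "\<Phi> p = (if p \<in> B then ?inv (\<phi> (?x p)) else p)" for p
    have BN0: "B \<subseteq> S \<inter> N0" using \<rho>'(3) \<rho> by (auto simp: B_def)
    have \<Phi>B: "\<Phi> p \<in> S \<inter> N0 \<and> ?x (\<Phi> p) = \<phi> (?x p)" if p: "p \<in> B" for p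
    proof -
      have "dist x0 (\<phi> (?x p)) \<le> dist x0 (?x p) + norm (\<phi> (?x p) - ?x p)"
        using dist_triangle[of x0 "\<phi> (?x p)" "?x p"] by (simp add: dist_norm norm_minus_commute)
      also have "\<dots> \<le> \<rho>'" using p \<phi>_dist[of "?x p"] \<rho> by (simp add: B_def)
      finally have in_ball: "\<phi> (?x p) \<in> cball x0 \<rho>'" by simp
      have "?inv (\<phi> (?x p)) \<in> fst c \<and> ?x (?inv (\<phi> (?x p))) = \<phi> (?x p)"
        by (rule chart_inv') (use in_ball \<rho>'(2) in blast)
      then show ?thesis using \<rho>'(3) in_ball p by (auto simp: \<Phi>_def)
    qed
    have \<Phi>K: "\<Phi> p = p" if p: "p \<notin> K" for p
    proof (cases "p \<in> B")
      case True
      then have "norm (?x p - x0) \<ge> \<rho>" "p \<in> fst c"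
        using p by (auto simp: B_def K_def dist_norm norm_minus_commute)
      then show ?thesis using chart_inv[OF chart] \<rho> by (simp add: \<Phi>_def \<phi>_def bump_outside)
    qed (simp add: \<Phi>_def)
    have "q \<in> B" using qd \<delta> \<rho> by (auto simp: B_def dist_norm norm_minus_commute)
    moreover have "\<phi> (?x q) = ?x q'" using f by (simp add: \<phi>_def w0_def f_def[symmetric])
    ultimately have "\<Phi> q = q'" using chart_inv[OF chart qd(2)] by (simp add: \<Phi>_def)
    moreover have "\<forall>p. p \<notin> S \<longrightarrow> \<Phi> p = p" using BN0 by (auto simp: \<Phi>_def)
    moreover have "future_causal_curve A g' T' a b (\<Phi> \<circ> \<gamma>)" if \<gamma>: "future_causal_curve A g T a b \<gamma>" for a b \<gamma>
    proof (rule locally_causal_curve[OF st'])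
      show "a < b" using \<gamma> by (simp add: future_causal_curve_def)
      fix t assume t: "t \<in> {a..b}"
      show "locally_causal A g' T' {a..b} (\<Phi> \<circ> \<gamma>) t"
      proof (cases "\<gamma> t \<in> B")
        case True
        obtain U where U: "open U" "t \<in> U" "\<gamma> ` (U \<inter> {a..b}) \<subseteq> B" "chart_causal A g T c {a..b} (U \<inter> {a..b}) \<gamma>"
          by (rule causal_curve_nhd[OF st \<gamma> t c(1) B _ True]) (auto simp: B_def)
        define J where "J = U \<inter> {a..b}"
        obtain u where u: "continuous_on J u"
          "\<And>s. s \<in> J \<Longrightarrow> ((?x \<circ> \<gamma>) has_vector_derivative u s) (at s within {a..b})"
          "\<And>s. s \<in> J \<Longrightarrow> u s \<in> future_cone (component_form A g c (\<gamma> s)) (T (\<gamma> s) c)"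
          using U(4) unfolding chart_causal_def J_def[symmetric] by blast
        have JB: "\<gamma> s \<in> B" if "s \<in> J" for s using U(3) that by (auto simp: J_def)
        have cx: "continuous_on J (?x \<circ> \<gamma>)"
          using u(2) has_vector_derivative_continuous continuous_within_subset[of _ "{a..b}" _ J]
          unfolding continuous_on_eq_continuous_within J_def by blast
        define u' where "u' s = u s + bump' \<rho> x0 ((?x \<circ> \<gamma>) s) (u s) *\<^sub>R w0" for s
        have "chart_causal A g' T' c {a..b} J (\<Phi> \<circ> \<gamma>)"
          unfolding chart_causal_def
        proof (intro conjI exI[of _ u'] ballI)
          show "(\<Phi> \<circ> \<gamma>) ` J \<subseteq> fst c"
          proof (rule image_subsetI)
            fix s assume "s \<in> J"
            then show "(\<Phi> \<circ> \<gamma>) s \<in> fst c" using \<Phi>B[OF JB] N0(3) by auto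
          qed
          show "continuous_on J u'" unfolding u'_def
            by (intro continuous_intros u(1) bump'_continuous cx)
          fix s assume s: "s \<in> J"
          have D: "((?x \<circ> \<gamma>) has_derivative (\<lambda>h. h *\<^sub>R u s)) (at s within {a..b})"
            using u(2)[OF s] by (simp add: has_vector_derivative_def)
          have "((\<lambda>s. bump \<rho> x0 ((?x \<circ> \<gamma>) s)) has_derivative (\<lambda>h. bump' \<rho> x0 ((?x \<circ> \<gamma>) s) (h *\<^sub>R u s))) (at s within {a..b})"
            by (rule has_derivative_compose[OF D bump_derivative])
          then have "((\<lambda>s. bump \<rho> x0 ((?x \<circ> \<gamma>) s)) has_vector_derivative bump' \<rho> x0 ((?x \<circ> \<gamma>) s) (u s)) (at s within {a..b})"
            by (simp add: has_vector_derivative_def bump'_def mult_ac)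
          then have "((\<lambda>s. bump \<rho> x0 ((?x \<circ> \<gamma>) s) *\<^sub>R w0) has_vector_derivative bump' \<rho> x0 ((?x \<circ> \<gamma>) s) (u s) *\<^sub>R w0) (at s within {a..b})"
            using bounded_linear.has_vector_derivative[OF bounded_linear_scaleR_left] by blast
          from has_vector_derivative_add[OF u(2)[OF s] this]
          have "((\<lambda>s. \<phi> ((?x \<circ> \<gamma>) s)) has_vector_derivative u' s) (at s within {a..b})"
            by (simp add: \<phi>_def u'_def o_def)
          then show "((?x \<circ> (\<Phi> \<circ> \<gamma>)) has_vector_derivative u' s) (at s within {a..b})"
            by (rule has_vector_derivative_local[OF _ U(1)]) (use s JB \<Phi>B in \<open>auto simp: J_def\<close>)
          have "norm (u' s - u s) = \<bar>bump' \<rho> x0 ((?x \<circ> \<gamma>) s) (u s)\<bar> * norm w0" by (simp add: u'_def)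
          also have "\<dots> \<le> (4 / \<rho> * norm (u s)) * (4 * \<delta>)"
            by (intro mult_mono bump'_bound \<rho> w0) (use \<rho> in auto)
          also have "\<dots> = (16 * \<delta>) / \<rho> * norm (u s)" by simp
          also have "\<dots> \<le> e * norm (u s)"
            using \<delta>(3) \<rho>(1) by (intro mult_right_mono) (auto simp: field_simps)
          finally show "u' s \<in> future_cone (component_form A g' c ((\<Phi> \<circ> \<gamma>) s)) (T' ((\<Phi> \<circ> \<gamma>) s) c)"
            using robust[OF _ _ u(3)[OF s]] JB[OF s] BN0 \<Phi>B[OF JB[OF s]] by (metis IntD2 comp_apply subsetD)
        qed
        then show ?thesis unfolding locally_causal_def J_def using c(1) U(1,2) by blast
      next
        case False
        then have "\<gamma> t \<in> - K" using \<rho> by (auto simp: B_def K_def)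
        then obtain U where U: "open U" "t \<in> U" "\<gamma> ` (U \<inter> {a..b}) \<subseteq> - K"
          using continuous_on_open_nhd[OF causal_curve_continuous[OF \<gamma>] t open_Compl[OF K]] by blast
        show ?thesis
          by (rule locally_causal_cong[OF causal_curve_locally_causal[OF st' causal_curve_wider[OF w \<gamma>] t] U(1,2)])
            (use \<Phi>K U(3) in \<open>auto simp: image_subset_iff\<close>)
      qed
    qed
    ultimately show ?thesis by blast
  qed
  ultimately show thesis using that[of N] by blast
qed

section \<open>Causal relations of nested metrics\<close>

text \<open>The causal relation without its diagonal part. On the diagonal it records closed causal curves, which
is what the antisymmetry argument needs.\<close>

definition curve_relation where
  "curve_relation A g T = {(x, y). \<exists>a b \<gamma>. future_causal_curve A g T a b \<gamma> \<and> \<gamma> a = x \<and> \<gamma> b = y}"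

lemma causal_relation_eq: "causal_relation A g T = curve_relation A g T \<union> Id"
  by (auto simp: causal_relation_def curve_relation_def)

lemma refl_causal_relation: "refl (causal_relation A g T)"
  by (auto simp: causal_relation_eq refl_on_def)

lemma curve_relation_wider: "wider r A g' T' g T \<Longrightarrow> curve_relation A g T \<subseteq> curve_relation A g' T'"
  unfolding curve_relation_def using causal_curve_wider by blast

lemma causal_relation_wider: "wider r A g' T' g T \<Longrightarrow> causal_relation A g T \<subseteq> causal_relation A g' T'"
  unfolding causal_relation_eq using curve_relation_wider by blast

lemma curve_relation_comp:
  assumes st: "spacetime r A g T" and w: "wider r A g' T' g T"
  shows "curve_relation A g T O curve_relation A g T \<subseteq> curve_relation A g' T'"
proof (rule subrelI)
  fix x z assume "(x, z) \<in> curve_relation A g T O curve_relation A g T"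
  then obtain a b \<gamma>1 a' b' \<gamma>2 where g1: "future_causal_curve A g T a b \<gamma>1" "\<gamma>1 a = x"
    and g2: "future_causal_curve A g T a' b' \<gamma>2" "\<gamma>2 b' = z" and y: "\<gamma>1 b = \<gamma>2 a'"
    unfolding curve_relation_def by force
  have "future_causal_curve A g T (a - b) 0 (\<lambda>t. \<gamma>1 (t + b))"
    "future_causal_curve A g T 0 (b' - a') (\<lambda>t. \<gamma>2 (t + a'))"
    using causal_curve_shift[OF st g1(1), of b] causal_curve_shift[OF st g2(1), of a'] by simp_all
  from causal_curve_join_at_0[OF st w this] y
  obtain \<gamma> where "future_causal_curve A g' T' (a - b) (b' - a') \<gamma>" "\<gamma> (a - b) = x" "\<gamma> (b' - a') = z"
    using g1(2) g2(2) by auto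
  then show "(x, z) \<in> curve_relation A g' T'" unfolding curve_relation_def by blast
qed

lemma causal_relation_comp:
  assumes st: "spacetime r A g T" and w: "wider r A g' T' g T"
  shows "causal_relation A g T O causal_relation A g T \<subseteq> causal_relation A g' T'"
  using curve_relation_comp[OF assms] curve_relation_wider[OF w] unfolding causal_relation_eq by blast

text \<open>The two end points are moved one after the other, inside disjoint neighbourhoods, and each move uses up
half of the room between \<open>g\<close> and \<open>g'\<close>.\<close>

lemma causal_relation_perturbable:
  assumes st: "spacetime r A g T" and w: "wider r A g' T' g T"
  shows "perturbable (causal_relation A g T) (causal_relation A g' T')"
  unfolding perturbable_def
proof (intro allI impI)
  fix x y :: 'a assume "x \<noteq> y"
  then obtain S S' where S: "open S" "open S'" "x \<in> S" "y \<in> S'" "S \<inter> S' = {}" using hausdorff by metis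
  let ?h = "interpolated_metric (1/2) g g'"
  have w1: "wider r A ?h T g T"
    using wider_interpolated[OF st w, of 0 "1/2"] by (simp add: interpolated_metric_0)
  have sth: "spacetime r A ?h T" using w1 by (simp add: wider_def)
  have w2: "wider r A g' T' ?h T" by (rule wider_interpolated_top[OF st w]) auto
  obtain N where N: "open N" "x \<in> N" "N \<subseteq> S"
    and pushN: "\<And>q q'. q \<in> N \<Longrightarrow> q' \<in> N \<Longrightarrow> \<exists>\<Phi>. \<Phi> q = q' \<and> (\<forall>p. p \<notin> S \<longrightarrow> \<Phi> p = p) \<and>
      (\<forall>a b \<gamma>. future_causal_curve A g T a b \<gamma> \<longrightarrow> future_causal_curve A ?h T a b (\<Phi> \<circ> \<gamma>))"
    by (rule push_diffeomorphism[OF st w1 S(1,3)]) blast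
  obtain N' where N': "open N'" "y \<in> N'" "N' \<subseteq> S'"
    and pushN': "\<And>q q'. q \<in> N' \<Longrightarrow> q' \<in> N' \<Longrightarrow> \<exists>\<Phi>. \<Phi> q = q' \<and> (\<forall>p. p \<notin> S' \<longrightarrow> \<Phi> p = p) \<and>
      (\<forall>a b \<gamma>. future_causal_curve A ?h T a b \<gamma> \<longrightarrow> future_causal_curve A g' T' a b (\<Phi> \<circ> \<gamma>))"
    by (rule push_diffeomorphism[OF sth w2 S(2,4)]) blast
  have "(x2, y2) \<in> causal_relation A g' T'"
    if 1: "(x1, y1) \<in> causal_relation A g T" "x1 \<in> N" "y1 \<in> N'" and 2: "x2 \<in> N" "y2 \<in> N'" for x1 y1 x2 y2
  proof -
    have notin: "y1 \<notin> S" "x2 \<notin> S'" "x1 \<noteq> y1" using 1 2 N N' S(5) by blast+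
    then obtain a b \<gamma> where \<gamma>: "future_causal_curve A g T a b \<gamma>" "\<gamma> a = x1" "\<gamma> b = y1"
      using 1(1) unfolding causal_relation_def by blast
    obtain \<Phi> where \<Phi>: "\<Phi> x1 = x2" "\<Phi> y1 = y1" "future_causal_curve A ?h T a b (\<Phi> \<circ> \<gamma>)"
      using pushN[OF 1(2) 2(1)] notin(1) \<gamma>(1) by blast
    obtain \<Psi> where \<Psi>: "\<Psi> y1 = y2" "\<Psi> x2 = x2" "future_causal_curve A g' T' a b (\<Psi> \<circ> (\<Phi> \<circ> \<gamma>))"
      using pushN'[OF 1(3) 2(2)] notin(2) \<Phi>(3) by blast
    moreover have "(\<Psi> \<circ> (\<Phi> \<circ> \<gamma>)) a = x2" "(\<Psi> \<circ> (\<Phi> \<circ> \<gamma>)) b = y2" using \<gamma> \<Phi> \<Psi> by auto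
    ultimately show ?thesis unfolding causal_relation_def by blast
  qed
  then have "causal_relation A g T \<inter> N \<times> N' \<noteq> {} \<longrightarrow> N \<times> N' \<subseteq> causal_relation A g' T'" by blast
  then show "\<exists>N N'. open N \<and> open N' \<and> x \<in> N \<and> y \<in> N' \<and>
      (causal_relation A g T \<inter> N \<times> N' \<noteq> {} \<longrightarrow> N \<times> N' \<subseteq> causal_relation A g' T')"
    using N(1,2) N'(1,2) by blast
qed

text \<open>Closed coordinate balls around \<open>p\<close> whose radius is proportional to the index.\<close>

lemma (in C1_atlas) compact_neighbourhood_family:
  assumes S: "open S" "p \<in> S"
  obtains K :: "real \<Rightarrow> 'm set" where
    "\<And>s. 0 < s \<Longrightarrow> s < 1 \<Longrightarrow> compact (K s)" "\<And>s. 0 < s \<Longrightarrow> s < 1 \<Longrightarrow> p \<in> K s"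
    "\<And>s. 0 < s \<Longrightarrow> s < 1 \<Longrightarrow> K s \<subseteq> S"
    "\<And>s t. 0 < s \<Longrightarrow> s < t \<Longrightarrow> t < 1 \<Longrightarrow> K s \<subseteq> interior (K t)"
proof -
  obtain c where c: "c \<in> A" "p \<in> fst c" using cover by blast
  note chart = charts[OF c(1)]
  obtain \<rho> where \<rho>: "\<rho> > 0" "cball (snd c p) \<rho> \<subseteq> snd c ` fst c"
    "{q \<in> fst c. snd c q \<in> cball (snd c p) \<rho>} \<subseteq> S"
    by (rule chart_cball_radius[OF chart S c(2)])
  define K where "K s = {q \<in> fst c. snd c q \<in> cball (snd c p) (s * \<rho>)}" for s
  have le: "s * \<rho> \<le> \<rho>" if "s < 1" for s using that \<rho>(1) by (simp add: mult_le_cancel_right1)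
  show thesis
  proof (rule that[of K])
    fix s :: real assume s: "0 < s" "s < 1"
    have "cball (snd c p) (s * \<rho>) \<subseteq> snd c ` fst c"
      using subset_cball[OF le[OF s(2)], of "snd c p"] \<rho>(2) by blast
    then show "compact (K s)" unfolding K_def by (intro chart_preimage_compact[OF chart compact_cball])
    show "p \<in> K s" using c s \<rho>(1) by (simp add: K_def)
    show "K s \<subseteq> S" using \<rho>(3) le[OF s(2)] by (force simp: K_def)
  next
    fix s t :: real assume st: "0 < s" "s < t" "t < 1"
    then have "s * \<rho> < t * \<rho>" using \<rho>(1) by simp
    then have "K s \<subseteq> {q \<in> fst c. snd c q \<in> ball (snd c p) (t * \<rho>)}" by (auto simp: K_def)
    also have "\<dots> \<subseteq> interior (K t)"
      by (rule interior_maximal[OF _ chart_preimage_open[OF chart open_ball]]) (auto simp: K_def)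
    finally show "K s \<subseteq> interior (K t)" .
  qed
qed

lemma (in C1_atlas) antitone_function_near:
  fixes R :: "real \<Rightarrow> ('m \<times> 'm) set"
  assumes R_refl: "\<And>s. refl (R s)"
    and R_Q: "\<And>s. 0 < s \<Longrightarrow> s < 1 \<Longrightarrow> Q \<subseteq> R s"
    and R_comp: "\<And>s t. 0 < s \<Longrightarrow> s < t \<Longrightarrow> t < 1 \<Longrightarrow> R s O R s \<subseteq> R t"
    and R_pert: "\<And>s t. 0 < s \<Longrightarrow> s < t \<Longrightarrow> t < 1 \<Longrightarrow> perturbable (R s) (R t)"
    and N: "open N" "x \<in> N"
  obtains f :: "'m \<Rightarrow> real" where "continuous_on UNIV f" "range f \<subseteq> {0..1}"
    "\<And>x y. (x, y) \<in> Q \<Longrightarrow> f y \<le> f x" "f x = 0"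
    "\<And>y. f y < 1 \<Longrightarrow> \<exists>s x'. 0 < s \<and> s < 1 \<and> x' \<in> N \<and> (x', y) \<in> R s"
proof -
  obtain K :: "real \<Rightarrow> 'm set" where K: "\<And>s. 0 < s \<Longrightarrow> s < 1 \<Longrightarrow> compact (K s)"
    "\<And>s. 0 < s \<Longrightarrow> s < 1 \<Longrightarrow> x \<in> K s" "\<And>s. 0 < s \<Longrightarrow> s < 1 \<Longrightarrow> K s \<subseteq> N"
    "\<And>s t. 0 < s \<Longrightarrow> s < t \<Longrightarrow> t < 1 \<Longrightarrow> K s \<subseteq> interior (K t)"
    by (rule compact_neighbourhood_family[OF N]) blast
  obtain f :: "'m \<Rightarrow> real" where f: "continuous_on UNIV f" "range f \<subseteq> {0..1}"
    "\<And>x y. (x, y) \<in> Q \<Longrightarrow> f y \<le> f x"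
    "\<And>x. \<forall>s\<in>{0<..<1}. x \<in> K s \<Longrightarrow> f x = 0"
    "\<And>x. \<forall>s\<in>{0<..<1}. x \<notin> R s `` K s \<Longrightarrow> f x = 1"
    by (rule antitone_function[of R Q K, OF R_refl R_Q R_comp R_pert K(1,4)]) (assumption | rule that)+
  have "\<exists>s x'. 0 < s \<and> s < 1 \<and> x' \<in> N \<and> (x', y) \<in> R s" if y: "f y < 1" for y
  proof -
    have "\<not> (\<forall>s\<in>{0<..<1}. y \<notin> R s `` K s)" using f(5)[of y] y by auto
    then obtain s where "s \<in> {0<..<1}" "y \<in> R s `` K s" by blast
    then have s: "0 < s" "s < 1" "y \<in> R s `` K s" by simp_all
    then obtain x' where "x' \<in> K s" "(x', y) \<in> R s" by blast
    then show ?thesis using K(3)[OF s(1,2)] s(1,2) by blast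
  qed
  moreover have "f x = 0" using f(4) K(2) by simp
  ultimately show thesis using that[of f] f(1-3) by blast
qed

text \<open>The curve is connected and runs from the open ball to the complement of the closed ball. Compactness of
the closed ball, in a Hausdorff space, makes that complement open.\<close>

lemma sphere_crossing:
  assumes st: "spacetime r A g T" and c: "c \<in> A" and \<rho>: "cball x0 \<rho> \<subseteq> snd c ` fst c"
    and a: "a \<in> fst c" "snd c a \<in> ball x0 \<rho>"
    and z: "z \<notin> {q \<in> fst c. snd c q \<in> cball x0 \<rho>}" and az: "(a, z) \<in> causal_relation A g T"
  obtains p where "p \<in> fst c" "snd c p \<in> sphere x0 \<rho>" "(a, p) \<in> curve_relation A g T" "(p, z) \<in> curve_relation A g T"
proof -
  interpret C1_atlas A by (rule spacetime_C1_atlas[OF st])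
  let ?B = "{q \<in> fst c. snd c q \<in> ball x0 \<rho>}" and ?K = "{q \<in> fst c. snd c q \<in> cball x0 \<rho>}"
  have B: "open ?B" by (rule chart_preimage_open[OF charts[OF c] open_ball])
  have K: "closed ?K"
    by (rule compact_imp_closed, rule chart_preimage_compact[OF charts[OF c] compact_cball \<rho>])
  have "a \<noteq> z" using a z by auto
  then obtain \<alpha> \<beta> \<gamma> where \<gamma>: "future_causal_curve A g T \<alpha> \<beta> \<gamma>" "\<gamma> \<alpha> = a" "\<gamma> \<beta> = z"
    using az unfolding causal_relation_def by blast
  have \<alpha>\<beta>: "\<alpha> < \<beta>" using \<gamma>(1) by (simp add: future_causal_curve_def)
  have "connected (\<gamma> ` {\<alpha>..\<beta>})"
    by (rule connected_continuous_image[OF causal_curve_continuous[OF \<gamma>(1)]]) simp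
  moreover have "a \<in> ?B \<inter> \<gamma> ` {\<alpha>..\<beta>}" "z \<in> - ?K \<inter> \<gamma> ` {\<alpha>..\<beta>}" using a z \<gamma> \<alpha>\<beta> by auto
  moreover have "?B \<inter> - ?K \<inter> \<gamma> ` {\<alpha>..\<beta>} = {}" by auto
  ultimately have "\<not> \<gamma> ` {\<alpha>..\<beta>} \<subseteq> ?B \<union> - ?K"
    using connectedD[OF _ B open_Compl[OF K], of "\<gamma> ` {\<alpha>..\<beta>}"] by blast
  then obtain t where t: "t \<in> {\<alpha>..\<beta>}" "\<gamma> t \<notin> ?B" "\<gamma> t \<in> ?K" by blast
  have sph: "\<gamma> t \<in> fst c" "snd c (\<gamma> t) \<in> sphere x0 \<rho>" using t(2,3) by auto
  have "t \<noteq> \<alpha>" using t(2) a \<gamma> by auto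
  moreover have "t \<noteq> \<beta>" using t(3) z \<gamma> by auto
  ultimately have "future_causal_curve A g T \<alpha> t \<gamma>" "future_causal_curve A g T t \<beta> \<gamma>"
    using t(1) causal_curve_sub[OF st \<gamma>(1)] by auto
  then have "(a, \<gamma> t) \<in> curve_relation A g T" "(\<gamma> t, z) \<in> curve_relation A g T"
    unfolding curve_relation_def using \<gamma>(2,3) by blast+
  then show thesis using that sph by blast
qed

text \<open>A tube argument over \<open>S\<close>: near \<open>x\<close> and near each point of \<open>S\<close>, at least one of the two directions
of \<open>R\<close> is absent.\<close>

lemma compact_separation:
  fixes R :: "('a::topological_space \<times> 'a) set"
  assumes S: "compact S" and no: "\<And>p. p \<in> S \<Longrightarrow> (x, p) \<notin> closure R \<or> (p, x) \<notin> closure R"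
  obtains N where "open N" "x \<in> N" "\<And>a b p. a \<in> N \<Longrightarrow> b \<in> N \<Longrightarrow> p \<in> S \<Longrightarrow> (a, p) \<in> R \<Longrightarrow> (p, b) \<notin> R"
proof -
  have "\<exists>N W. open N \<and> open W \<and> x \<in> N \<and> p \<in> W \<and> (N \<times> W \<inter> R = {} \<or> W \<times> N \<inter> R = {})" if p: "p \<in> S" for p
    using no[OF p]
  proof
    assume "(x, p) \<notin> closure R"
    then have "(x, p) \<in> - closure R" by simp
    then obtain N W where "open N" "open W" "(x, p) \<in> N \<times> W" "N \<times> W \<subseteq> - closure R"
      by (rule open_prod_elim[OF open_Compl[OF closed_closure]])
    then show ?thesis using closure_subset[of R] by blast
  next
    assume "(p, x) \<notin> closure R"
    then have "(p, x) \<in> - closure R" by simp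
    then obtain W N where "open W" "open N" "(p, x) \<in> W \<times> N" "W \<times> N \<subseteq> - closure R"
      by (rule open_prod_elim[OF open_Compl[OF closed_closure]])
    then show ?thesis using closure_subset[of R] by blast
  qed
  then obtain N W where NW: "\<And>p. p \<in> S \<Longrightarrow> open (N p) \<and> open (W p) \<and> x \<in> N p \<and> p \<in> W p \<and>
      (N p \<times> W p \<inter> R = {} \<or> W p \<times> N p \<inter> R = {})" by metis
  have "S \<subseteq> (\<Union>p\<in>S. W p)" using NW by blast
  from compactE_image[OF S _ this]
  obtain F where F: "F \<subseteq> S" "finite F" "S \<subseteq> (\<Union>p\<in>F. W p)" using NW by metis
  show thesis
  proof (rule that[of "\<Inter>p\<in>F. N p"])
    show "open (\<Inter>p\<in>F. N p)" using F NW by (intro open_INT) auto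
    show "x \<in> (\<Inter>p\<in>F. N p)" using F(1) NW by blast
    fix a b p assume ab: "a \<in> (\<Inter>p\<in>F. N p)" "b \<in> (\<Inter>p\<in>F. N p)" and p: "p \<in> S" and ap: "(a, p) \<in> R"
    obtain q where q: "q \<in> F" "p \<in> W q" using F(3) p by blast
    then have "N q \<times> W q \<inter> R = {} \<or> W q \<times> N q \<inter> R = {}" using NW F(1) by blast
    then show "(p, b) \<notin> R" using ab q ap by blast
  qed
qed

section \<open>The Seifert relation\<close>

context
  fixes r and A :: "('m::t2_space, 'n::finite) chart set" and g T
  assumes st: "spacetime r A g T"
begin

lemma seifert_subset: "wider r A g' T' g T \<Longrightarrow> seifert_relation r A g T \<subseteq> causal_relation A g' T'"
  unfolding seifert_relation_def by blast

lemma seifert_refl: "refl (seifert_relation r A g T)"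
  using refl_causal_relation unfolding seifert_relation_def refl_on_def by blast

text \<open>Given \<open>g' > g\<close>, both pairs are related by curves of the metric halfway between, and their
concatenation can be rounded within \<open>g'\<close>.\<close>

lemma seifert_trans: "trans (seifert_relation r A g T)"
proof (rule transI)
  fix x y z assume xy: "(x, y) \<in> seifert_relation r A g T" and yz: "(y, z) \<in> seifert_relation r A g T"
  have "(x, z) \<in> causal_relation A g' T'" if w: "wider r A g' T' g T" for g' T'
  proof -
    let ?h = "interpolated_metric (1/2) g g'"
    have w1: "wider r A ?h T g T"
      using wider_interpolated[OF st w, of 0 "1/2"] by (simp add: interpolated_metric_0)
    have w2: "wider r A g' T' ?h T" by (rule wider_interpolated_top[OF st w]) auto
    have "spacetime r A ?h T" using w1 by (simp add: wider_def)
    from causal_relation_comp[OF this w2] seifert_subset[OF w1] xy yz show ?thesis by blast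
  qed
  then show "(x, z) \<in> seifert_relation r A g T" unfolding seifert_relation_def by blast
qed

lemma causal_no_two_way:
  assumes w: "spacetime r A h T" "wider r A g' T' h T" and causal: "causal A g' T'"
    and xy: "(x, y) \<in> causal_relation A h T" "(y, x) \<in> causal_relation A h T"
  shows "x = y"
proof (rule ccontr)
  assume "x \<noteq> y"
  then have "(x, y) \<in> curve_relation A h T" "(y, x) \<in> curve_relation A h T"
    using xy unfolding causal_relation_eq by auto
  then have "(x, x) \<in> curve_relation A g' T'" using curve_relation_comp[OF w] by blast
  then obtain a b \<gamma> where "future_causal_curve A g' T' a b \<gamma>" "\<gamma> a = x" "\<gamma> b = x"
    unfolding curve_relation_def by blast
  then show False using causal unfolding causal_def by metis
qed

lemma interpolated_family:
  assumes w: "wider r A k T' g T" and s: "0 < s" "s < 1"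
  shows "spacetime r A (interpolated_metric s g k) T"
    and "wider r A (interpolated_metric s g k) T g T"
    and "wider r A k T' (interpolated_metric s g k) T"
    and "s < t \<Longrightarrow> t < 1 \<Longrightarrow> wider r A (interpolated_metric t g k) T (interpolated_metric s g k) T"
proof -
  show 1: "wider r A (interpolated_metric s g k) T g T"
    using wider_interpolated[OF st w, of 0 s] s by (simp add: interpolated_metric_0)
  then show "spacetime r A (interpolated_metric s g k) T" by (simp add: wider_def)
  show "wider r A k T' (interpolated_metric s g k) T"
    using s by (intro wider_interpolated_top[OF st w]) auto
  show "s < t \<Longrightarrow> t < 1 \<Longrightarrow> wider r A (interpolated_metric t g k) T (interpolated_metric s g k) T"
    using s by (intro wider_interpolated[OF st w]) auto
qed

lemma seifert_antisym:
  assumes "stably_causal r A g T"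
  shows "antisym (seifert_relation r A g T)"
proof (rule antisymI)
  fix x y assume xy: "(x, y) \<in> seifert_relation r A g T" "(y, x) \<in> seifert_relation r A g T"
  obtain g' T' where w: "wider r A g' T' g T" and causal: "causal A g' T'"
    using assms unfolding stably_causal_def by blast
  note fam = interpolated_family[OF w, of "1/2"]
  have "(x, y) \<in> causal_relation A (interpolated_metric (1/2) g g') T"
    "(y, x) \<in> causal_relation A (interpolated_metric (1/2) g g') T"
    using seifert_subset[OF fam(2)] xy by auto
  then show "x = y" using causal_no_two_way[OF fam(1,3) causal] by simp
qed

lemma interpolated_relations:
  assumes w: "wider r A k T' g T" and s: "0 < s" "s < 1"
  shows "seifert_relation r A g T \<subseteq> causal_relation A (interpolated_metric s g k) T"
    and "causal_relation A (interpolated_metric s g k) T \<subseteq> causal_relation A k T'"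
    and "s < t \<Longrightarrow> t < 1 \<Longrightarrow> causal_relation A (interpolated_metric s g k) T O
      causal_relation A (interpolated_metric s g k) T \<subseteq> causal_relation A (interpolated_metric t g k) T"
    and "s < t \<Longrightarrow> t < 1 \<Longrightarrow> perturbable (causal_relation A (interpolated_metric s g k) T)
      (causal_relation A (interpolated_metric t g k) T)"
proof -
  note fam = interpolated_family[OF w s]
  show "seifert_relation r A g T \<subseteq> causal_relation A (interpolated_metric s g k) T"
    by (rule seifert_subset[OF fam(2)])
  show "causal_relation A (interpolated_metric s g k) T \<subseteq> causal_relation A k T'"
    by (rule causal_relation_wider[OF fam(3)])
  assume t: "s < t" "t < 1"
  show "causal_relation A (interpolated_metric s g k) T O
      causal_relation A (interpolated_metric s g k) T \<subseteq> causal_relation A (interpolated_metric t g k) T"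
    by (rule causal_relation_comp[OF fam(1) fam(4)[OF t]])
  show "perturbable (causal_relation A (interpolated_metric s g k) T)
      (causal_relation A (interpolated_metric t g k) T)"
    by (rule causal_relation_perturbable[OF fam(1) fam(4)[OF t]])
qed

text \<open>The scale consists of the metrics between \<open>g\<close> and \<open>k\<close>, so all its sets lie in the causal future of
\<open>N\<close> with respect to \<open>k\<close>.\<close>

lemma future_function:
  assumes w: "wider r A k T' g T" and N: "open N" "x \<in> N"
  obtains f where "f \<in> isotone_functions (seifert_relation r A g T)" "f x = 1"
    "\<And>y. f y > 0 \<Longrightarrow> \<exists>x'\<in>N. (x', y) \<in> causal_relation A k T'"
proof -
  interpret C1_atlas A by (rule spacetime_C1_atlas[OF st])
  define J where "J s = causal_relation A (interpolated_metric s g k) T" for s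
  note J = interpolated_relations[OF w, folded J_def]
  have J_refl: "refl (J s)" for s unfolding J_def by (rule refl_causal_relation)
  have J_step: "J s O J s \<subseteq> J t" "perturbable (J s) (J t)" if "0 < s" "s < t" "t < 1" for s t
    using J(3,4)[of s t] that by simp_all
  obtain f :: "'m \<Rightarrow> real" where f: "continuous_on UNIV f" "range f \<subseteq> {0..1}"
    "\<And>x y. (x, y) \<in> seifert_relation r A g T \<Longrightarrow> f y \<le> f x" "f x = 0"
    "\<And>y. f y < 1 \<Longrightarrow> \<exists>s x'. 0 < s \<and> s < 1 \<and> x' \<in> N \<and> (x', y) \<in> J s"
    by (rule antitone_function_near[of J "seifert_relation r A g T" N x, OF J_refl J(1) J_step N])
      (assumption | rule that)+
  show thesis
  proof (rule that[of "\<lambda>y. 1 - f y"])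
    show "(\<lambda>y. 1 - f y) \<in> isotone_functions (seifert_relation r A g T)"
      using f(1-3) by (auto simp: isotone_functions_def image_subset_iff intro: continuous_on_diff)
    show "1 - f x = 1" using f(4) by simp
    fix y assume "1 - f y > 0"
    then obtain s x' where "0 < s" "s < 1" "x' \<in> N" "(x', y) \<in> J s" using f(5)[of y] by auto
    then show "\<exists>x'\<in>N. (x', y) \<in> causal_relation A k T'" using J(2) by blast
  qed
qed

text \<open>The converse relations satisfy the same hypotheses, and a function that decreases along the converse of
the Seifert relation is isotone.\<close>

lemma past_function:
  assumes w: "wider r A k T' g T" and N: "open N" "x \<in> N"
  obtains f where "f \<in> isotone_functions (seifert_relation r A g T)" "f x = 0"
    "\<And>y. f y < 1 \<Longrightarrow> \<exists>x'\<in>N. (y, x') \<in> causal_relation A k T'"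
proof -
  interpret C1_atlas A by (rule spacetime_C1_atlas[OF st])
  define J where "J s = causal_relation A (interpolated_metric s g k) T" for s
  note J = interpolated_relations[OF w, folded J_def]
  have J_refl: "refl ((J s)\<inverse>)" for s unfolding J_def using refl_causal_relation by simp
  have J_Q: "(seifert_relation r A g T)\<inverse> \<subseteq> (J s)\<inverse>" if "0 < s" "s < 1" for s
    using J(1)[OF that] by blast
  have J_step: "(J s)\<inverse> O (J s)\<inverse> \<subseteq> (J t)\<inverse>" "perturbable ((J s)\<inverse>) ((J t)\<inverse>)"
    if "0 < s" "s < t" "t < 1" for s t
  proof -
    have "J s O J s \<subseteq> J t" using J(3)[of s t] that by simp
    then show "(J s)\<inverse> O (J s)\<inverse> \<subseteq> (J t)\<inverse>" by blast
    show "perturbable ((J s)\<inverse>) ((J t)\<inverse>)" using J(4)[of s t] that by (intro perturbable_converse) simp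
  qed
  obtain f :: "'m \<Rightarrow> real" where f: "continuous_on UNIV f" "range f \<subseteq> {0..1}"
    "\<And>x y. (x, y) \<in> (seifert_relation r A g T)\<inverse> \<Longrightarrow> f y \<le> f x" "f x = 0"
    "\<And>y. f y < 1 \<Longrightarrow> \<exists>s x'. 0 < s \<and> s < 1 \<and> x' \<in> N \<and> (x', y) \<in> (J s)\<inverse>"
    by (rule antitone_function_near[of "\<lambda>s. (J s)\<inverse>" "(seifert_relation r A g T)\<inverse>" N x,
          OF J_refl J_Q J_step N]) (assumption | rule that)+
  show thesis
  proof (rule that[of f])
    show "f \<in> isotone_functions (seifert_relation r A g T)"
      using f(1-3) by (auto simp: isotone_functions_def)
    show "f x = 0" by (rule f(4))
    fix y assume "f y < 1"
    then obtain s x' where "0 < s" "s < 1" "x' \<in> N" "(y, x') \<in> J s" using f(5)[of y] by auto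
    then show "\<exists>x'\<in>N. (y, x') \<in> causal_relation A k T'" using J(2) by blast
  qed
qed

text \<open>Halfway to a metric \<open>g'\<close> with \<open>(x, y) \<notin> J g'\<close>, the pair is not even in the closure of the causal
relation, so \<open>y\<close> is not in the future of a whole neighbourhood of \<open>x\<close>.\<close>

lemma seifert_separation:
  assumes "(x, y) \<notin> seifert_relation r A g T"
  shows "\<exists>f \<in> isotone_functions (seifert_relation r A g T). f y < f x"
proof -
  obtain k T' where w: "wider r A k T' g T" and xy: "(x, y) \<notin> causal_relation A k T'"
    using assms unfolding seifert_relation_def by blast
  let ?h = "interpolated_metric (1/2) g k"
  have fam: "spacetime r A ?h T" "wider r A ?h T g T" "wider r A k T' ?h T"
    using interpolated_family[OF w, of "1/2"] by simp_all
  have "(x, y) \<notin> closure (causal_relation A ?h T)"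
    using perturbable_closure[OF causal_relation_perturbable[OF fam(1,3)] refl_causal_relation] xy by blast
  then have "(x, y) \<in> - closure (causal_relation A ?h T)" by simp
  then obtain N N' where "open N" "open N'" "(x, y) \<in> N \<times> N'" "N \<times> N' \<subseteq> - closure (causal_relation A ?h T)"
    by (rule open_prod_elim[OF open_Compl[OF closed_closure]])
  then have N: "open N" "x \<in> N" "y \<in> N'" "N \<times> N' \<subseteq> - closure (causal_relation A ?h T)" by auto
  obtain f where f: "f \<in> isotone_functions (seifert_relation r A g T)" "f x = 1"
    "\<And>y. f y > 0 \<Longrightarrow> \<exists>x'\<in>N. (x', y) \<in> causal_relation A ?h T"
    using future_function[OF fam(2) N(1,2)] by metis
  have "\<not> f y > 0" using f(3)[of y] N(3,4) closure_subset[of "causal_relation A ?h T"] by blast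
  then show ?thesis using f(1,2) by (intro bexI[of _ f]) auto
qed

text \<open>A causal curve that leaves a ball around \<open>x\<close> and returns crosses the bounding sphere. If this happened
for curves with ends arbitrarily near \<open>x\<close>, compactness of the sphere would give a point \<open>p\<close> on it causally
related to \<open>x\<close> in both directions, hence a closed causal curve for \<open>g'\<close>. Three intermediate metrics are
used: one for the curves, one to join their pieces, and one to pass to the limit.\<close>

lemma stable_strong_causality:
  assumes w: "wider r A g' T' g T" and causal: "causal A g' T'" and S: "open S" "x \<in> S"
  obtains k N where "wider r A k T g T" "open N" "x \<in> N"
    "\<And>a b z. a \<in> N \<Longrightarrow> b \<in> N \<Longrightarrow> (a, z) \<in> causal_relation A k T \<Longrightarrow> (z, b) \<in> causal_relation A k T \<Longrightarrow> z \<in> S"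
proof -
  interpret C1_atlas A by (rule spacetime_C1_atlas[OF st])
  define h where "h s = interpolated_metric s g g'" for s
  note fam = interpolated_family[OF w, folded h_def]
  have st_h: "spacetime r A (h (1/4)) T" "spacetime r A (h (1/2)) T" "spacetime r A (h (3/4)) T"
    and w_h: "wider r A (h (1/4)) T g T" "wider r A (h (1/2)) T (h (1/4)) T"
      "wider r A (h (3/4)) T (h (1/2)) T" "wider r A g' T' (h (3/4)) T"
    using fam[of "1/4"] fam[of "1/2"] fam[of "3/4"] by simp_all
  obtain c where c: "c \<in> A" "x \<in> fst c" using cover by blast
  note chart = charts[OF c(1)]
  define x0 where "x0 = snd c x"
  obtain \<rho> where \<rho>: "\<rho> > 0" "cball x0 \<rho> \<subseteq> snd c ` fst c" "{q \<in> fst c. snd c q \<in> cball x0 \<rho>} \<subseteq> S"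
    unfolding x0_def by (rule chart_cball_radius[OF chart S c(2)])
  define \<Sigma> where "\<Sigma> = {p \<in> fst c. snd c p \<in> sphere x0 \<rho>}"
  have \<Sigma>: "compact \<Sigma>" unfolding \<Sigma>_def
    by (rule chart_preimage_compact[OF chart compact_sphere]) (use \<rho>(2) in auto)
  have no: "(x, p) \<notin> closure (causal_relation A (h (1/2)) T) \<or> (p, x) \<notin> closure (causal_relation A (h (1/2)) T)"
    if p: "p \<in> \<Sigma>" for p
  proof (rule ccontr)
    assume "\<not> ?thesis"
    then have "(x, p) \<in> causal_relation A (h (3/4)) T" "(p, x) \<in> causal_relation A (h (3/4)) T"
      using perturbable_closure[OF causal_relation_perturbable[OF st_h(2) w_h(3)] refl_causal_relation] by auto
    then have "x = p" by (rule causal_no_two_way[OF st_h(3) w_h(4) causal])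
    then show False using p \<rho>(1) by (simp add: \<Sigma>_def x0_def)
  qed
  obtain N where N: "open N" "x \<in> N"
    and sep: "\<And>a b p. a \<in> N \<Longrightarrow> b \<in> N \<Longrightarrow> p \<in> \<Sigma> \<Longrightarrow> (a, p) \<in> causal_relation A (h (1/2)) T \<Longrightarrow>
      (p, b) \<notin> causal_relation A (h (1/2)) T"
    using compact_separation[OF \<Sigma> no] by metis
  let ?B = "{q \<in> fst c. snd c q \<in> ball x0 \<rho>}"
  show thesis
  proof (rule that[of "h (1/4)" "N \<inter> ?B"])
    show "wider r A (h (1/4)) T g T" by (rule w_h(1))
    show "open (N \<inter> ?B)" by (intro open_Int N(1) chart_preimage_open[OF chart open_ball])
    show "x \<in> N \<inter> ?B" using N(2) c(2) \<rho>(1) by (simp add: x0_def)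
    fix a b z assume a: "a \<in> N \<inter> ?B" and b: "b \<in> N \<inter> ?B"
      and az: "(a, z) \<in> causal_relation A (h (1/4)) T" and zb: "(z, b) \<in> causal_relation A (h (1/4)) T"
    show "z \<in> S"
    proof (rule ccontr)
      assume "z \<notin> S"
      then have z: "z \<notin> {q \<in> fst c. snd c q \<in> cball x0 \<rho>}" using \<rho>(3) by blast
      have a': "a \<in> fst c" "snd c a \<in> ball x0 \<rho>" using a by auto
      obtain p where p: "p \<in> fst c" "snd c p \<in> sphere x0 \<rho>"
        "(a, p) \<in> curve_relation A (h (1/4)) T" "(p, z) \<in> curve_relation A (h (1/4)) T"
        by (rule sphere_crossing[OF st_h(1) c(1) \<rho>(2) a' z az])
      have "(p, b) \<in> causal_relation A (h (1/2)) T"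
        using causal_relation_comp[OF st_h(1) w_h(2)] p(4) zb unfolding causal_relation_eq by blast
      moreover have "(a, p) \<in> causal_relation A (h (1/2)) T"
        using curve_relation_wider[OF w_h(2)] p(3) unfolding causal_relation_eq by blast
      moreover have "p \<in> \<Sigma>" using p(1,2) by (simp add: \<Sigma>_def)
      ultimately show False using sep a b by blast
    qed
  qed
qed

lemma seifert_initial_topology:
  assumes "stably_causal r A g T" and S: "open S" "x \<in> S"
  shows "\<exists>f \<in> isotone_functions (seifert_relation r A g T).
    \<exists>h \<in> isotone_functions (seifert_relation r A g T).
       f x = 1 \<and> h x = 0 \<and> {y. 0 < f y \<and> h y < 1} \<subseteq> S"
proof -
  obtain g' T' where w: "wider r A g' T' g T" and causal: "causal A g' T'"
    using assms(1) unfolding stably_causal_def by blast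
  obtain k N where k: "wider r A k T g T" and N: "open N" "x \<in> N"
    and sub: "\<And>a b z. a \<in> N \<Longrightarrow> b \<in> N \<Longrightarrow> (a, z) \<in> causal_relation A k T \<Longrightarrow>
      (z, b) \<in> causal_relation A k T \<Longrightarrow> z \<in> S"
    using stable_strong_causality[OF w causal S] by metis
  obtain f where f: "f \<in> isotone_functions (seifert_relation r A g T)" "f x = 1"
    "\<And>y. f y > 0 \<Longrightarrow> \<exists>x'\<in>N. (x', y) \<in> causal_relation A k T"
    using future_function[OF k N] by metis
  obtain h where h: "h \<in> isotone_functions (seifert_relation r A g T)" "h x = 0"
    "\<And>y. h y < 1 \<Longrightarrow> \<exists>x'\<in>N. (y, x') \<in> causal_relation A k T"
    using past_function[OF k N] by metis
  have "{y. 0 < f y \<and> h y < 1} \<subseteq> S" using f(3) h(3) sub by blast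
  then show ?thesis using f h by blast
qed

end

theorem theorem4p15:
  fixes r :: enat
    and A :: "('m::t2_space, 'n::finite) chart set"
    and g :: "('m, 'n) metric"
    and T :: "'m \<Rightarrow> ('m, 'n) tangent"
  assumes "spacetime r A g T"
    and "stably_causal r A g T"
  shows "quasi_uniformizable (seifert_relation r A g T) \<and>
    admits_nachbin_compactification (seifert_relation r A g T)"
proof
  let ?Q = "seifert_relation r A g T"
  show "quasi_uniformizable ?Q"
    by (rule quasi_uniformizable_isotone[OF seifert_separation[OF assms(1)]
          seifert_initial_topology[OF assms]])
  have "partial_order_on UNIV ?Q"
    using seifert_refl[OF assms(1)] seifert_trans[OF assms(1)] seifert_antisym[OF assms]
    by (simp add: partial_order_on_def preorder_on_def)
  then show "admits_nachbin_compactification ?Q"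
    by (rule nachbin_compactification_isotone[OF _ seifert_separation[OF assms(1)]
          seifert_initial_topology[OF assms]])
qed

end
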